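(* Let $s>5/2$. Assume $u_o\in H^s(S^1)$ has nonzero mean $\mu(u_o)\neq 0$ and satisfies $$Au_o(x)=\mu(u_o)-u_o''(x)\ge 0\quad\text{for all }x\in S^1.$$ Then the Cauchy problem $$u_t+uu_x+A^{-1}\partial_x\Big(2\mu(u)u+\tfrac12u_x^2\Big)=0,\qquad u(0,x)=u_o(x),$$ has a unique global solution $u\in C(\mathbb{R},H^s(S^1))\cap C^1(\mathbb{R},H^{s-1}(S^1))$. (The same holds if instead $Au_o\le 0$ on $S^1$.)
   Context: $S^1=\mathbb{R}/\mathbb{Z}$, $\mu(u)=\int_{S^1}u\,dx$, $A=\mu-\partial_x^2$, i.e. $Av=\mu(v)-v_{xx}$, an isomorphism $H^s\to H^{s-2}$ commuting with $\partial_x$. *)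

theory Defs
  imports "HOL-Analysis.Analysis"
begin

text \<open>Functions on the circle S^1 = R/Z are represented as 1-periodic functions real => real.\<close>

definition periodic1 :: "(real \<Rightarrow> real) \<Rightarrow> bool" where
  "periodic1 u \<longleftrightarrow> (\<forall>x. u (x + 1) = u x)"

definition mu :: "(real \<Rightarrow> real) \<Rightarrow> real" where
  "mu u = integral {0..1} u"

definition fcoeff :: "(real \<Rightarrow> real) \<Rightarrow> int \<Rightarrow> complex" where
  "fcoeff u k = integral {0..1} (\<lambda>x. complex_of_real (u x) * cis (- (2 * pi * of_int k * x)))"

definition Hs_weight :: "real \<Rightarrow> (real \<Rightarrow> real) \<Rightarrow> int \<Rightarrow> real" where
  "Hs_weight s u k = (1 + (2 * pi * of_int k)\<^sup>2) powr s * (cmod (fcoeff u k))\<^sup>2"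

text \<open>Membership in H^s(S^1), by continuous representatives (all orders used below exceed 1/2)\<close>
definition in_Hs :: "real \<Rightarrow> (real \<Rightarrow> real) \<Rightarrow> bool" where
  "in_Hs s u \<longleftrightarrow> periodic1 u \<and> continuous_on UNIV u \<and> (Hs_weight s u summable_on UNIV)"

definition Hs_norm :: "real \<Rightarrow> (real \<Rightarrow> real) \<Rightarrow> real" where
  "Hs_norm s u = sqrt (infsum (Hs_weight s u) UNIV)"

definition cont_Hs :: "real \<Rightarrow> (real \<Rightarrow> real \<Rightarrow> real) \<Rightarrow> bool" where
  "cont_Hs s U \<longleftrightarrow> (\<forall>t. in_Hs s (U t)) \<and>
     (\<forall>t0. ((\<lambda>t. Hs_norm s (\<lambda>x. U t x - U t0 x)) \<longlongrightarrow> 0) (at t0))"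

definition has_Hs_deriv :: "real \<Rightarrow> (real \<Rightarrow> real \<Rightarrow> real) \<Rightarrow> (real \<Rightarrow> real \<Rightarrow> real) \<Rightarrow> bool" where
  "has_Hs_deriv s U U' \<longleftrightarrow> (\<forall>t. in_Hs s (U t)) \<and> (\<forall>t. in_Hs s (U' t)) \<and>
     (\<forall>t0. ((\<lambda>t. Hs_norm s (\<lambda>x. (U t x - U t0 x) / (t - t0) - U' t0 x)) \<longlongrightarrow> 0) (at t0))"

definition C1_Hs_with :: "real \<Rightarrow> (real \<Rightarrow> real \<Rightarrow> real) \<Rightarrow> (real \<Rightarrow> real \<Rightarrow> real) \<Rightarrow> bool" where
  "C1_Hs_with s U U' \<longleftrightarrow> has_Hs_deriv s U U' \<and> cont_Hs s U'"

definition C2 :: "(real \<Rightarrow> real) \<Rightarrow> bool" where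
  "C2 w \<longleftrightarrow> (\<forall>x. (w has_real_derivative deriv w x) (at x) \<and>
              (deriv w has_real_derivative deriv (deriv w) x) (at x)) \<and>
           continuous_on UNIV (deriv (deriv w))"

definition opA :: "(real \<Rightarrow> real) \<Rightarrow> real \<Rightarrow> real" where
  "opA v x = mu v - deriv (deriv v) x"

definition opA_inv :: "(real \<Rightarrow> real) \<Rightarrow> real \<Rightarrow> real" where
  "opA_inv g = (THE w. periodic1 w \<and> C2 w \<and> (\<forall>x. opA w x = g x))"

definition is_global_solution :: "real \<Rightarrow> (real \<Rightarrow> real) \<Rightarrow> (real \<Rightarrow> real \<Rightarrow> real) \<Rightarrow> bool" where
  "is_global_solution s u0 U \<longleftrightarrow>
     cont_Hs s U \<and>
     (\<exists>U'. C1_Hs_with (s - 1) U U' \<and>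
        (\<forall>t x. U' t x + U t x * deriv (U t) x
           + opA_inv (deriv (\<lambda>y. 2 * mu (U t) * U t y + 1/2 * (deriv (U t) y)\<^sup>2)) x = 0)) \<and>
     U 0 = u0"

end

theory Submission
  imports Defs
begin

text \<open>
  On the Fourier side the equation becomes the infinite system
  \<open>a\<^sub>k' = \<Sum>\<^sub>j - \<i> \<gamma>(k, j) a\<^sub>j a\<^sub>k\<^sub>-\<^sub>j\<close>. Up to a skew part, its symbol weighted by \<open>\<langle>k\<rangle>\<^sup>2\<^sup>s\<close> loses
  no derivative, so the \<open>H\<^sup>s\<close> energy grows at a rate proportional to \<open>\<Sum> \<langle>k\<rangle> |a\<^sub>k|\<close>. Galerkin truncations
  therefore live on a time interval depending only on the initial norm, and an \<open>\<ell>\<^sup>2\<close> comparison of a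
  truncation with any solution yields convergence, uniqueness, and the energy bound for the limit.

  Since \<open>A\<^sup>-\<^sup>1 \<partial>\<^sub>x f\<close> has derivative \<open>\<mu>(f) - f\<close>, the slope \<open>v = u\<^sub>x\<close> satisfies
  \<open>v\<^sub>t = - u v\<^sub>x - v\<^sup>2/2 + 2 \<mu> u - c(t)\<close>. A maximum principle with doubled variables for
  \<open>v(y) - v(x) - \<mu> (y - x)\<close> propagates \<open>u\<^sub>x\<^sub>x \<le> \<mu>\<close>, which bounds \<open>|u\<^sub>x|\<close>; the same argument from
  below bounds \<open>u\<^sub>x\<^sub>x\<close>. Bessel's inequality then bounds \<open>\<Sum> \<langle>k\<rangle> |a\<^sub>k|\<close> on every finite time interval, so
  the solution is global. The symmetry \<open>x \<mapsto> -x, t \<mapsto> -t\<close> gives negative times, and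
  \<open>u(t, x) \<mapsto> - u(-t, x)\<close> the case \<open>A u\<^sub>o \<le> 0\<close>.
\<close>

text \<open>The momentum lies in H^(s-2) only: continuous, but possibly without a derivative to
  transport, so its sign is carried by difference quotients of the slope. The sign bounds
  \<open>u_xx\<close> from one side; periodicity turns this into a bound of \<open>|u_x|\<close> by
  the mean, independent of the Sobolev norm, and only then does the other side of
  \<open>u_xx\<close> obey a linear differential inequality. Both sides are needed because the
  energy rate is an absolutely convergent Fourier sum, not the supremum of the slope.

  The energy identity cannot be applied to a solution in H^s directly, since the nonlinearity lies
  in H^(s-1) only. It is proved on finite frequency sets with constants independent of the set, and
  inherited by limits. The threshold 5/2 is where the sum of \<open>jb k ^ 2 * |a_k|\<close>
  converges: it makes \<open>u_xx\<close> continuous and is the rate in the comparison of two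
  solutions. The energy bound starts at the exact initial norm with a factor tending to 1; applied
  in both time directions, this gives strong continuity in H^s, which limits of truncations alone do
  not provide.\<close>

subsection \<open>Ordinary differential equations\<close>

text \<open>In the supremum norm weighted by \<open>exp (- 2 L t)\<close> the Picard operator is a contraction on the whole interval.\<close>

lemma picard_lipschitz:
  fixes F :: "'a::banach \<Rightarrow> 'a"
  assumes T: "T \<ge> 0" and L: "L > 0" and lip: "\<And>x y. norm (F x - F y) \<le> L * norm (x - y)"
  obtains y where "y 0 = x0"
    "\<And>t. t \<in> {0..T} \<Longrightarrow> (y has_vector_derivative F (y t)) (at t within {0..T})"
proof -
  have contF: "continuous_on UNIV F"
    by (rule lipschitz_on_continuous_on[of L]) (use L lip in \<open>auto intro!: lipschitz_onI simp: dist_norm\<close>)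
  define lam where "lam = 2 * L"
  have lam: "lam > 0" using L by (simp add: lam_def)
  \<comment> \<open>Functions on [0,T] are modelled by bounded continuous functions on the whole
    line, frozen outside the interval by clamping the argument. The fixed point \<open>z\<close>
    below is the solution times \<open>exp (- lam * t)\<close>; \<open>lam = 2 * L\<close> makes the
    contraction factor 1/2.\<close>
  define c where "c t = max 0 (min T t)" for t :: real
  have c: "c t \<in> {0..T}" for t using T by (auto simp: c_def)
  have ccont: "continuous_on UNIV c" unfolding c_def by (intro continuous_intros)
  define G :: "(real \<Rightarrow>\<^sub>C 'a) \<Rightarrow> real \<Rightarrow> 'a" where
    "G z t = F (exp (lam * t) *\<^sub>R apply_bcontfun z t)" for z t
  have contG: "continuous_on A (G z)" for A z
    unfolding G_def
    by (rule continuous_on_subset[OF continuous_on_compose2[OF contF]]) (auto intro!: continuous_intros)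
  define Phi :: "(real \<Rightarrow>\<^sub>C 'a) \<Rightarrow> real \<Rightarrow> 'a" where
    "Phi z t = exp (- lam * t) *\<^sub>R (x0 + integral {0..t} (G z))" for z t
  have contPhi: "continuous_on {0..T} (Phi z)" for z
    unfolding Phi_def
    by (intro continuous_intros indefinite_integral_continuous_1 integrable_continuous_real contG)
  have inb: "(\<lambda>t. Phi z (c t)) \<in> bcontfun" for z
  proof -
    have "bounded (Phi z ` {0..T})"
      by (intro compact_imp_bounded compact_continuous_image contPhi) auto
    then obtain B where B: "\<forall>t\<in>{0..T}. norm (Phi z t) \<le> B" unfolding bounded_iff by auto
    show ?thesis
      by (rule bcontfun_normI[of _ B], rule continuous_on_compose2[OF contPhi ccont])
         (use c B in auto)
  qed
  define PP where "PP z = Bcontfun (\<lambda>t. Phi z (c t))" for z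
  have PP: "apply_bcontfun (PP z) t = Phi z (c t)" for z t
    unfolding PP_def by (simp add: Bcontfun_inverse[OF inb])
  have contr: "dist (PP z) (PP w) \<le> (1/2) * dist z w" for z w
  proof (rule dist_bound)
    fix t
    define r where "r = c t"
    have r: "r \<in> {0..T}" using c r_def by auto
    have *: "norm (G z x - G w x) \<le> L * exp (lam * x) * dist z w" for x
    proof -
      have "norm (G z x - G w x) \<le> L * norm (exp (lam * x) *\<^sub>R z x - exp (lam * x) *\<^sub>R w x)"
        unfolding G_def by (rule lip)
      also have "\<dots> = L * exp (lam * x) * dist (apply_bcontfun z x) (apply_bcontfun w x)"
        by (simp add: dist_norm flip: scaleR_diff_right)
      also have "\<dots> \<le> L * exp (lam * x) * dist z w"
        using L by (intro mult_left_mono dist_bounded) auto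
      finally show ?thesis .
    qed
    have ii: "((\<lambda>x. exp (lam * x)) has_integral (exp (lam * r) / lam - exp (lam * 0) / lam)) {0..r}"
      by (rule fundamental_theorem_of_calculus)
         (use r lam in \<open>auto intro!: derivative_eq_intros simp flip: has_real_derivative_iff_has_vector_derivative\<close>)
    have "norm (integral {0..r} (\<lambda>x. G z x - G w x)) \<le> integral {0..r} (\<lambda>x. L * exp (lam * x) * dist z w)"
      by (rule integral_norm_bound_integral)
         (use * in \<open>auto intro!: integrable_continuous_real continuous_intros contG\<close>)
    also have "\<dots> = L * dist z w * integral {0..r} (\<lambda>x. exp (lam * x))"
      by (subst integral_mult_right[symmetric]) (simp add: mult_ac)
    also have "\<dots> = L * dist z w * ((exp (lam * r) - 1) / lam)"
      using ii by (simp add: integral_unique diff_divide_distrib)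
    also have "\<dots> = dist z w * (exp (lam * r) - 1) / 2" using L by (simp add: lam_def)
    finally have n: "norm (integral {0..r} (\<lambda>x. G z x - G w x)) \<le> dist z w * (exp (lam * r) - 1) / 2" .
    have "dist (PP z t) (PP w t) = norm (exp (- lam * r) *\<^sub>R (integral {0..r} (\<lambda>x. G z x - G w x)))"
      unfolding PP r_def[symmetric] Phi_def dist_norm
      by (subst integral_diff) (auto intro!: integrable_continuous_real contG simp flip: scaleR_diff_right)
    also have "\<dots> \<le> exp (- lam * r) * (dist z w * (exp (lam * r) - 1) / 2)"
      using n by (simp)
    also have "\<dots> \<le> exp (- lam * r) * (dist z w * exp (lam * r) / 2)"
      by (intro mult_left_mono divide_right_mono) auto
    also have "\<dots> = (1/2) * dist z w" by (simp add: exp_minus)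
    finally show "dist (PP z t) (PP w t) \<le> (1/2) * dist z w" .
  qed
  have "\<exists>!z. PP z = z"
    by (rule banach_fix_type[of "1/2"]) (use contr in auto)
  then obtain z where z: "PP z = z" by auto
  define y where "y t = exp (lam * t) *\<^sub>R apply_bcontfun z t" for t
  have yeq: "y t = x0 + integral {0..t} (G z)" if "t \<in> {0..T}" for t
  proof -
    have "c t = t" using that by (auto simp: c_def)
    then have "apply_bcontfun z t = Phi z t" using PP[of z t] z by simp
    then show ?thesis by (simp add: y_def Phi_def exp_minus)
  qed
  have "(y has_vector_derivative F (y t)) (at t within {0..T})" if t: "t \<in> {0..T}" for t
  proof -
    have "((\<lambda>t. x0 + integral {0..t} (G z)) has_vector_derivative (0 + G z t)) (at t within {0..T})"
      by (intro has_vector_derivative_add has_vector_derivative_const integral_has_vector_derivative contG t)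
    then have "((\<lambda>t. x0 + integral {0..t} (G z)) has_vector_derivative F (y t)) (at t within {0..T})"
      by (simp add: G_def y_def)
    then show ?thesis
      using has_vector_derivative_transform[OF t, of y "\<lambda>t. x0 + integral {0..t} (G z)"] yeq by auto
  qed
  moreover have "y 0 = x0" using yeq[of 0] T by simp
  ultimately show ?thesis using that by blast
qed

text \<open>The function \<open>y t * exp (- K * t) - e * t\<close> is nonincreasing: the source
  \<open>e\<close> only appears multiplied by an exponential that is at most 1.\<close>

lemma gronwall:
  fixes y :: "real \<Rightarrow> real"
  assumes d: "\<And>t. t \<in> {0..T} \<Longrightarrow> (y has_real_derivative y' t) (at t within {0..T})"
    and le: "\<And>t. t \<in> {0..T} \<Longrightarrow> y' t \<le> K * y t + e"
    and K: "K \<ge> 0" and e: "e \<ge> 0" and t: "t \<in> {0..T}"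
  shows "y t \<le> (y 0 + e * t) * exp (K * t)"
proof -
  define g where "g t = y t * exp (- K * t) - e * t" for t
  have dg: "(g has_real_derivative (y' s * exp (- K * s) - K * exp (- K * s) * y s - e)) (at s within {0..T})"
    if "s \<in> {0..T}" for s
    unfolding g_def by (rule derivative_eq_intros d that refl | simp)+
  have "g t \<le> g 0"
  proof (rule DERIV_nonpos_imp_decreasing_open[of 0 t g])
    show "0 \<le> t" using t by auto
    show "continuous_on {0..t} g"
      by (rule continuous_on_subset[OF DERIV_continuous_on[OF dg]]) (use t in auto)
    fix s assume s: "0 < s" "s < t"
    then have s': "s \<in> {0..T}" using t by auto
    have "at s within {0..T} = at s" using s t by (intro at_within_interior) auto
    moreover have "y' s * exp (- K * s) - K * exp (- K * s) * y s - e \<le> 0"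
    proof -
      have "(y' s - K * y s) * exp (- K * s) \<le> e * 1"
        using le[OF s'] K s e by (intro mult_mono) auto
      then show ?thesis by (simp add: algebra_simps)
    qed
    ultimately show "\<exists>y. (g has_real_derivative y) (at s) \<and> y \<le> 0" using dg[OF s'] by auto
  qed
  then have "y t * exp (- K * t) \<le> y 0 + e * t" by (simp add: g_def)
  then have "y t * exp (- K * t) * exp (K * t) \<le> (y 0 + e * t) * exp (K * t)"
    by (intro mult_right_mono) auto
  then show ?thesis by (simp add: mult.assoc flip: exp_add)
qed

text \<open>Under y' <= C y^(3/2) the quantity 1 / sqrt y falls at rate at most C/2, so it stays
  away from 0 for a time of order 1 / (C R). Shifting \<open>y\<close> by R^2 keeps the root
  positive, and y 0 + R^2 <= 2 R^2 < (3R/2)^2 starts \<open>q\<close> at 2/(3R) or more; a loss of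
  at most 1/(4R) leaves more than 1/(3R), whence the factor 3.\<close>

lemma riccati_bound:
  fixes y :: "real \<Rightarrow> real"
  assumes d: "\<And>t. t \<in> {0..T} \<Longrightarrow> (y has_real_derivative y' t) (at t within {0..T})"
    and le: "\<And>t. t \<in> {0..T} \<Longrightarrow> y' t \<le> C * y t * sqrt (y t)"
    and nn: "\<And>t. t \<in> {0..T} \<Longrightarrow> y t \<ge> 0"
    and C: "C > 0" and R: "R > 0" and y0: "y 0 \<le> R\<^sup>2" and T: "C * R * T \<le> 1/2" and t: "t \<in> {0..T}"
  shows "y t \<le> (3 * R)\<^sup>2"
proof -
  define q where "q t = 1 / sqrt (y t + R\<^sup>2)" for t
  have pos: "y s + R\<^sup>2 > 0" if "s \<in> {0..T}" for s using nn[OF that] R by (simp add: add_nonneg_pos)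
  have dq: "((\<lambda>t. q t + C/2 * t) has_real_derivative
      (- (y' s / (2 * sqrt (y s + R\<^sup>2))) / (y s + R\<^sup>2) + C/2)) (at s within {0..T})"
    if "s \<in> {0..T}" for s
  proof -
    define r where "r = sqrt (y s + R\<^sup>2)"
    have r: "r > 0" "y s + R\<^sup>2 = r * r" using pos[OF that] by (auto simp: r_def)
    show ?thesis
      unfolding q_def using pos[OF that] r
      by (auto intro!: derivative_eq_intros d[OF that] simp: field_simps)
  qed
  have "q 0 + C/2 * 0 \<le> q t + C/2 * t"
  proof (rule DERIV_nonneg_imp_increasing_open[of 0 t "\<lambda>t. q t + C/2 * t"])
    show "0 \<le> t" using t by auto
    show "continuous_on {0..t} (\<lambda>t. q t + C/2 * t)"
      by (rule continuous_on_subset[OF DERIV_continuous_on[OF dq]]) (use t in auto)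
    fix s assume s: "0 < s" "s < t"
    then have s': "s \<in> {0..T}" using t by auto
    have a: "at s within {0..T} = at s" using s t by (intro at_within_interior) auto
    define z where "z = y s + R\<^sup>2"
    have z: "z > 0" using pos[OF s'] z_def by simp
    have "y' s \<le> C * y s * sqrt (y s)" using le[OF s'] .
    also have "\<dots> \<le> C * z * sqrt z"
      using C nn[OF s'] by (intro mult_mono) (auto simp: z_def)
    finally have "y' s / (2 * sqrt z) / z \<le> C / 2"
      using z by (simp add: field_simps)
    then have "- (y' s / (2 * sqrt (y s + R\<^sup>2))) / (y s + R\<^sup>2) + C/2 \<ge> 0" by (simp add: z_def)
    then show "\<exists>y. ((\<lambda>t. q t + C/2 * t) has_real_derivative y) (at s) \<and> 0 \<le> y"
      using dq[OF s'] a by auto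
  qed
  moreover have "q 0 \<ge> 1 / (3/2 * R)"
  proof -
    have "sqrt (y 0 + R\<^sup>2) \<le> sqrt ((3/2 * R)\<^sup>2)"
    proof (intro real_sqrt_le_mono)
      have "(3/2 * R)\<^sup>2 = 9/4 * R\<^sup>2" by (simp add: power_mult_distrib power_divide)
      then show "y 0 + R\<^sup>2 \<le> (3/2 * R)\<^sup>2" using y0 zero_le_power2[of R] by linarith
    qed
    then have "sqrt (y 0 + R\<^sup>2) \<le> 3/2 * R" using R by simp
    moreover have "0 \<in> {0..T}" using t by auto
    ultimately show ?thesis unfolding q_def using R pos[of 0]
      by (intro divide_left_mono) auto
  qed
  moreover have "C/2 * t \<le> 1 / (4 * R)"
  proof -
    have "C * R * t \<le> C * R * T" using C R t by (intro mult_left_mono) auto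
    then have "C * R * t \<le> 1/2" using T by simp
    then show ?thesis using R by (simp add: field_simps)
  qed
  moreover have "1 / (3/2 * R) = 2/3 * (1 / R)" "1 / (4 * R) = 1/4 * (1 / R)" "1 / (3 * R) = 1/3 * (1 / R)" "1 / R > 0"
    using R by auto
  moreover have "a + C/2 * 0 \<le> b + c \<Longrightarrow> 2/3 * u \<le> a \<Longrightarrow> c \<le> 1/4 * u \<Longrightarrow> u > 0 \<Longrightarrow> 1/3 * u \<le> b"
    for a b c u :: real by simp
  ultimately have "q t \<ge> 1 / (3 * R)" by metis
  then have "sqrt (y t + R\<^sup>2) \<le> 3 * R" using R pos[OF t]
    by (auto simp: q_def field_simps)
  then have "y t + R\<^sup>2 \<le> (3 * R)\<^sup>2"
    by (metis pos[OF t] less_imp_le power_mono real_sqrt_ge_zero real_sqrt_pow2)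
  then show ?thesis by (smt (verit) zero_le_power2)
qed

subsection \<open>Weights and interaction coefficients\<close>

text \<open>The Japanese bracket of the frequency 2 pi k. Its square is the symbol of 1 - d^2/dx^2,
  so the weight in \<open>Hs_weight\<close> is its power 2s.\<close>

definition jb :: "int \<Rightarrow> real" where
  "jb k = sqrt (1 + (2 * pi * of_int k)\<^sup>2)"

lemma jb_ge1: "jb k \<ge> 1"
  unfolding jb_def by simp

lemma jb_pos: "jb k > 0" and jb_nonneg: "jb k \<ge> 0"
  using jb_ge1[of k] by linarith+

lemma jb_minus [simp]: "jb (- k) = jb k"
  by (simp add: jb_def)

lemma jb_sq: "(jb k)\<^sup>2 = 1 + (2 * pi * of_int k)\<^sup>2"
  unfolding jb_def by (simp add: add_nonneg_nonneg)

lemma jb_ge: "2 * pi * \<bar>of_int k\<bar> \<le> jb k"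
  unfolding jb_def by (rule real_le_rsqrt) (simp add: power_mult_distrib)

lemma jb_ge_pi: "pi * \<bar>of_int k\<bar> \<le> jb k"
  using jb_ge[of k] mult_nonneg_nonneg[OF pi_ge_zero abs_ge_zero[of "real_of_int k"]] by linarith

text \<open>For k nonzero, k^2 >= 1 absorbs the summand 1, and (2 pi)^2 + 1 < 8^2.\<close>

lemma jb_le: assumes "k \<noteq> 0" shows "jb k \<le> 8 * \<bar>of_int k\<bar>"
proof -
  have k: "\<bar>real_of_int k\<bar> \<ge> 1" using assms by linarith
  have "1 + (2 * pi * real_of_int k)\<^sup>2 \<le> 60 * (real_of_int k)\<^sup>2"
  proof -
    have "pi \<le> 3.2" using pi_approx by simp
    then have "(2 * pi)\<^sup>2 \<le> (6.4)\<^sup>2" by (intro power_mono) auto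
    then have p: "(2 * pi)\<^sup>2 \<le> 41" by (simp add: power2_eq_square)
    have k2: "1 \<le> (real_of_int k)\<^sup>2" using k by (metis abs_le_square_iff abs_one one_power2)
    have "(2 * pi * real_of_int k)\<^sup>2 \<le> 41 * (real_of_int k)\<^sup>2"
      unfolding power_mult_distrib[of "2*pi"] by (intro mult_right_mono p) simp
    then show ?thesis using k2 by linarith
  qed
  also have "\<dots> \<le> (8 * \<bar>real_of_int k\<bar>)\<^sup>2" by (simp add: power_mult_distrib)
  finally show ?thesis unfolding jb_def by (intro real_le_lsqrt) auto
qed

lemma sqrt_one_plus_sq_triangle: "sqrt (1 + (x + y)\<^sup>2) \<le> sqrt (1 + x\<^sup>2) + \<bar>y\<bar>" for x y :: real
proof (rule real_le_lsqrt)
  have "\<bar>x\<bar> \<le> sqrt (1 + x\<^sup>2)" by (rule real_le_rsqrt) simp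
  then have "\<bar>x\<bar> * \<bar>y\<bar> \<le> sqrt (1 + x\<^sup>2) * \<bar>y\<bar>" by (intro mult_right_mono) auto
  then have "x * y \<le> sqrt (1 + x\<^sup>2) * \<bar>y\<bar>" by (metis abs_le_D1 abs_mult)
  then show "1 + (x + y)\<^sup>2 \<le> (sqrt (1 + x\<^sup>2) + \<bar>y\<bar>)\<^sup>2"
    by (simp add: power2_sum add_nonneg_nonneg)
qed (auto intro!: add_nonneg_nonneg)

text \<open>The function sqrt (1 + x^2) is 1-Lipschitz.\<close>

lemma jb_diff: "\<bar>jb k - jb j\<bar> \<le> jb (k - j)"
proof -
  have *: "jb k - jb j \<le> jb (k - j)" for k j
  proof -
    have "2 * pi * of_int j + 2 * pi * of_int (k - j) = 2 * pi * real_of_int k"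
      by (simp add: algebra_simps)
    then have "jb k \<le> jb j + \<bar>2 * pi * real_of_int (k - j)\<bar>"
      using sqrt_one_plus_sq_triangle[of "2 * pi * of_int j" "2 * pi * of_int (k - j)"]
      by (simp only: jb_def)
    then show ?thesis using jb_ge[of "k - j"] by (simp add: abs_mult)
  qed
  show ?thesis using *[of k j] *[of j k] jb_minus[of "k - j"] by (simp add: abs_le_iff)
qed

lemma jb_triangle: "jb k \<le> jb j + jb (k - j)"
  using jb_diff[of k j] by linarith

text \<open>
  The equation reads \<open>a\<^sub>k' = \<Sum>\<^sub>j - \<i> * gam k j * a\<^sub>j * a\<^sub>k\<^sub>-\<^sub>j\<close>: the three summands of \<open>gam\<close> come from \<open>u u\<^sub>x = (u\<^sup>2/2)\<^sub>x\<close>,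
  from \<open>u\<^sub>x\<^sup>2/2\<close> and, symmetrised in \<open>j\<close> and \<open>k - j\<close>, from \<open>2 \<mu>(u) u\<close>, where \<open>A\<^sup>-\<^sup>1 \<partial>\<^sub>x\<close> multiplies the
  \<open>k\<close>-th coefficient by \<open>\<i> / (2 \<pi> k)\<close>. Division by zero makes \<open>gam 0 j = 0\<close>, which is the conservation of the mean.
\<close>

definition gam :: "int \<Rightarrow> int \<Rightarrow> real" where
  "gam k j = pi * of_int k - pi * of_int j * of_int (k - j) / of_int k
     + ((if j = 0 then 1 else 0) + (if j = k then 1 else 0)) / (2 * pi * of_int k)"

text \<open>The symbol left after removing the transport part \<open>pi * k\<close>, that of
  (u^2/2)_x. The transport part loses a derivative and is handled by skew-symmetry; this remainder
  is estimated by absolute values alone.\<close>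

definition rho :: "int \<Rightarrow> int \<Rightarrow> real" where
  "rho k j = gam k j - pi * of_int k"

lemma gam_0 [simp]: "gam 0 j = 0"
  by (simp add: gam_def)

lemma gam_minus: "gam (- k) (- j) = - gam k j"
  by (auto simp: gam_def field_simps)

lemma gam_flip: "gam k (k - j) = gam k j"
  by (auto simp: gam_def field_simps)

lemma abs_rho: 
  assumes "k \<noteq> 0"
  shows "\<bar>rho k j\<bar> \<le> (pi * \<bar>of_int j\<bar> * \<bar>of_int (k - j)\<bar> + 1) / \<bar>of_int k\<bar>"
proof -
  have "rho k j = ((((if j = 0 then 1 else 0) + (if j = k then 1 else 0)) / (2 * pi)) - pi * of_int j * of_int (k - j)) / of_int k"
    using assms by (simp add: rho_def gam_def field_simps)
  moreover have "\<bar>((if j = 0 then 1 else 0) + (if j = k then 1 else 0)) / (2 * pi)\<bar> \<le> 1"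
    using pi_gt3 by (auto simp: field_simps)
  moreover have "\<bar>pi * of_int j * real_of_int (k - j)\<bar> = pi * \<bar>of_int j\<bar> * \<bar>of_int (k - j)\<bar>"
    by (simp add: abs_mult)
  moreover have "\<bar>x\<bar> \<le> 1 \<Longrightarrow> \<bar>y\<bar> = z \<Longrightarrow> \<bar>(x - y) / real_of_int k\<bar> \<le> (z + 1) / \<bar>of_int k\<bar>" for x y z :: real
    unfolding abs_divide by (intro divide_right_mono) linarith+
  ultimately show ?thesis by metis
qed

text \<open>All growth is moved to the frequency \<open>k - j\<close>: |j| <= |k| + |k - j|, and the
  |k| cancels against the denominator. This suits the comparison of two solutions, where the
  difference, at frequency \<open>j\<close>, can bear no derivative.\<close>

lemma rho_bound_sq: "\<bar>rho k j\<bar> \<le> 2 * (jb (k - j))\<^sup>2"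
proof (cases "k = 0")
  case True then show ?thesis by (simp add: rho_def)
next
  case False
  define x where "x = \<bar>real_of_int k\<bar>"
  define m where "m = \<bar>real_of_int (k - j)\<bar>"
  have x: "x \<ge> 1" using False unfolding x_def by linarith
  have m: "m = 0 \<or> m \<ge> 1" unfolding m_def by (cases "k = j") linarith+
  have mm: "m \<le> m * m" using m by auto
  have j: "\<bar>real_of_int j\<bar> \<le> x + m" unfolding x_def m_def by linarith
  have m0: "m \<ge> 0" by (simp add: m_def)
  have "\<bar>rho k j\<bar> \<le> (pi * \<bar>of_int j\<bar> * m + 1) / x" using abs_rho[OF False] by (simp add: x_def m_def)
  also have "\<dots> \<le> (pi * (x + m) * m + 1) / x"
    using x m0 j by (intro divide_right_mono add_right_mono mult_right_mono mult_left_mono) auto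
  also have "\<dots> = pi * m + (pi * m * m + 1) / x" using x by (simp add: field_simps)
  also have "\<dots> \<le> pi * m + (pi * m * m + 1) / 1"
    using x m0 by (intro add_left_mono divide_left_mono) (auto intro!: add_nonneg_nonneg)
  also have "\<dots> \<le> 2 * (pi * (m * m)) + 1" using mult_left_mono[OF mm, of pi] by simp
  also have "\<dots> \<le> 2 * (1 + (2 * pi * m)\<^sup>2)"
  proof -
    have "pi * (m * m) * 1 \<le> pi * (m * m) * (4 * pi)"
      using pi_gt3 by (intro mult_left_mono) auto
    moreover have "(2 * pi * m)\<^sup>2 = pi * (m * m) * (4 * pi)" by (simp add: power2_eq_square)
    moreover have "pi * (m * m) \<ge> 0" by simp
    moreover have "P * 1 \<le> Y \<Longrightarrow> Z = Y \<Longrightarrow> P \<ge> 0 \<Longrightarrow> 2 * P + 1 \<le> 2 * (1 + Z)" for P Y Z :: real by simp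
    ultimately show ?thesis by blast
  qed
  also have "\<dots> = 2 * (jb (k - j))\<^sup>2" by (simp add: jb_sq m_def power_mult_distrib)
  finally show ?thesis .
qed

text \<open>The factor \<open>1 / jb k\<close> is the smoothing of A^(-1) d/dx; it lets the weight
  \<open>jb k powr s\<close> drop to the power s - 1 before it is distributed over the two factors.
  The constant is twice the 8 of \<open>jb_le\<close>.\<close>

lemma rho_bound_prod: "\<bar>rho k j\<bar> \<le> 16 * jb j * jb (k - j) / jb k"
proof (cases "k = 0")
  case True then show ?thesis using jb_nonneg[of j] jb_nonneg by (simp add: rho_def)
next
  case False
  have k1: "\<bar>real_of_int k\<bar> \<ge> 1" using False by linarith
  have a: "pi * \<bar>real_of_int j\<bar> * \<bar>of_int (k - j)\<bar> \<le> jb j * jb (k - j)"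
  proof -
    have "pi * \<bar>real_of_int j\<bar> \<le> jb j" by (rule jb_ge_pi)
    moreover have "\<bar>real_of_int (k-j)\<bar> \<le> jb (k-j)"
    proof -
      have "1 * \<bar>real_of_int (k-j)\<bar> \<le> pi * \<bar>real_of_int (k-j)\<bar>"
        using pi_gt3 by (intro mult_right_mono) auto
      also have "\<dots> \<le> jb (k-j)" by (rule jb_ge_pi)
      finally show ?thesis by simp
    qed
    ultimately show ?thesis by (intro mult_mono) (auto simp: jb_nonneg)
  qed
  have b: "1 \<le> jb j * jb (k - j)" using jb_ge1[of j] jb_ge1[of "k-j"]
    by (metis mult_mono' mult_1 zero_le_one)
  have "\<bar>rho k j\<bar> \<le> (2 * (jb j * jb (k - j))) / \<bar>of_int k\<bar>"
    by (rule order.trans[OF abs_rho[OF False]]) (intro divide_right_mono, use a b in auto)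
  also have "\<dots> \<le> (2 * (jb j * jb (k - j))) / (jb k / 8)"
    using jb_le[OF False] jb_pos[of k] k1 b by (intro divide_left_mono) auto
  finally show ?thesis by (simp add: mult_ac)
qed

lemma powr_add_le: "(x + y) powr t \<le> 2 powr t * (x powr t + y powr t)"
  if "x \<ge> 0" "y \<ge> 0" "t \<ge> 0" for x y t :: real
proof -
  have "(x + y) powr t \<le> (2 * max x y) powr t" using that by (intro powr_mono2) auto
  also have "\<dots> = 2 powr t * max x y powr t" using that by (simp add: powr_mult)
  also have "\<dots> \<le> 2 powr t * (x powr t + y powr t)"
    by (intro mult_left_mono) (auto simp: max_def)
  finally show ?thesis .
qed

text \<open>One factor takes all s derivatives, to be measured in l^2, the other a single one, to be
  measured in l^1. This split makes the energy rate linear in the sum of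
  \<open>jb k * |a_k|\<close>.\<close>

abbreviation paraprod :: "real \<Rightarrow> int \<Rightarrow> int \<Rightarrow> real" where
  "paraprod s k j \<equiv> jb j powr s * jb (k - j) + jb j * jb (k - j) powr s"

lemma jb_powr_Suc: "jb k * jb k powr (s - 1) = jb k powr s"
  using jb_pos[of k] by (metis powr_mult_base less_imp_le add.commute diff_add_cancel)

lemma jb_powr_le:
  assumes "s \<ge> 1"
  shows "jb j * jb (k - j) * jb k powr (s - 1) \<le> 2 powr s * paraprod s k j"
proof -
  have "jb k powr (s - 1) \<le> (jb j + jb (k - j)) powr (s - 1)"
    using assms jb_triangle[of k j] by (intro powr_mono2) (auto simp: jb_nonneg)
  also have "\<dots> \<le> 2 powr (s - 1) * (jb j powr (s - 1) + jb (k - j) powr (s - 1))"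
    by (rule powr_add_le) (use assms in \<open>auto simp: jb_nonneg\<close>)
  also have "\<dots> \<le> 2 powr s * (jb j powr (s - 1) + jb (k - j) powr (s - 1))"
    by (intro mult_right_mono) (auto)
  finally have "jb j * jb (k - j) * jb k powr (s - 1)
     \<le> jb j * jb (k - j) * (2 powr s * (jb j powr (s - 1) + jb (k - j) powr (s - 1)))"
    by (intro mult_left_mono) (auto simp: jb_nonneg)
  also have "\<dots> = 2 powr s * ((jb j * jb j powr (s-1)) * jb (k-j) + jb j * (jb (k-j) * jb (k-j) powr (s-1)))"
    by (simp only: algebra_simps)
  finally show ?thesis unfolding jb_powr_Suc .
qed

lemma weight_rho:
  assumes "s \<ge> 1"
  shows "jb k powr s * \<bar>rho k j\<bar> \<le> 16 * 2 powr s * paraprod s k j"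
proof -
  have "jb k powr s * \<bar>rho k j\<bar> \<le> jb k powr s * (16 * jb j * jb (k - j) / jb k)"
    by (intro mult_left_mono rho_bound_prod) auto
  also have "\<dots> = 16 * (jb j * jb (k - j) * jb k powr (s - 1))"
    using jb_pos[of k] by (simp flip: jb_powr_Suc[of k s])
  also have "\<dots> \<le> 16 * (2 powr s * paraprod s k j)" by (intro mult_left_mono jb_powr_le assms) auto
  finally show ?thesis by (simp add: mult.assoc)
qed

lemma jb_le_prod: "jb k \<le> 2 * (jb j * jb (k - j))"
proof -
  have "0 \<le> (jb j - 1) * jb (k-j) + jb j * (jb (k-j) - 1)" using jb_ge1[of j] jb_ge1[of "k-j"] by simp
  then have "jb j + jb (k - j) \<le> 2 * (jb j * jb (k - j))" by (simp add: algebra_simps)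
  then show ?thesis using jb_triangle[of k j] by linarith
qed

lemma gam_bound: "\<bar>gam k j\<bar> \<le> 18 * (jb j * jb (k - j))"
proof -
  have "\<bar>gam k j\<bar> \<le> pi * \<bar>of_int k\<bar> + \<bar>rho k j\<bar>"
    unfolding rho_def using abs_triangle_ineq[of "gam k j - pi * of_int k" "pi * of_int k"]
    by (simp add: abs_mult)
  moreover have "pi * \<bar>of_int k\<bar> \<le> jb k" by (rule jb_ge_pi)
  moreover have "16 * jb j * jb (k - j) / jb k \<le> 16 * jb j * jb (k - j) / 1"
    using jb_ge1[of k] by (intro divide_left_mono) (auto simp: jb_nonneg)
  ultimately show ?thesis using rho_bound_prod[of k j] jb_le_prod[of k j] by linarith
qed

text \<open>Here the whole symbol, transport included, is estimated by absolute values; the price is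
  the weight s - 1 in place of s. The mapping of H^s into H^(s-1) by the nonlinearity rests on
  it.\<close>

lemma weight_gam:
  assumes "s \<ge> 1"
  shows "jb k powr (s - 1) * \<bar>gam k j\<bar> \<le> 18 * 2 powr s * paraprod s k j"
proof -
  have "jb k powr (s - 1) * \<bar>gam k j\<bar> \<le> jb k powr (s - 1) * (18 * (jb j * jb (k - j)))"
    by (intro mult_left_mono gam_bound) auto
  also have "\<dots> = 18 * (jb j * jb (k - j) * jb k powr (s - 1))" by (simp add: mult_ac)
  also have "\<dots> \<le> 18 * (2 powr s * paraprod s k j)" by (intro mult_left_mono jb_powr_le assms) auto
  finally show ?thesis by (simp add: mult.assoc)
qed

lemma powr_diff_le:
  fixes x y :: real
  assumes "s \<ge> 1" "x > 0" "y > 0"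
  shows "\<bar>x powr s - y powr s\<bar> \<le> s * \<bar>x - y\<bar> * (x powr (s - 1) + y powr (s - 1))"
proof -
  have *: "\<bar>x powr s - y powr s\<bar> \<le> s * \<bar>x - y\<bar> * (x powr (s - 1) + y powr (s - 1))"
    if "x < y" "x > 0" for x y :: real
  proof -
    have "\<exists>z>x. z < y \<and> y powr s - x powr s = (y - x) * (s * z powr (s - 1))"
      using that by (intro MVT2) (auto intro!: derivative_eq_intros)
    then obtain z where z: "x < z" "z < y" "y powr s - x powr s = (y - x) * (s * z powr (s - 1))" by auto
    have "z powr (s - 1) \<le> y powr (s - 1)" using z that assms by (intro powr_mono2) auto
    then have "z powr (s - 1) \<le> x powr (s - 1) + y powr (s - 1)" by (smt (verit) powr_ge_zero)
    then have "(y - x) * (s * z powr (s - 1)) \<le> (y - x) * (s * (x powr (s - 1) + y powr (s - 1)))"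
      using that assms by (intro mult_left_mono) auto
    moreover have "x powr s \<le> y powr s" using that assms by (intro powr_mono2) auto
    ultimately show ?thesis using z that by (simp add: mult_ac)
  qed
  show ?thesis
  proof (cases x y rule: linorder_cases)
    case less then show ?thesis using * assms by blast
  next
    case greater
    then show ?thesis using *[of y x] assms by (simp add: abs_minus_commute add.commute)
  qed auto
qed

text \<open>This is the commutator of the weight with transport. The mean value theorem exchanges
  one power of the weight for the difference of \<open>jb k\<close> and \<open>jb j\<close>, which
  is at most \<open>jb (k - j)\<close>; this leaves room for the derivative at frequency
  \<open>j\<close>.\<close>

lemma weight_comm:
  assumes "s \<ge> 1"
  shows "\<bar>jb k powr s - jb j powr s\<bar> * jb j \<le> s * 3 * 2 powr s * paraprod s k j"
proof -
  define p q r where "p = jb j" "q = jb (k - j)" "r = jb k"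
  note pqr = this
  have pos: "p \<ge> 1" "q \<ge> 1" "r \<ge> 1" using jb_ge1 by (auto simp: pqr)
  have "\<bar>r powr s - p powr s\<bar> \<le> s * \<bar>r - p\<bar> * (r powr (s - 1) + p powr (s - 1))"
    using assms pos by (intro powr_diff_le) auto
  also have "\<dots> \<le> s * q * (r powr (s - 1) + p powr (s - 1))"
    using assms jb_diff[of k j] by (intro mult_left_mono mult_right_mono) (auto simp: pqr)
  finally have "\<bar>r powr s - p powr s\<bar> * p \<le> s * q * (r powr (s - 1) + p powr (s - 1)) * p"
    using pos by (intro mult_right_mono) auto
  also have "\<dots> = s * (p * q * r powr (s - 1) + (p * p powr (s-1)) * q)" by (simp only: algebra_simps)
  also have "\<dots> = s * (p * q * r powr (s - 1) + p powr s * q)" by (simp only: pqr jb_powr_Suc)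
  also have "\<dots> \<le> s * (2 powr s * (p powr s * q + p * q powr s) + 2 powr s * (p powr s * q + p * q powr s))"
  proof -
    have "p * q * r powr (s - 1) \<le> 2 powr s * (p powr s * q + p * q powr s)"
      using jb_powr_le[OF assms, of j k] by (simp add: pqr)
    moreover have "p powr s * q \<le> 2 powr s * (p powr s * q + p * q powr s)"
    proof -
      have "1 * (p powr s * q) \<le> 2 powr s * (p powr s * q + p * q powr s)"
        using assms pos by (intro mult_mono ge_one_powr_ge_zero) auto
      then show ?thesis by simp
    qed
    ultimately show ?thesis using assms by (intro mult_left_mono add_mono) auto
  qed
  also have "\<dots> \<le> s * 3 * 2 powr s * (p powr s * q + p * q powr s)"
    using assms pos by (simp add: algebra_simps)
  finally show ?thesis by (simp add: pqr)
qed

subsection \<open>Trilinear estimates on finite frequency sets\<close>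

lemma sum_shift_le:
  fixes h :: "int \<Rightarrow> real"
  assumes "finite S" and h: "\<And>i. h i \<ge> 0" "\<And>i. i \<notin> S \<Longrightarrow> h i = 0"
  shows "(\<Sum>j\<in>S. h (k - j)) \<le> sum h S" "(\<Sum>j\<in>S. h (j - k)) \<le> sum h S"
proof -
  have *: "sum h A \<le> sum h S" if "finite A" for A
  proof -
    have "sum h A = sum h (A \<inter> S)"
      using that h by (intro sum.mono_neutral_right) auto
    also have "\<dots> \<le> sum h S" using assms by (intro sum_mono2) auto
    finally show ?thesis .
  qed
  have "(\<Sum>j\<in>S. h (k - j)) = sum h ((\<lambda>j. k - j) ` S)"
    by (subst sum.reindex) (auto simp: inj_on_def)
  then show "(\<Sum>j\<in>S. h (k - j)) \<le> sum h S" using *[of "(\<lambda>j. k - j) ` S"] assms(1) by simp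
  have "(\<Sum>j\<in>S. h (j - k)) = sum h ((\<lambda>j. j - k) ` S)"
    by (subst sum.reindex) (auto simp: inj_on_def)
  then show "(\<Sum>j\<in>S. h (j - k)) \<le> sum h S" using *[of "(\<lambda>j. j - k) ` S"] assms(1) by simp
qed

text \<open>Schur test: the product of \<open>f\<close> and \<open>g\<close> is split into squares,
  and what remains is a sum of shifts of \<open>h\<close>, at most its l^1 norm. The squares may
  stay a sum because the estimate is applied with equal \<open>f\<close> and
  \<open>g\<close>.\<close>

lemma trilinear1:
  fixes f g h :: "int \<Rightarrow> real"
  assumes S: "finite S" and h: "\<And>i. h i \<ge> 0" "\<And>i. i \<notin> S \<Longrightarrow> h i = 0"
  shows "(\<Sum>k\<in>S. \<Sum>j\<in>S. f k * g j * h (k - j)) \<le> sum h S * ((\<Sum>k\<in>S. (f k)\<^sup>2) + (\<Sum>k\<in>S. (g k)\<^sup>2)) / 2"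
proof -
  have "f k * g j \<le> ((f k)\<^sup>2 + (g j)\<^sup>2) / 2" for k j
    using sum_squares_bound[of "f k" "g j"] by simp
  then have "(\<Sum>k\<in>S. \<Sum>j\<in>S. f k * g j * h (k - j)) \<le> (\<Sum>k\<in>S. \<Sum>j\<in>S. ((f k)\<^sup>2 + (g j)\<^sup>2) / 2 * h (k - j))"
    using h by (intro sum_mono mult_right_mono) auto
  also have "\<dots> = (\<Sum>k\<in>S. \<Sum>j\<in>S. (f k)\<^sup>2 / 2 * h (k - j)) + (\<Sum>k\<in>S. \<Sum>j\<in>S. (g j)\<^sup>2 / 2 * h (k - j))"
    by (simp add: add_divide_distrib distrib_right sum.distrib)
  also have "(\<Sum>k\<in>S. \<Sum>j\<in>S. (g j)\<^sup>2 / 2 * h (k - j)) = (\<Sum>j\<in>S. \<Sum>k\<in>S. (g j)\<^sup>2 / 2 * h (k - j))"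
    by (rule sum.swap)
  also have "(\<Sum>k\<in>S. \<Sum>j\<in>S. (f k)\<^sup>2 / 2 * h (k - j)) \<le> (\<Sum>k\<in>S. (f k)\<^sup>2 / 2 * sum h S)"
    unfolding sum_distrib_left[symmetric] by (intro sum_mono mult_left_mono sum_shift_le S h) auto
  also have "(\<Sum>j\<in>S. \<Sum>k\<in>S. (g j)\<^sup>2 / 2 * h (k - j)) \<le> (\<Sum>j\<in>S. (g j)\<^sup>2 / 2 * sum h S)"
    unfolding sum_distrib_left[symmetric] by (intro sum_mono mult_left_mono sum_shift_le S h) auto
  finally show ?thesis
    by (simp add: sum_distrib_left sum_divide_distrib mult.commute add_divide_distrib distrib_left)
qed

text \<open>The counterpart with the l^1 factor at \<open>j\<close> and a square-summable one at
  \<open>k - j\<close>; here the sum over \<open>k\<close> is carried out inside.\<close>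

lemma trilinear2:
  fixes f g h :: "int \<Rightarrow> real"
  assumes S: "finite S" and h: "\<And>i. h i \<ge> 0" and g: "\<And>i. i \<notin> S \<Longrightarrow> g i = 0"
  shows "(\<Sum>k\<in>S. \<Sum>j\<in>S. f k * h j * g (k - j)) \<le> sum h S * ((\<Sum>k\<in>S. (f k)\<^sup>2) + (\<Sum>k\<in>S. (g k)\<^sup>2)) / 2"
proof -
  have "(\<Sum>k\<in>S. \<Sum>j\<in>S. f k * h j * g (k - j)) = (\<Sum>j\<in>S. h j * (\<Sum>k\<in>S. f k * g (k - j)))"
    by (subst sum.swap) (simp add: sum_distrib_left mult_ac)
  also have "\<dots> \<le> (\<Sum>j\<in>S. h j * (((\<Sum>k\<in>S. (f k)\<^sup>2) + (\<Sum>k\<in>S. (g k)\<^sup>2)) / 2))"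
  proof (intro sum_mono mult_left_mono h)
    fix j
    have "f k * g (k - j) \<le> ((f k)\<^sup>2 + (g (k - j))\<^sup>2) / 2" for k
      using sum_squares_bound[of "f k" "g (k - j)"] by simp
    then have "(\<Sum>k\<in>S. f k * g (k - j)) \<le> (\<Sum>k\<in>S. ((f k)\<^sup>2 + (g (k - j))\<^sup>2) / 2)"
      by (intro sum_mono)
    also have "\<dots> = ((\<Sum>k\<in>S. (f k)\<^sup>2) + (\<Sum>k\<in>S. (g (k - j))\<^sup>2)) / 2"
      by (simp add: sum.distrib add_divide_distrib sum_divide_distrib)
    also have "\<dots> \<le> ((\<Sum>k\<in>S. (f k)\<^sup>2) + (\<Sum>k\<in>S. (g k)\<^sup>2)) / 2"
      using sum_shift_le(2)[OF S, of "\<lambda>i. (g i)\<^sup>2" j] g by simp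
    finally show "(\<Sum>k\<in>S. f k * g (k - j)) \<le> ((\<Sum>k\<in>S. (f k)\<^sup>2) + (\<Sum>k\<in>S. (g k)\<^sup>2)) / 2" .
  qed
  also have "\<dots> = sum h S * ((\<Sum>k\<in>S. (f k)\<^sup>2) + (\<Sum>k\<in>S. (g k)\<^sup>2)) / 2"
    by (simp add: sum_distrib_right sum_divide_distrib)
  finally show ?thesis .
qed

lemma sum_reflect:
  fixes F :: "int \<Rightarrow> complex"
  assumes S: "finite S" and F: "\<And>j. j \<notin> S \<or> k - j \<notin> S \<Longrightarrow> F j = 0"
  shows "(\<Sum>j\<in>S. F j) = (\<Sum>j\<in>S. F (k - j))"
proof -
  define A where "A = {j\<in>S. k - j \<in> S}"
  have "(\<Sum>j\<in>S. F j) = sum F A"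
    using S F by (intro sum.mono_neutral_right) (auto simp: A_def)
  also have "\<dots> = (\<Sum>j\<in>A. F (k - j))"
    by (rule sum.reindex_bij_witness[of _ "\<lambda>j. k - j" "\<lambda>j. k - j"]) (auto simp: A_def)
  also have "\<dots> = (\<Sum>j\<in>S. F (k - j))"
    using S F by (intro sum.mono_neutral_left) (auto simp: A_def)
  finally show ?thesis .
qed

definition symm :: "(int \<Rightarrow> complex) \<Rightarrow> bool" where
  "symm a \<longleftrightarrow> (\<forall>k. a (- k) = cnj (a k))"

lemma symmD: "symm a \<Longrightarrow> a (- k) = cnj (a k)"
  by (simp add: symm_def)

text \<open>The transport term is skew up to a factor \<open>k - j\<close> that falls on \<open>g\<close>, which is real-valued in
  physical space.\<close>

lemma skew_bound:
  fixes z g :: "int \<Rightarrow> complex"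
  assumes S: "finite S" and g: "symm g"
  shows "\<bar>Im (\<Sum>k\<in>S. \<Sum>j\<in>S. of_int j * (cnj (z k) * z j * g (k - j)))\<bar>
      \<le> (\<Sum>k\<in>S. \<Sum>j\<in>S. cmod (z k) * cmod (z j) * (\<bar>of_int (k - j)\<bar> * cmod (g (k - j)))) / 2"
    and "\<bar>Im (\<Sum>k\<in>S. \<Sum>j\<in>S. of_int k * (cnj (z k) * z j * g (k - j)))\<bar>
      \<le> (\<Sum>k\<in>S. \<Sum>j\<in>S. cmod (z k) * cmod (z j) * (\<bar>of_int (k - j)\<bar> * cmod (g (k - j)))) / 2"
proof -
  define M where "M = (\<Sum>k\<in>S. \<Sum>j\<in>S. of_int j * (cnj (z k) * z j * g (k - j)))"
  define M' where "M' = (\<Sum>k\<in>S. \<Sum>j\<in>S. of_int k * (cnj (z k) * z j * g (k - j)))"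
  \<comment> \<open>Since \<open>g\<close> is real in physical space, exchanging \<open>j\<close>
    and \<open>k\<close> turns the conjugate of \<open>M\<close> into \<open>M'\<close>. Thus
    \<open>Im M\<close> is, up to sign, half of \<open>Im (M' - M)\<close>, where only the factor
    \<open>k - j\<close> survives.\<close>
  have g': "cnj (g (k - j)) = g (j - k)" for k j using symmD[OF g, of "k - j"] by simp
  have "cnj M = (\<Sum>k\<in>S. \<Sum>j\<in>S. of_int j * (z k * cnj (z j) * g (j - k)))"
    by (simp add: M_def g' mult_ac)
  also have "\<dots> = M'" unfolding M'_def by (subst sum.swap) (simp add: mult_ac)
  finally have MM: "cnj M = M'" .
  have "M' - M = (\<Sum>k\<in>S. \<Sum>j\<in>S. of_int (k - j) * (cnj (z k) * z j * g (k - j)))"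
    by (simp add: M_def M'_def algebra_simps sum_subtractf)
  moreover have "cmod (of_int (k - j) * (cnj (z k) * z j * g (k - j)))
     = cmod (z k) * cmod (z j) * (\<bar>of_int (k - j)\<bar> * cmod (g (k - j)))" for k j
    unfolding norm_mult norm_of_int complex_mod_cnj by (simp only: mult_ac)
  ultimately have "cmod (M' - M) \<le> (\<Sum>k\<in>S. \<Sum>j\<in>S. cmod (z k) * cmod (z j) * (\<bar>of_int (k - j)\<bar> * cmod (g (k - j))))"
    by (simp only:) (intro sum_norm_le, simp)
  moreover have "\<bar>Im (M' - M)\<bar> \<le> cmod (M' - M)" by (rule abs_Im_le_cmod)
  moreover have "Im (M' - M) = - 2 * Im M" "Im M' = - Im M" unfolding MM[symmetric] by simp_all
  ultimately show "\<bar>Im (\<Sum>k\<in>S. \<Sum>j\<in>S. of_int j * (cnj (z k) * z j * g (k - j)))\<bar>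
      \<le> (\<Sum>k\<in>S. \<Sum>j\<in>S. cmod (z k) * cmod (z j) * (\<bar>of_int (k - j)\<bar> * cmod (g (k - j)))) / 2"
    "\<bar>Im (\<Sum>k\<in>S. \<Sum>j\<in>S. of_int k * (cnj (z k) * z j * g (k - j)))\<bar>
      \<le> (\<Sum>k\<in>S. \<Sum>j\<in>S. cmod (z k) * cmod (z j) * (\<bar>of_int (k - j)\<bar> * cmod (g (k - j)))) / 2"
    unfolding M_def[symmetric] M'_def[symmetric] by linarith+
qed

text \<open>The 1 is the skew transport part; the bracket adds the constants of
  \<open>weight_comm\<close> and \<open>weight_rho\<close>; the 2 counts the two terms of
  \<open>paraprod\<close>.\<close>

definition en_const :: "real \<Rightarrow> real" where
  "en_const s = 1 + 2 * (s * 3 * 2 powr s + 16 * 2 powr s)"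

text \<open>The derivative is put on one factor, \<open>pi * k\<close> becoming
  \<open>2 * pi * j\<close> by the symmetry between \<open>j\<close> and \<open>k - j\<close>.
  Replacing the weight at \<open>k\<close> by that at \<open>j\<close> then makes the top-order part
  skew in the weighted unknown \<open>z\<close>, at the cost of a commutator.\<close>

lemma energy_bound:
  fixes a :: "int \<Rightarrow> complex"
  assumes S: "finite S" and a: "symm a" "\<And>k. k \<notin> S \<Longrightarrow> a k = 0" and s: "s \<ge> 1"
  shows "\<bar>\<Sum>k\<in>S. (jb k powr s)\<^sup>2 * Re (cnj (a k) * (\<Sum>j\<in>S. - \<i> * gam k j * (a j * a (k - j))))\<bar>
     \<le> en_const s * (\<Sum>k\<in>S. jb k * cmod (a k)) * (\<Sum>k\<in>S. (jb k powr s * cmod (a k))\<^sup>2)"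
proof -
  define w where "w k = jb k powr s" for k
  define z where "z k = of_real (w k) * a k" for k
  define W where "W = (\<Sum>k\<in>S. jb k * cmod (a k))"
  define E where "E = (\<Sum>k\<in>S. (w k * cmod (a k))\<^sup>2)"
  \<comment> \<open>The commutator of the weight with transport, plus the weighted remainder of the
    symbol.\<close>
  define c where "c k j = 2 * pi * (w k - w j) * of_int j + w k * rho k j" for k j
  have w0: "w k \<ge> 0" for k by (simp add: w_def)
  have nz: "cmod (z k) = w k * cmod (a k)" for k by (simp add: z_def norm_mult w0)
  have z0: "z k = 0" if "k \<notin> S" for k using a(2)[OF that] by (simp add: z_def)
  have per: "(w k)\<^sup>2 * Re (cnj (a k) * (\<Sum>j\<in>S. - \<i> * gam k j * (a j * a (k - j))))
     = Im (\<Sum>j\<in>S. 2 * pi * (of_int j * (cnj (z k) * z j * a (k - j)))) 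
       + Im (\<Sum>j\<in>S. of_real (c k j) * (cnj (z k) * (a j * a (k - j))))" for k
  proof -
    have fl: "(\<Sum>j\<in>S. of_int j * (a j * a (k - j))) = (\<Sum>j\<in>S. of_int (k - j) * (a j * a (k - j)))"
      using a(2) by (subst sum_reflect[OF S, of k]) (auto simp: mult_ac)
    have "(\<Sum>j\<in>S. of_int k * (a j * a (k - j)))
       = (\<Sum>j\<in>S. of_int j * (a j * a (k - j)) + of_int (k - j) * (a j * a (k - j)))"
      by (intro sum.cong) (auto simp: algebra_simps)
    also have "\<dots> = (\<Sum>j\<in>S. 2 * (of_int j * (a j * a (k - j))))"
      unfolding sum.distrib fl[symmetric] by (simp add: sum_distrib_left)
    finally have "(\<Sum>j\<in>S. gam k j * (a j * a (k - j))) = (\<Sum>j\<in>S. (2 * pi * of_int j + rho k j) * (a j * a (k - j)))"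
    proof -
      assume h: "(\<Sum>j\<in>S. of_int k * (a j * a (k - j))) = (\<Sum>j\<in>S. 2 * (of_int j * (a j * a (k - j))))"
      have "(\<Sum>j\<in>S. gam k j * (a j * a (k - j))) = (\<Sum>j\<in>S. pi * (of_int k * (a j * a (k - j)))) + (\<Sum>j\<in>S. rho k j * (a j * a (k - j)))"
        by (simp add: rho_def algebra_simps sum.distrib[symmetric])
      also have "(\<Sum>j\<in>S. pi * (of_int k * (a j * a (k - j)))) = pi * (\<Sum>j\<in>S. 2 * (of_int j * (a j * a (k - j))))"
        by (subst h[symmetric]) (simp only: sum_distrib_left)
      finally show ?thesis by (simp add: algebra_simps sum.distrib sum_distrib_left)
    qed
    moreover have "(\<Sum>j\<in>S. - \<i> * gam k j * (a j * a (k - j))) = - \<i> * (\<Sum>j\<in>S. gam k j * (a j * a (k - j)))"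
      by (simp only: sum_distrib_left mult.assoc)
    ultimately have "(\<Sum>j\<in>S. - \<i> * gam k j * (a j * a (k - j))) = - \<i> * (\<Sum>j\<in>S. (2 * pi * of_int j + rho k j) * (a j * a (k - j)))"
      by simp
    then have "(w k)\<^sup>2 * Re (cnj (a k) * (\<Sum>j\<in>S. - \<i> * gam k j * (a j * a (k - j))))
      = Im (of_real ((w k)\<^sup>2) * cnj (a k) * (\<Sum>j\<in>S. (2 * pi * of_int j + rho k j) * (a j * a (k - j))))"
      by (simp add: algebra_simps)
    also have "of_real ((w k)\<^sup>2) * cnj (a k) * (\<Sum>j\<in>S. (2 * pi * of_int j + rho k j) * (a j * a (k - j)))
      = (\<Sum>j\<in>S. 2 * pi * (of_int j * (cnj (z k) * z j * a (k - j))) + of_real (c k j) * (cnj (z k) * (a j * a (k - j))))"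
      unfolding sum_distrib_left
      by (intro sum.cong) (auto simp: z_def c_def algebra_simps power2_eq_square)
    finally show ?thesis by (simp add: sum.distrib)
  qed
  have c: "\<bar>c k j\<bar> \<le> (s * 3 * 2 powr s + 16 * 2 powr s) * paraprod s k j" for k j
  proof -
    have "\<bar>c k j\<bar> \<le> \<bar>2 * pi * (w k - w j) * of_int j\<bar> + \<bar>w k * rho k j\<bar>" unfolding c_def by linarith
    also have "\<bar>2 * pi * (w k - w j) * of_int j\<bar> = \<bar>w k - w j\<bar> * (2 * pi * \<bar>of_int j\<bar>)"
      by (simp add: abs_mult)
    also have "\<dots> \<le> \<bar>w k - w j\<bar> * jb j" by (intro mult_left_mono jb_ge) auto
    also have "\<dots> \<le> s * 3 * 2 powr s * paraprod s k j" unfolding w_def by (rule weight_comm[OF s])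
    also have "\<bar>w k * rho k j\<bar> \<le> 16 * 2 powr s * paraprod s k j"
      using weight_rho[OF s, of k j] by (simp add: abs_mult w_def)
    finally show ?thesis by (simp add: distrib_right)
  qed
  have A: "\<bar>Im (\<Sum>k\<in>S. \<Sum>j\<in>S. of_int j * (cnj (z k) * z j * a (k - j)))\<bar> * (2 * pi) \<le> W * E"
  proof -
    have "\<bar>Im (\<Sum>k\<in>S. \<Sum>j\<in>S. of_int j * (cnj (z k) * z j * a (k - j)))\<bar> * (2 * pi)
        \<le> (\<Sum>k\<in>S. \<Sum>j\<in>S. cmod (z k) * cmod (z j) * (\<bar>of_int (k - j)\<bar> * cmod (a (k - j)))) / 2 * (2 * pi)"
      by (intro mult_right_mono skew_bound(1) S a) auto
    also have "\<dots> = (\<Sum>k\<in>S. \<Sum>j\<in>S. cmod (z k) * cmod (z j) * (pi * \<bar>of_int (k - j)\<bar> * cmod (a (k - j))))"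
      by (simp add: sum_distrib_left sum_distrib_right mult_ac)
    also have "\<dots> \<le> (\<Sum>k\<in>S. \<Sum>j\<in>S. cmod (z k) * cmod (z j) * (jb (k - j) * cmod (a (k - j))))"
    proof (intro sum_mono mult_left_mono mult_right_mono)
      fix k j show "pi * \<bar>real_of_int (k - j)\<bar> \<le> jb (k - j)"
        by (rule jb_ge_pi)
    qed auto
    also have "\<dots> \<le> W * (E + E) / 2"
      unfolding W_def E_def nz[symmetric]
      by (rule trilinear1[OF S]) (use a(2) in \<open>auto simp: jb_nonneg\<close>)
    finally show ?thesis by simp
  qed
  have B: "\<bar>Im (\<Sum>k\<in>S. \<Sum>j\<in>S. of_real (c k j) * (cnj (z k) * (a j * a (k - j))))\<bar>
      \<le> (s * 3 * 2 powr s + 16 * 2 powr s) * (2 * (W * E))"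
  proof -
    have "cmod (\<Sum>k\<in>S. \<Sum>j\<in>S. of_real (c k j) * (cnj (z k) * (a j * a (k - j))))
      \<le> (\<Sum>k\<in>S. \<Sum>j\<in>S. \<bar>c k j\<bar> * (cmod (z k) * (cmod (a j) * cmod (a (k - j)))))"
      by (intro sum_norm_le) (auto simp: norm_mult)
    also have "\<dots> \<le> (\<Sum>k\<in>S. \<Sum>j\<in>S. (s * 3 * 2 powr s + 16 * 2 powr s) * paraprod s k j * (cmod (z k) * (cmod (a j) * cmod (a (k - j)))))"
      by (intro sum_mono mult_right_mono c) auto
    also have "\<dots> = (s * 3 * 2 powr s + 16 * 2 powr s) * 
       ((\<Sum>k\<in>S. \<Sum>j\<in>S. cmod (z k) * cmod (z j) * (jb (k - j) * cmod (a (k - j))))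
       + (\<Sum>k\<in>S. \<Sum>j\<in>S. cmod (z k) * (jb j * cmod (a j)) * cmod (z (k - j))))"
      unfolding nz w_def sum.distrib[symmetric] sum_distrib_left
      by (intro sum.cong refl) (simp only: algebra_simps)
    also have "\<dots> \<le> (s * 3 * 2 powr s + 16 * 2 powr s) * (W * (E + E) / 2 + W * (E + E) / 2)"
      unfolding W_def E_def nz[symmetric]
      using s
      by (intro mult_left_mono add_mono trilinear1[OF S] trilinear2[OF S]) (use a(2) z0 in \<open>auto simp: jb_nonneg\<close>)
    finally have "cmod (\<Sum>k\<in>S. \<Sum>j\<in>S. of_real (c k j) * (cnj (z k) * (a j * a (k - j))))
      \<le> (s * 3 * 2 powr s + 16 * 2 powr s) * (2 * (W * E))" by (simp add: mult.commute[of E W])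
    then show ?thesis using abs_Im_le_cmod order.trans by blast
  qed
  have "(\<Sum>k\<in>S. (w k)\<^sup>2 * Re (cnj (a k) * (\<Sum>j\<in>S. - \<i> * gam k j * (a j * a (k - j)))))
    = 2 * pi * Im (\<Sum>k\<in>S. \<Sum>j\<in>S. of_int j * (cnj (z k) * z j * a (k - j)))
     + Im (\<Sum>k\<in>S. \<Sum>j\<in>S. of_real (c k j) * (cnj (z k) * (a j * a (k - j))))"
    unfolding per sum.distrib Im_sum[symmetric]
    by (simp add: sum_distrib_left mult.assoc)
  moreover have "\<bar>2 * pi * X\<bar> = \<bar>X\<bar> * (2 * pi)" for X :: real by (simp add: abs_mult)
  ultimately have "\<bar>\<Sum>k\<in>S. (w k)\<^sup>2 * Re (cnj (a k) * (\<Sum>j\<in>S. - \<i> * gam k j * (a j * a (k - j))))\<bar>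
     \<le> W * E + (s * 3 * 2 powr s + 16 * 2 powr s) * (2 * (W * E))"
    using A B by (smt (verit))
  also have "\<dots> = en_const s * W * E" by (simp add: en_const_def algebra_simps)
  finally show ?thesis by (simp add: w_def W_def E_def)
qed

text \<open>The difference \<open>d\<close> of two solutions enters linearly, with their sum as
  \<open>g\<close>. No symmetrisation is available between distinct factors, so the derivative stays
  outside as \<open>k\<close>, and skew-symmetry in \<open>d\<close> throws it on \<open>g\<close>.
  In the constant 3, transport contributes 1 and \<open>rho_bound_sq\<close> contributes 2.\<close>

lemma l2_difference_bound:
  fixes d g :: "int \<Rightarrow> complex"
  assumes S: "finite S" and g: "symm g" "\<And>k. k \<notin> S \<Longrightarrow> g k = 0"
  shows "\<bar>\<Sum>k\<in>S. Re (cnj (d k) * (\<Sum>j\<in>S. - \<i> * gam k j * (d j * g (k - j))))\<bar>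
     \<le> 3 * (\<Sum>k\<in>S. (jb k)\<^sup>2 * cmod (g k)) * (\<Sum>k\<in>S. (cmod (d k))\<^sup>2)"
proof -
  define X where "X = (\<Sum>k\<in>S. \<Sum>j\<in>S. cmod (d k) * cmod (d j) * ((jb (k - j))\<^sup>2 * cmod (g (k - j))))"
  have per: "Re (cnj (d k) * (\<Sum>j\<in>S. - \<i> * gam k j * (d j * g (k - j))))
     = Im (\<Sum>j\<in>S. pi * (of_int k * (cnj (d k) * d j * g (k - j)))) 
       + Im (\<Sum>j\<in>S. of_real (rho k j) * (cnj (d k) * (d j * g (k - j))))" for k
  proof -
    have "(\<Sum>j\<in>S. - \<i> * gam k j * (d j * g (k - j))) = - \<i> * (\<Sum>j\<in>S. gam k j * (d j * g (k - j)))"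
      by (simp only: sum_distrib_left mult.assoc)
    then have "Re (cnj (d k) * (\<Sum>j\<in>S. - \<i> * gam k j * (d j * g (k - j))))
      = Im (cnj (d k) * (\<Sum>j\<in>S. gam k j * (d j * g (k - j))))"
      by (simp add: algebra_simps)
    also have "cnj (d k) * (\<Sum>j\<in>S. gam k j * (d j * g (k - j)))
      = (\<Sum>j\<in>S. pi * (of_int k * (cnj (d k) * d j * g (k - j))) + of_real (rho k j) * (cnj (d k) * (d j * g (k - j))))"
      unfolding sum_distrib_left
      by (intro sum.cong) (auto simp: rho_def algebra_simps)
    finally show ?thesis by (simp add: sum.distrib)
  qed
  have A: "pi * \<bar>Im (\<Sum>k\<in>S. \<Sum>j\<in>S. of_int k * (cnj (d k) * d j * g (k - j)))\<bar> \<le> X"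
  proof -
    have "pi * \<bar>Im (\<Sum>k\<in>S. \<Sum>j\<in>S. of_int k * (cnj (d k) * d j * g (k - j)))\<bar>
      \<le> pi * ((\<Sum>k\<in>S. \<Sum>j\<in>S. cmod (d k) * cmod (d j) * (\<bar>of_int (k - j)\<bar> * cmod (g (k - j)))) / 2)"
      by (intro mult_left_mono skew_bound(2) S g) auto
    also have "\<dots> = (\<Sum>k\<in>S. \<Sum>j\<in>S. cmod (d k) * cmod (d j) * ((pi / 2 * \<bar>of_int (k - j)\<bar>) * cmod (g (k - j))))"
      by (simp add: sum_distrib_left sum_distrib_right mult_ac sum_divide_distrib)
    also have "\<dots> \<le> X"
      unfolding X_def
    proof (intro sum_mono mult_left_mono mult_right_mono)
      fix k j :: int
      have "pi / 2 * \<bar>real_of_int (k - j)\<bar> \<le> pi * \<bar>real_of_int (k - j)\<bar>"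
        by (intro mult_right_mono) auto
      also have "\<dots> \<le> jb (k - j)" by (rule jb_ge_pi)
      also have "\<dots> \<le> (jb (k - j))\<^sup>2" using jb_ge1[of "k-j"] by (simp add: power2_eq_square)
      finally show "pi / 2 * \<bar>real_of_int (k - j)\<bar> \<le> (jb (k - j))\<^sup>2" .
    qed auto
    finally show ?thesis .
  qed
  have B: "\<bar>Im (\<Sum>k\<in>S. \<Sum>j\<in>S. of_real (rho k j) * (cnj (d k) * (d j * g (k - j))))\<bar> \<le> 2 * X"
  proof -
    have "cmod (\<Sum>k\<in>S. \<Sum>j\<in>S. of_real (rho k j) * (cnj (d k) * (d j * g (k - j))))
      \<le> (\<Sum>k\<in>S. \<Sum>j\<in>S. \<bar>rho k j\<bar> * (cmod (d k) * (cmod (d j) * cmod (g (k - j)))))"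
      by (intro sum_norm_le) (auto simp: norm_mult)
    also have "\<dots> \<le> (\<Sum>k\<in>S. \<Sum>j\<in>S. 2 * (jb (k - j))\<^sup>2 * (cmod (d k) * (cmod (d j) * cmod (g (k - j)))))"
      by (intro sum_mono mult_right_mono rho_bound_sq) auto
    also have "\<dots> = 2 * X" by (simp add: X_def sum_distrib_left mult_ac)
    finally show ?thesis using abs_Im_le_cmod order.trans by blast
  qed
  have X: "X \<le> (\<Sum>k\<in>S. (jb k)\<^sup>2 * cmod (g k)) * ((\<Sum>k\<in>S. (cmod (d k))\<^sup>2) + (\<Sum>k\<in>S. (cmod (d k))\<^sup>2)) / 2"
    unfolding X_def by (rule trilinear1[OF S]) (use g in auto)
  have "(\<Sum>k\<in>S. Re (cnj (d k) * (\<Sum>j\<in>S. - \<i> * gam k j * (d j * g (k - j)))))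
    = pi * Im (\<Sum>k\<in>S. \<Sum>j\<in>S. of_int k * (cnj (d k) * d j * g (k - j)))
     + Im (\<Sum>k\<in>S. \<Sum>j\<in>S. of_real (rho k j) * (cnj (d k) * (d j * g (k - j))))"
    unfolding per sum.distrib Im_sum[symmetric]
    by (simp add: sum_distrib_left)
  moreover have "\<bar>pi * Y\<bar> = pi * \<bar>Y\<bar>" for Y :: real by (simp add: abs_mult)
  ultimately have "\<bar>\<Sum>k\<in>S. Re (cnj (d k) * (\<Sum>j\<in>S. - \<i> * gam k j * (d j * g (k - j))))\<bar> \<le> 3 * X"
    using A B by (smt (verit))
  then show ?thesis using X by simp
qed

subsection \<open>Sobolev balls of Fourier coefficients\<close>

lemma summable_jb:
  assumes "r > 1/2"
  shows "(\<lambda>k. jb k powr (- 2 * r)) summable_on UNIV"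
proof -
  define f where "f k = jb k powr (- 2 * r)" for k
  have fb: "f (int n) \<le> real n powr (- 2 * r)" if "n \<ge> 1" for n
  proof -
    have "real n \<le> pi * \<bar>real_of_int (int n)\<bar>"
      using mult_right_mono[of 1 pi "real n"] pi_gt3 by simp
    also have "\<dots> \<le> jb (int n)" by (rule jb_ge_pi)
    finally show ?thesis unfolding f_def using that assms by (intro powr_mono2') auto
  qed
  have "summable (\<lambda>n. f (int n))"
  proof (rule summable_comparison_test)
    show "summable (\<lambda>n. real n powr (- 2 * r))" using assms by (subst summable_real_powr_iff) auto
    show "\<exists>N. \<forall>n\<ge>N. norm (f (int n)) \<le> real n powr (- 2 * r)"
      using fb by (intro exI[of _ 1]) (auto simp: f_def)
  qed
  then have N: "(\<lambda>n. f (int n)) summable_on UNIV"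
    by (subst summable_on_UNIV_nonneg_real_iff) (auto simp: f_def)
  then have 1: "f summable_on range int"
    by (subst summable_on_reindex) (auto simp: o_def)
  have "(\<lambda>n. f (- int n)) summable_on UNIV" using N by (simp add: f_def)
  then have 2: "f summable_on range (\<lambda>n. - int n)"
    by (subst summable_on_reindex) (auto simp: o_def inj_on_def)
  have "f summable_on (range int \<union> (range (\<lambda>n. - int n) - range int))"
    using 1 summable_on_subset_banach[OF 2, of "range (\<lambda>n. - int n) - range int"]
    by (intro summable_on_Un_disjoint) auto
  moreover have "range int \<union> (range (\<lambda>n. - int n) - range int) = UNIV"
  proof -
    have "k \<in> range int \<or> k \<in> range (\<lambda>n. - int n)" for k
      by (cases k rule: int_cases2) auto
    then show ?thesis by blast
  qed
  ultimately show ?thesis unfolding f_def by (simp only:)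
qed

text \<open>The Cauchy-Schwarz constant of the embedding of H^r into absolutely summable sequences,
  meaningful for r > 1/2.\<close>

definition zt :: "real \<Rightarrow> real" where
  "zt r = sqrt (infsum (\<lambda>k. jb k powr (- 2 * r)) UNIV)"

lemma zt_nonneg: "zt r \<ge> 0"
  unfolding zt_def by (simp add: infsum_nonneg)

lemma l1_bound:
  assumes r: "r > 1/2" and S: "finite S" and x: "\<And>k. x k \<ge> 0"
  shows "(\<Sum>k\<in>S. x k) \<le> zt r * sqrt (\<Sum>k\<in>S. (jb k powr r * x k)\<^sup>2)"
proof -
  have "(\<Sum>k\<in>S. x k) = (\<Sum>k\<in>S. \<bar>jb k powr (- r)\<bar> * \<bar>jb k powr r * x k\<bar>)"
  proof (intro sum.cong refl)
    fix k show "x k = \<bar>jb k powr (- r)\<bar> * \<bar>jb k powr r * x k\<bar>"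
      using x[of k] jb_pos[of k] by (simp add: abs_mult powr_minus)
  qed
  also have "\<dots> \<le> L2_set (\<lambda>k. jb k powr (- r)) S * L2_set (\<lambda>k. jb k powr r * x k) S"
    by (rule L2_set_mult_ineq)
  also have "\<dots> \<le> zt r * L2_set (\<lambda>k. jb k powr r * x k) S"
  proof -
    have "(\<Sum>k\<in>S. (jb k powr (- r))\<^sup>2) = (\<Sum>k\<in>S. jb k powr (- 2 * r))"
      by (simp add: power2_eq_square flip: powr_add)
    also have "\<dots> \<le> infsum (\<lambda>k. jb k powr (- 2 * r)) UNIV"
      by (rule finite_sum_le_infsum) (use S summable_jb[OF r] in auto)
    finally have "L2_set (\<lambda>k. jb k powr (- r)) S \<le> zt r"
      unfolding L2_set_def zt_def by (rule real_sqrt_le_mono)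
    then show ?thesis by (rule mult_right_mono) simp
  qed
  finally show ?thesis by (simp add: L2_set_def)
qed

text \<open>Bounding every finite partial sum says at once that the \<open>H\<^sup>s\<close> series converges and that its norm is at most \<open>R\<close>.\<close>

definition hsb :: "real \<Rightarrow> real \<Rightarrow> (int \<Rightarrow> complex) \<Rightarrow> bool" where
  "hsb s R a \<longleftrightarrow> (\<forall>S. finite S \<longrightarrow> (\<Sum>k\<in>S. (jb k powr s * cmod (a k))\<^sup>2) \<le> R\<^sup>2)"

lemma hsbD: "hsb s R a \<Longrightarrow> finite S \<Longrightarrow> (\<Sum>k\<in>S. (jb k powr s * cmod (a k))\<^sup>2) \<le> R\<^sup>2"
  by (simp add: hsb_def)

lemma hsb_mono: "hsb s R a \<Longrightarrow> R \<ge> 0 \<Longrightarrow> R \<le> R' \<Longrightarrow> hsb s R' a"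
  unfolding hsb_def using power_mono[of R R' 2] by (auto intro: order.trans)

lemma hsb_single:
  assumes "hsb s R a" "R \<ge> 0"
  shows "jb k powr s * cmod (a k) \<le> R"
  using hsbD[OF assms(1), of "{k}"] assms(2) by (simp add: abs_le_square_iff flip: abs_le_square_iff)

lemma jb_powr_mono: "p \<le> q \<Longrightarrow> jb k powr p \<le> jb k powr q"
  using jb_ge1[of k] by (intro powr_mono) auto

lemma jb_powr_ge1: "s \<ge> 0 \<Longrightarrow> jb k powr s \<ge> 1"
  using jb_ge1[of k] by (simp add: ge_one_powr_ge_zero)

lemma hsb_l1:
  assumes a: "hsb s R a" "R \<ge> 0" and p: "s - p > 1/2" and S: "finite S"
  shows "(\<Sum>k\<in>S. jb k powr p * cmod (a k)) \<le> zt (s - p) * R"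
proof -
  have "(\<Sum>k\<in>S. jb k powr p * cmod (a k))
      \<le> zt (s - p) * sqrt (\<Sum>k\<in>S. (jb k powr (s - p) * (jb k powr p * cmod (a k)))\<^sup>2)"
    by (rule l1_bound[OF p S]) auto
  also have "(\<Sum>k\<in>S. (jb k powr (s - p) * (jb k powr p * cmod (a k)))\<^sup>2) = (\<Sum>k\<in>S. (jb k powr s * cmod (a k))\<^sup>2)"
    by (simp add: mult.assoc[symmetric] flip: powr_add)
  also have "zt (s - p) * sqrt \<dots> \<le> zt (s - p) * R"
    using hsbD[OF a(1) S] a(2) by (intro mult_left_mono zt_nonneg) (simp add: real_le_lsqrt)
  finally show ?thesis .
qed

text \<open>On frequencies beyond n, q spare derivatives are worth a factor n^(-q). The sequence
  enters only through R, so the tails are uniform on Sobolev balls.\<close>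

lemma hsb_tail:
  assumes a: "hsb s R a" "R \<ge> 0" and q: "q \<ge> 0" "s - p - q > 1/2" and S: "finite S"
    and n: "n \<ge> 1" "\<And>k. k \<in> S \<Longrightarrow> real n \<le> \<bar>of_int k\<bar>"
  shows "(\<Sum>k\<in>S. jb k powr p * cmod (a k)) \<le> real n powr (- q) * (zt (s - p - q) * R)"
proof -
  have "(\<Sum>k\<in>S. jb k powr p * cmod (a k)) \<le> (\<Sum>k\<in>S. real n powr (- q) * (jb k powr (p + q) * cmod (a k)))"
  proof (intro sum_mono)
    fix k assume k: "k \<in> S"
    have "real n \<le> 1 * \<bar>of_int k\<bar>" using n(2)[OF k] by simp
    also have "\<dots> \<le> pi * \<bar>of_int k\<bar>" using pi_gt3 by (intro mult_right_mono) auto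
    also have "\<dots> \<le> jb k" by (rule jb_ge_pi)
    finally have "real n powr q \<le> jb k powr q" using q n by (intro powr_mono2) auto
    then have "real n powr (- q) * real n powr q \<le> real n powr (- q) * jb k powr q" by (intro mult_left_mono) auto
    then have "1 \<le> real n powr (- q) * jb k powr q" using n by (simp flip: powr_add)
    then have "1 * (jb k powr p * cmod (a k)) \<le> (real n powr (- q) * jb k powr q) * (jb k powr p * cmod (a k))"
      by (intro mult_right_mono) auto
    also have "\<dots> = real n powr (- q) * (jb k powr (p + q) * cmod (a k))"
      by (simp add: powr_add mult_ac)
    finally show "jb k powr p * cmod (a k) \<le> real n powr (- q) * (jb k powr (p + q) * cmod (a k))" by simp
  qed
  also have "\<dots> \<le> real n powr (- q) * (zt (s - (p + q)) * R)"
    unfolding sum_distrib_left[symmetric]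
    by (intro mult_left_mono hsb_l1[OF a]) (use q S in auto)
  finally show ?thesis by (simp add: diff_diff_eq)
qed

subsection \<open>Galerkin approximation\<close>

lemma cmod_sq_deriv:
  assumes "(f has_vector_derivative f') (at t within A)"
  shows "((\<lambda>t. (cmod (f t))\<^sup>2) has_real_derivative 2 * Re (cnj (f t) * f')) (at t within A)"
proof -
  have 1: "((\<lambda>t. Re (f t)) has_real_derivative Re f') (at t within A)"
    using bounded_linear.has_vector_derivative[OF bounded_linear_Re assms]
    by (simp add: has_real_derivative_iff_has_vector_derivative)
  have 2: "((\<lambda>t. Im (f t)) has_real_derivative Im f') (at t within A)"
    using bounded_linear.has_vector_derivative[OF bounded_linear_Im assms]
    by (simp add: has_real_derivative_iff_has_vector_derivative)
  show ?thesis unfolding cmod_power2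
    by (rule derivative_eq_intros 1 2 refl)+ (simp add: algebra_simps)
qed

definition freqs :: "nat \<Rightarrow> int set" where "freqs N = {- int N..int N}"

lemma finite_freqs [simp]: "finite (freqs N)" and freqs_minus: "- k \<in> freqs N \<longleftrightarrow> k \<in> freqs N"
  and card_freqs: "card (freqs N) = 2 * N + 1"
  by (auto simp: freqs_def)

lemma not_in_freqs: "k \<notin> freqs N \<Longrightarrow> real N \<le> \<bar>of_int k\<bar>"
  by (auto simp: freqs_def)

text \<open>Only \<open>j\<close> is confined to \<open>S\<close>. For a sequence supported in
  \<open>S\<close> the factor \<open>a (k - j)\<close> confines the other frequency, and the sum is
  the complete quadratic term.\<close>

definition qfin :: "int set \<Rightarrow> (int \<Rightarrow> complex) \<Rightarrow> int \<Rightarrow> complex" where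
  "qfin S a k = (\<Sum>j\<in>S. - \<i> * gam k j * (a j * a (k - j)))"

lemma qfin_cnj:
  assumes "symm a"
  shows "qfin (freqs N) a (- k) = cnj (qfin (freqs N) a k)"
proof -
  have "qfin (freqs N) a (- k) = (\<Sum>j\<in>freqs N. - \<i> * gam (- k) (- j) * (a (- j) * a (- (k - j))))"
    unfolding qfin_def
    by (rule sum.reindex_bij_witness[of _ uminus uminus]) (auto simp: freqs_minus)
  also have "\<dots> = cnj (qfin (freqs N) a k)"
    unfolding qfin_def using symmD[OF assms] by (simp only: gam_minus) simp
  finally show ?thesis .
qed

text \<open>Radial retraction onto the ball of radius R. It turns a quadratic vector field into a
  globally Lipschitz one without changing it inside the ball.\<close>

lemma clip_lipschitz:
  fixes a b :: "'a::real_normed_vector"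
  assumes R: "R > 0"
  defines "cl \<equiv> \<lambda>a::'a. (R / max R (norm a)) *\<^sub>R a"
  shows "norm (cl a - cl b) \<le> 2 * norm (a - b)" "norm (cl a) \<le> R"
proof -
  define ma mb where "ma = max R (norm a)" "mb = max R (norm b)"
  have m: "ma > 0" "mb > 0" "R \<le> ma" "R \<le> mb" "norm b \<le> mb" "norm a \<le> ma" using R by (auto simp: ma_mb_def)
  have mm: "\<bar>mb - ma\<bar> \<le> norm (a - b)"
    using norm_triangle_ineq3[of a b] by (auto simp: ma_mb_def max_def)
  have "cl a - cl b = (R / ma) *\<^sub>R (a - b) + (R / ma - R / mb) *\<^sub>R b"
    unfolding cl_def ma_mb_def by (simp add: algebra_simps)
  then have "norm (cl a - cl b) \<le> (R / ma) * norm (a - b) + \<bar>R / ma - R / mb\<bar> * norm b"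
    using norm_triangle_ineq[of "(R / ma) *\<^sub>R (a - b)" "(R / ma - R / mb) *\<^sub>R b"] R m by simp
  also have "R / ma - R / mb = (R / ma) * ((mb - ma) / mb)" using m by (simp add: field_simps)
  also have "\<bar>(R / ma) * ((mb - ma) / mb)\<bar> * norm b = (R / ma) * \<bar>mb - ma\<bar> * (norm b / mb)"
    using R m by (simp add: abs_mult)
  also have "\<dots> \<le> 1 * norm (a - b) * 1"
    using R m mm by (intro mult_mono) auto
  also have "(R / ma) * norm (a - b) \<le> 1 * norm (a - b)" using R m by (intro mult_right_mono) auto
  finally show "norm (cl a - cl b) \<le> 2 * norm (a - b)" by simp
  have "norm (cl a) = R * (norm a / ma)" using R m by (simp add: cl_def ma_mb_def)
  also have "\<dots> \<le> R * 1" using R m by (intro mult_left_mono) auto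
  finally show "norm (cl a) \<le> R" by simp
qed

instance bcontfun :: (metric_space, banach) banach ..

lemma bounded_linear_bcontfun_at: "bounded_linear (\<lambda>x :: real \<Rightarrow>\<^sub>C complex. apply_bcontfun x k)"
  by (rule bounded_linear_intro[where K = 1]) (auto simp: norm_bounded)

text \<open>It combines E' <= 2 \<open>en_const s\<close> W E with W <= \<open>zt (s - 1)\<close>
  sqrt E; the added 1 makes it positive, as \<open>riccati_bound\<close> asks.\<close>

definition gal_const :: "real \<Rightarrow> real" where
  "gal_const s = 2 * en_const s * (zt (s - 1) + 1)"

lemma en_const_pos: "s \<ge> 0 \<Longrightarrow> en_const s > 0"
  unfolding en_const_def by (intro add_pos_nonneg) auto

lemma gal_const_pos: "s \<ge> 0 \<Longrightarrow> gal_const s > 0"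
  unfolding gal_const_def using en_const_pos[of s] zt_nonneg[of "s-1"] by simp

text \<open>The lifespan depends on s and R but not on N, because the constants of the energy
  inequality do not see the frequency set. The last conclusion records the finer bound that starts
  at the initial energy and grows at the rate of an l^1 bound K; \<open>tame_local\<close> carries
  it to the limit.\<close>

lemma galerkin:
  fixes a0 :: "int \<Rightarrow> complex"
  assumes s: "s > 3/2" and R: "R > 0" and a0: "symm a0" "hsb s R a0"
    and T: "T \<ge> 0" "gal_const s * R * T \<le> 1/2"
  obtains a where
    "\<And>k. a 0 k = (if k \<in> freqs N then a0 k else 0)"
    "\<And>t k. t \<in> {0..T} \<Longrightarrow> k \<notin> freqs N \<Longrightarrow> a t k = 0"
    "\<And>t. t \<in> {0..T} \<Longrightarrow> symm (a t)"
    "\<And>t. t \<in> {0..T} \<Longrightarrow> hsb s (3 * R) (a t)"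
    "\<And>t k. t \<in> {0..T} \<Longrightarrow> k \<in> freqs N \<Longrightarrow>
        ((\<lambda>t. a t k) has_vector_derivative qfin (freqs N) (a t) k) (at t within {0..T})"
    "\<And>K t. \<lbrakk>K \<ge> 0; t \<in> {0..T}; \<And>t. t \<in> {0..T} \<Longrightarrow> (\<Sum>k\<in>freqs N. jb k * cmod (a t k)) \<le> K\<rbrakk> \<Longrightarrow>
        (\<Sum>k\<in>freqs N. (jb k powr s * cmod (a t k))\<^sup>2)
          \<le> (\<Sum>k\<in>freqs N. (jb k powr s * cmod (a0 k))\<^sup>2) * exp (2 * en_const s * K * t)"
proof -
  define S where "S = freqs N"
  have S: "finite S" "\<And>k. - k \<in> S \<longleftrightarrow> k \<in> S" by (auto simp: S_def freqs_minus)
  \<comment> \<open>It bounds the supremum of the interpolants below as soon as all coefficients are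
    at most 3 R, so the clipping turns out to be inactive.\<close>
  define Rc where "Rc = real (card S) * (3 * R)"
  have Rc: "Rc > 0" using R by (simp add: Rc_def S_def card_freqs)
  define V where "V a k = (if k \<in> S then qfin S a k else 0)" for a k
  define co :: "(real \<Rightarrow>\<^sub>C complex) \<Rightarrow> int \<Rightarrow> complex" where "co a k = apply_bcontfun a (of_int k)" for a k
  define cl where "cl = (\<lambda>a :: real \<Rightarrow>\<^sub>C complex. (Rc / max Rc (norm a)) *\<^sub>R a)"
  \<comment> \<open>Averaging with the conjugate reflection makes the field preserve the reality
    condition by construction; on sequences with that condition it agrees with
    \<open>V\<close>.\<close>
  define Fr where "Fr a k = (V (co (cl a)) k + cnj (V (co (cl a)) (- k))) / 2" for a k
  \<comment> \<open>The dimension depends on N, so coefficient vectors have no type of their own.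
    They are stored as piecewise linear functions with the coefficients as values at the integers,
    inside the Banach space of bounded continuous functions.\<close>
  define hat where "hat x = max 0 (1 - \<bar>x\<bar>)" for x :: real
  have hat: "0 \<le> hat x" "hat x \<le> 1" for x by (auto simp: hat_def)
  have hat_int: "hat (of_int l - of_int k) = (if k = l then 1 else 0)" for k l :: int
  proof -
    have "\<bar>real_of_int l - of_int k\<bar> \<ge> 1" if "k \<noteq> l" using that by linarith
    then show ?thesis by (auto simp: hat_def)
  qed
  define ext where "ext b = Bcontfun (\<lambda>x. \<Sum>k\<in>S. of_real (hat (x - of_int k)) * b k)" for b :: "int \<Rightarrow> complex"
  have ext: "apply_bcontfun (ext b) x = (\<Sum>k\<in>S. of_real (hat (x - of_int k)) * b k)" for b x
  proof -
    have "(\<lambda>x. \<Sum>k\<in>S. of_real (hat (x - of_int k)) * b k) \<in> bcontfun"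
    proof (rule bcontfun_normI[of _ "\<Sum>k\<in>S. 1 * cmod (b k)"])
      show "continuous_on UNIV (\<lambda>x. \<Sum>k\<in>S. of_real (hat (x - of_int k)) * b k)"
        unfolding hat_def by (intro continuous_intros)
      show "cmod (\<Sum>k\<in>S. of_real (hat (x - of_int k)) * b k) \<le> (\<Sum>k\<in>S. 1 * cmod (b k))" for x
        unfolding norm_mult norm_of_real using hat
        by (intro sum_norm_le) (simp add: norm_mult mult_left_le_one_le)
    qed
    then show ?thesis by (simp add: ext_def Bcontfun_inverse)
  qed
  have ext_co: "co (ext b) k = (if k \<in> S then b k else 0)" for b k
  proof -
    have "co (ext b) k = (\<Sum>l\<in>S. if k = l then b l else 0)"
      unfolding co_def ext by (intro sum.cong) (auto simp: hat_int)
    then show ?thesis using S by simp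
  qed
  define F where "F a = ext (Fr a)" for a
  define Gm where "Gm = (\<Sum>k\<in>S. \<Sum>j\<in>S. \<bar>gam k j\<bar>)"
  have Gm: "(\<Sum>j\<in>S. \<bar>gam k j\<bar>) \<le> Gm" if "k \<in> S" for k
    unfolding Gm_def using that S by (intro member_le_sum) (auto intro: sum_nonneg)
  have Gm0: "Gm \<ge> 0" unfolding Gm_def by (intro sum_nonneg) auto
  have co_le: "cmod (co a k) \<le> norm a" for a k by (simp add: co_def norm_bounded)
  have Vlip: "cmod (V (co a) k - V (co b) k) \<le> Gm * (2 * Rc * norm (a - b))"
    if ab: "norm a \<le> Rc" "norm b \<le> Rc" for a b and k
  proof (cases "k \<in> S")
    case True
    have "cmod (co a j * co a (k - j) - co b j * co b (k - j)) \<le> 2 * Rc * norm (a - b)" for j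
    proof -
      have "co a j * co a (k - j) - co b j * co b (k - j) = co a j * co (a - b) (k - j) + co (a - b) j * co b (k - j)"
        by (simp add: co_def algebra_simps)
      then have "cmod (co a j * co a (k - j) - co b j * co b (k - j)) \<le> cmod (co a j) * cmod (co (a - b) (k - j)) + cmod (co (a - b) j) * cmod (co b (k - j))"
        by (metis norm_triangle_ineq norm_mult)
      also have "\<dots> \<le> Rc * norm (a - b) + norm (a - b) * Rc"
        using ab Rc by (intro add_mono mult_mono co_le order.trans[OF co_le]) auto
      finally show ?thesis by simp
    qed
    note * = this
    have "cmod (V (co a) k - V (co b) k) = cmod (\<Sum>j\<in>S. - \<i> * gam k j * (co a j * co a (k - j) - co b j * co b (k - j)))"
      using True by (simp only: V_def qfin_def sum_subtractf right_diff_distrib if_True)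
    also have "\<dots> \<le> (\<Sum>j\<in>S. \<bar>gam k j\<bar> * (2 * Rc * norm (a - b)))"
      using * by (intro sum_norm_le) (auto simp: norm_mult intro!: mult_left_mono)
    also have "\<dots> = (\<Sum>j\<in>S. \<bar>gam k j\<bar>) * (2 * Rc * norm (a - b))"
      by (simp add: sum_distrib_right)
    also have "\<dots> \<le> Gm * (2 * Rc * norm (a - b))" using Gm[OF True] Rc by (intro mult_right_mono) auto
    finally show ?thesis .
  qed (use Rc Gm0 in \<open>simp add: V_def\<close>)
  have Fr_lip: "cmod (Fr a k - Fr b k) \<le> Gm * (2 * Rc * norm (cl a - cl b))" for a b k
  proof -
    have n: "norm (cl a) \<le> Rc" "norm (cl b) \<le> Rc"
      unfolding cl_def by (rule clip_lipschitz(2), use Rc in simp)+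
    have "Fr a k - Fr b k = ((V (co (cl a)) k - V (co (cl b)) k) + cnj (V (co (cl a)) (- k) - V (co (cl b)) (- k))) / 2"
      by (simp add: Fr_def add_divide_distrib diff_divide_distrib)
    moreover have "cmod ((u + cnj v) / 2) \<le> C" if "cmod u \<le> C" "cmod v \<le> C" for u v C
      using norm_triangle_ineq[of u "cnj v"] that by (simp add: norm_divide)
    ultimately show ?thesis using Vlip[OF n] by (simp only:)
  qed
  define L where "L = real (card S) * (Gm * (4 * Rc)) + 1"
  have L: "L > 0" using Gm0 Rc unfolding L_def by (intro add_nonneg_pos) auto
  have Flip: "norm (F a - F b) \<le> L * norm (a - b)" for a b
  proof (rule norm_bound)
    fix x
    have "apply_bcontfun (F a - F b) x = (\<Sum>k\<in>S. of_real (hat (x - of_int k)) * (Fr a k - Fr b k))"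
      by (simp add: F_def ext sum_subtractf right_diff_distrib)
    also have "cmod \<dots> \<le> (\<Sum>k\<in>S. 1 * (Gm * (2 * Rc * norm (cl a - cl b))))"
    proof (rule sum_norm_le)
      fix k
      have "cmod (of_real (hat (x - of_int k)) * (Fr a k - Fr b k)) = hat (x - of_int k) * cmod (Fr a k - Fr b k)"
        using hat by (simp add: norm_mult)
      also have "\<dots> \<le> 1 * (Gm * (2 * Rc * norm (cl a - cl b)))"
        using hat by (intro mult_mono Fr_lip) auto
      finally show "cmod (of_real (hat (x - of_int k)) * (Fr a k - Fr b k)) \<le> 1 * (Gm * (2 * Rc * norm (cl a - cl b)))" .
    qed
    also have "\<dots> = real (card S) * (Gm * (2 * Rc * norm (cl a - cl b)))" by simp
    also have "\<dots> \<le> real (card S) * (Gm * (2 * Rc * (2 * norm (a - b))))"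
      unfolding cl_def using Rc Gm0 by (intro mult_left_mono clip_lipschitz(1)) auto
    also have "\<dots> \<le> L * norm (a - b)" by (simp add: L_def algebra_simps)
    finally show "cmod (apply_bcontfun (F a - F b) x) \<le> L * norm (a - b)" .
  qed
  obtain y where y0: "y 0 = ext a0" and y: "\<And>t. t \<in> {0..T} \<Longrightarrow> (y has_vector_derivative F (y t)) (at t within {0..T})"
    using picard_lipschitz[OF T(1) L Flip] by metis
  define a where "a t = co (y t)" for t
  have da: "((\<lambda>t. a t k) has_vector_derivative (if k \<in> S then Fr (y t) k else 0)) (at t within {0..T})"
    if "t \<in> {0..T}" for t k
    using bounded_linear.has_vector_derivative[OF bounded_linear_bcontfun_at y[OF that], of "of_int k"]
    unfolding F_def co_def[symmetric] ext_co a_def .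
  have a0': "a 0 k = (if k \<in> S then a0 k else 0)" for k by (simp add: a_def y0 ext_co)
  have T0: "0 \<in> {0..T}" using T by simp
  have const: "f t = f 0" if "\<And>t. t \<in> {0..T} \<Longrightarrow> (f has_vector_derivative 0) (at t within {0..T})" "t \<in> {0..T}"
    for f :: "real \<Rightarrow> complex" and t
    using has_vector_derivative_zero_constant[of "{0..T}" f] that T0 by (metis convex_closed_interval box_real(2) convex_real_interval(5))
  have supp: "a t k = 0" if "t \<in> {0..T}" "k \<notin> S" for t k
  proof -
    have "a t k = a 0 k" using const[of "\<lambda>t. a t k" t] da[of _ k] that by simp
    then show ?thesis using a0' that by simp
  qed
  have sym: "symm (a t)" if "t \<in> {0..T}" for t
    unfolding symm_def
  proof
    fix k
    have "((\<lambda>t. a t (- k) - cnj (a t k)) has_vector_derivative 0) (at t within {0..T})" if "t \<in> {0..T}" for t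
    proof -
      have "((\<lambda>t. a t (- k) - cnj (a t k)) has_vector_derivative ((if - k \<in> S then Fr (y t) (- k) else 0) - cnj (if k \<in> S then Fr (y t) k else 0))) (at t within {0..T})"
        using that by (intro has_vector_derivative_diff da bounded_linear.has_vector_derivative[OF bounded_linear_cnj])
      then show ?thesis using S by (cases "k \<in> S") (simp_all add: Fr_def add.commute)
    qed
    then have "a t (- k) - cnj (a t k) = a 0 (- k) - cnj (a 0 k)"
      using const[of "\<lambda>t. a t (- k) - cnj (a t k)" t] that by blast
    then show "a t (- k) = cnj (a t k)" using a0' S symmD[OF a0(1), of k] by (auto split: if_splits)
  qed
  \<comment> \<open>The clipping factor. The field is quadratic, so clipping multiplies it by the
    square of \<open>th\<close>, which is at most 1 and does not spoil the energy
    inequality.\<close>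
  define th where "th t = Rc / max Rc (norm (y t))" for t
  have th: "0 \<le> th t" "th t \<le> 1" for t using Rc by (auto simp: th_def)
  have Fr: "Fr (y t) k = of_real ((th t)\<^sup>2) * qfin S (a t) k" if "t \<in> {0..T}" "k \<in> S" for t k
  proof -
    have c: "co (cl (y t)) k = of_real (th t) * a t k" for k
      by (simp add: cl_def th_def a_def co_def scaleR_conv_of_real)
    then have "symm (co (cl (y t)))" using sym[OF that(1)] by (simp add: symm_def)
    then have "Fr (y t) k = qfin S (co (cl (y t))) k"
      using that S qfin_cnj[of "co (cl (y t))" N k] by (simp add: Fr_def V_def S_def[symmetric])
    also have "\<dots> = of_real ((th t)\<^sup>2) * qfin S (a t) k"
      unfolding qfin_def c sum_distrib_left by (intro sum.cong) (auto simp: power2_eq_square)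
    finally show ?thesis .
  qed
  define E where "E t = (\<Sum>k\<in>S. (jb k powr s * cmod (a t k))\<^sup>2)" for t
  define W where "W t = (\<Sum>k\<in>S. jb k * cmod (a t k))" for t
  define E' where "E' t = (\<Sum>k\<in>S. (jb k powr s)\<^sup>2 * (2 * Re (cnj (a t k) * Fr (y t) k)))" for t
  have E0: "E t \<ge> 0" and W0: "W t \<ge> 0" for t
    by (auto simp: E_def W_def jb_nonneg intro!: sum_nonneg)
  have dE: "(E has_real_derivative E' t) (at t within {0..T})" if "t \<in> {0..T}" for t
    unfolding E_def E'_def power_mult_distrib
  proof (intro DERIV_sum DERIV_cmult cmod_sq_deriv)
    fix k assume "k \<in> S"
    then show "((\<lambda>t. a t k) has_vector_derivative Fr (y t) k) (at t within {0..T})"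
      using da[OF that, of k] by simp
  qed
  have E'b: "E' t \<le> 2 * en_const s * W t * E t" if t: "t \<in> {0..T}" for t
  proof -
    have "E' t = 2 * (th t)\<^sup>2 * (\<Sum>k\<in>S. (jb k powr s)\<^sup>2 * Re (cnj (a t k) * (\<Sum>j\<in>S. - \<i> * gam k j * (a t j * a t (k - j)))))"
      unfolding E'_def sum_distrib_left[where r = "2 * (th t)\<^sup>2"]
    proof (intro sum.cong refl)
      fix k assume k: "k \<in> S"
      have re: "Re (cnj (a t k) * (of_real x * q)) = x * Re (cnj (a t k) * q)" for q x
        by (simp add: algebra_simps)
      show "(jb k powr s)\<^sup>2 * (2 * Re (cnj (a t k) * Fr (y t) k)) =
         2 * (th t)\<^sup>2 * ((jb k powr s)\<^sup>2 * Re (cnj (a t k) * (\<Sum>j\<in>S. - \<i> * gam k j * (a t j * a t (k - j)))))"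
        unfolding Fr[OF t k] re qfin_def by (simp only: mult_ac)
    qed
    also have "\<dots> \<le> 2 * (th t)\<^sup>2 * (en_const s * W t * E t)"
      using energy_bound[OF S(1) sym[OF t], of s] supp[OF t] s
      by (intro mult_left_mono) (auto simp: W_def E_def abs_le_iff)
    also have "\<dots> \<le> 2 * 1 * (en_const s * W t * E t)"
      using th[of t] s E0[of t] W0[of t] en_const_pos[of s] by (intro mult_right_mono mult_left_mono power_le_one) auto
    finally show ?thesis by (simp add: mult_ac)
  qed
  have WE: "W t \<le> zt (s - 1) * sqrt (E t)" for t
  proof -
    have "W t \<le> zt (s - 1) * sqrt (\<Sum>k\<in>S. (jb k powr (s - 1) * (jb k * cmod (a t k)))\<^sup>2)"
      unfolding W_def by (rule l1_bound) (use s S in \<open>auto simp: jb_nonneg\<close>)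
    also have "(\<Sum>k\<in>S. (jb k powr (s - 1) * (jb k * cmod (a t k)))\<^sup>2) = E t"
      unfolding E_def jb_powr_Suc[symmetric, of _ s] by (simp add: mult_ac)
    finally show ?thesis .
  qed
  have E00: "E 0 \<le> R\<^sup>2" "E 0 = (\<Sum>k\<in>S. (jb k powr s * cmod (a0 k))\<^sup>2)"
    using hsbD[OF a0(2) S(1)] a0' by (simp_all add: E_def)
  have Eb: "E t \<le> (3 * R)\<^sup>2" if "t \<in> {0..T}" for t
  proof (rule riccati_bound[OF dE _ E0 gal_const_pos R E00(1) T(2) that])
    fix t assume t: "t \<in> {0..T}"
    have "E' t \<le> 2 * en_const s * W t * E t" by (rule E'b[OF t])
    also have "\<dots> \<le> 2 * en_const s * ((zt (s - 1) + 1) * sqrt (E t)) * E t"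
    proof (intro mult_right_mono mult_left_mono)
      show "W t \<le> (zt (s - 1) + 1) * sqrt (E t)"
        using WE[of t] real_sqrt_ge_zero[OF E0[of t]] unfolding distrib_right mult_1 by linarith
    qed (use E0[of t] en_const_pos[of s] s in auto)
    finally show "E' t \<le> gal_const s * E t * sqrt (E t)" by (simp add: gal_const_def mult_ac)
  qed (use s in auto)
  have hs: "hsb s (3 * R) (a t)" if t: "t \<in> {0..T}" for t
    unfolding hsb_def
  proof safe
    fix A :: "int set" assume A: "finite A"
    have "(\<Sum>k\<in>A. (jb k powr s * cmod (a t k))\<^sup>2) = (\<Sum>k\<in>A \<inter> S. (jb k powr s * cmod (a t k))\<^sup>2)"
      using A supp[OF t] by (intro sum.mono_neutral_right) auto
    also have "\<dots> \<le> E t" unfolding E_def using S by (intro sum_mono2) auto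
    finally show "(\<Sum>k\<in>A. (jb k powr s * cmod (a t k))\<^sup>2) \<le> (3 * R)\<^sup>2" using Eb[OF t] by simp
  qed
  have th1: "th t = 1" if t: "t \<in> {0..T}" for t
  proof -
    have "norm (y t) \<le> Rc"
    proof (rule norm_bound)
      fix x
      \<comment> \<open>The trajectory equals the interpolant of its own coefficients: the two have
        the same derivative and the same initial value. Bounds on coefficients thus bound the
        supremum.\<close>
      define f where "f t = apply_bcontfun (y t) x - (\<Sum>k\<in>S. of_real (hat (x - of_int k)) * a t k)" for t
      have df: "(f has_vector_derivative 0) (at t within {0..T})" if t: "t \<in> {0..T}" for t
      proof -
        have "(f has_vector_derivative (apply_bcontfun (F (y t)) x -
            (\<Sum>k\<in>S. of_real (hat (x - of_int k)) * (if k \<in> S then Fr (y t) k else 0)))) (at t within {0..T})"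
          unfolding f_def
          by (intro has_vector_derivative_diff has_vector_derivative_sum has_vector_derivative_mult_right da
              bounded_linear.has_vector_derivative[OF bounded_linear_bcontfun_at] y t)
        then show ?thesis by (simp add: F_def ext cong: sum.cong)
      qed
      have "f 0 = 0" by (simp add: f_def y0 ext a0')
      then have "f t = 0" using const[OF df t] by simp
      then have "cmod (apply_bcontfun (y t) x) = cmod (\<Sum>k\<in>S. of_real (hat (x - of_int k)) * a t k)"
        by (simp add: f_def)
      also have "\<dots> \<le> (\<Sum>k\<in>S. 3 * R)"
      proof (rule sum_norm_le)
        fix k
        have "1 * cmod (a t k) \<le> jb k powr s * cmod (a t k)" using s by (intro mult_right_mono jb_powr_ge1) auto
        also have "\<dots> \<le> 3 * R" using hsb_single[OF hs[OF t]] R by simp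
        finally have "hat (x - of_int k) * cmod (a t k) \<le> 1 * (3 * R)" using hat by (intro mult_mono) auto
        then show "cmod (of_real (hat (x - of_int k)) * a t k) \<le> 3 * R" using hat by (simp add: norm_mult)
      qed
      also have "\<dots> = Rc" by (simp add: Rc_def)
      finally show "cmod (apply_bcontfun (y t) x) \<le> Rc" .
    qed
    then show ?thesis using Rc by (simp add: th_def max_def)
  qed
  show ?thesis
  proof (rule that[of a])
    show "((\<lambda>t. a t k) has_vector_derivative qfin (freqs N) (a t) k) (at t within {0..T})"
      if "t \<in> {0..T}" "k \<in> freqs N" for t k
      using da[OF that(1), of k] Fr[OF that(1), of k] th1[OF that(1)] that(2) by (simp add: S_def)
    fix K t assume K: "K \<ge> 0" and t: "t \<in> {0..T}"
      and WK: "\<And>t. t \<in> {0..T} \<Longrightarrow> (\<Sum>k\<in>freqs N. jb k * cmod (a t k)) \<le> K"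
    have "E t \<le> (E 0 + 0 * t) * exp ((2 * en_const s * K) * t)"
    proof (rule gronwall[OF dE _ _ _ t])
      fix t assume t: "t \<in> {0..T}"
      have "E' t \<le> 2 * en_const s * W t * E t" by (rule E'b[OF t])
      also have "\<dots> \<le> 2 * en_const s * K * E t"
        using WK[OF t] E0[of t] en_const_pos[of s] s
        by (intro mult_right_mono mult_left_mono) (auto simp: W_def S_def)
      finally show "E' t \<le> 2 * en_const s * K * E t + 0" by simp
    qed (use K en_const_pos[of s] s in auto)
    then show "(\<Sum>k\<in>freqs N. (jb k powr s * cmod (a t k))\<^sup>2)
          \<le> (\<Sum>k\<in>freqs N. (jb k powr s * cmod (a0 k))\<^sup>2) * exp (2 * en_const s * K * t)"
      using E00(2) by (simp add: E_def S_def)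
  qed (use a0' supp sym hs in \<open>auto simp: S_def\<close>)
qed

subsection \<open>The quadratic nonlinearity on infinite sequences\<close>

definition qconv :: "(int \<Rightarrow> complex) \<Rightarrow> (int \<Rightarrow> complex) \<Rightarrow> int \<Rightarrow> complex" where
  "qconv a b k = infsum (\<lambda>j. - \<i> * gam k j * (a j * b (k - j))) UNIV"

lemma qterm_norm: "cmod (- \<i> * gam k j * (x * y)) \<le> 18 * ((jb j * cmod x) * (jb (k - j) * cmod y))"
proof -
  have "cmod (- \<i> * gam k j * (x * y)) = \<bar>gam k j\<bar> * (cmod x * cmod y)" by (simp add: norm_mult)
  also have "\<dots> \<le> 18 * (jb j * jb (k - j)) * (cmod x * cmod y)" by (intro mult_right_mono gam_bound) auto
  finally show ?thesis by (simp add: mult_ac)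
qed

lemma hsb_jb_single:
  assumes "hsb s R a" "R \<ge> 0" "s \<ge> 1"
  shows "jb k * cmod (a k) \<le> R"
proof -
  have "jb k powr 1 * cmod (a k) \<le> jb k powr s * cmod (a k)"
    using assms by (intro mult_right_mono jb_powr_mono) auto
  then show ?thesis using hsb_single[OF assms(1,2), of k] by (simp add: jb_nonneg)
qed

lemma hsb_jb_l1:
  assumes "hsb s R a" "R \<ge> 0" "s > 3/2" "finite F"
  shows "(\<Sum>j\<in>F. jb j * cmod (a j)) \<le> zt (s - 1) * R"
  using hsb_l1[OF assms(1,2), of 1 F] assms by (simp add: jb_nonneg)

lemma abs_summable_bounded:
  fixes f :: "'a \<Rightarrow> 'b::banach"
  assumes "\<And>F. finite F \<Longrightarrow> (\<Sum>j\<in>F. norm (f j)) \<le> C"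
  shows "f abs_summable_on A" "f summable_on A" "norm (infsum f A) \<le> C"
proof -
  show 1: "f abs_summable_on A"
    using assms by (intro nonneg_bdd_above_summable_on bdd_aboveI[of _ C]) auto
  then show "f summable_on A" by (rule abs_summable_summable)
  have "norm (infsum f A) \<le> infsum (\<lambda>x. norm (f x)) A" by (rule norm_infsum_bound[OF 1])
  also have "\<dots> \<le> C" using assms by (intro infsum_le_finite_sums 1) auto
  finally show "norm (infsum f A) \<le> C" .
qed

lemma qconv_summable:
  assumes a: "hsb s R a" "R \<ge> 0" and b: "hsb s R' b" "R' \<ge> 0" and s: "s > 3/2"
  shows "(\<lambda>j. - \<i> * gam k j * (a j * b (k - j))) summable_on UNIV"
    "cmod (qconv a b k) \<le> 18 * (zt (s - 1) * R * R')"
proof -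
  have *: "(\<Sum>j\<in>F. cmod (- \<i> * gam k j * (a j * b (k - j)))) \<le> 18 * (zt (s - 1) * R * R')" if "finite F" for F
  proof -
    have "(\<Sum>j\<in>F. cmod (- \<i> * gam k j * (a j * b (k - j)))) \<le> (\<Sum>j\<in>F. 18 * ((jb j * cmod (a j)) * R'))"
      using s by (intro sum_mono order.trans[OF qterm_norm] mult_left_mono hsb_jb_single[OF b]) (auto simp: jb_nonneg)
    also have "\<dots> = 18 * ((\<Sum>j\<in>F. jb j * cmod (a j)) * R')" by (simp add: sum_distrib_left sum_distrib_right)
    also have "\<dots> \<le> 18 * ((zt (s - 1) * R) * R')"
      using that s b by (intro mult_left_mono mult_right_mono hsb_jb_l1[OF a]) auto
    finally show ?thesis .
  qed
  show "(\<lambda>j. - \<i> * gam k j * (a j * b (k - j))) summable_on UNIV"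
    by (rule abs_summable_bounded(2)[OF *])
  show "cmod (qconv a b k) \<le> 18 * (zt (s - 1) * R * R')"
    unfolding qconv_def by (rule abs_summable_bounded(3)[OF *])
qed

lemma qconv_eq_qfin:
  assumes "finite S" "\<And>k. k \<notin> S \<Longrightarrow> a k = 0"
  shows "qconv a a k = qfin S a k"
proof -
  have "qconv a a k = infsum (\<lambda>j. - \<i> * gam k j * (a j * a (k - j))) S"
    unfolding qconv_def using assms by (intro infsum_cong_neutral) auto
  then show ?thesis using assms by (simp add: qfin_def)
qed

definition trunc :: "nat \<Rightarrow> (int \<Rightarrow> complex) \<Rightarrow> int \<Rightarrow> complex" where
  "trunc N a k = (if k \<in> freqs N then a k else 0)"

text \<open>Twice the constant 18 of \<open>gam_bound\<close> times a tail of exponent 3/4. The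
  exponent exceeds 1/2, so that the squared error summed over 2N + 1 modes tends to 0, and it is
  small enough for s - 1 - 3/4 to exceed 1/2.\<close>

definition qerr :: "real \<Rightarrow> real \<Rightarrow> nat \<Rightarrow> real" where
  "qerr s R N = 36 * (real N powr (- 3/4) * (zt (s - 7/4) * R) * R)"

text \<open>A discarded product has \<open>j\<close> or \<open>k - j\<close> beyond N; that factor
  is summed as a tail and the other one is bounded by R. The error does not depend on
  \<open>k\<close>.\<close>

lemma qconv_trunc:
  assumes a: "hsb s R a" "R \<ge> 0" and s: "s > 5/2" and N: "N \<ge> 1"
  shows "cmod (qfin (freqs N) (trunc N a) k - qconv a a k) \<le> qerr s R N"
proof -
  define f where "f j = - \<i> * gam k j * (a j * a (k - j))" for j
  define g where "g j = - \<i> * gam k j * (trunc N a j * trunc N a (k - j))" for j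
  define x where "x j = jb j * cmod (a j)" for j
  define y where "y j = (if j \<in> freqs N then 0 else x j)" for j
  have x0: "x j \<ge> 0" and y0: "y j \<ge> 0" for j by (auto simp: x_def y_def jb_nonneg)
  have xR: "x j \<le> R" for j using hsb_jb_single[OF a] s by (simp add: x_def)
  have fs: "f summable_on UNIV" unfolding f_def using qconv_summable(1)[OF a a, of k] s by simp
  have ta: "hsb s R (trunc N a)"
    unfolding hsb_def
  proof safe
    fix F :: "int set" assume "finite F"
    have "(\<Sum>k\<in>F. (jb k powr s * cmod (trunc N a k))\<^sup>2) \<le> (\<Sum>k\<in>F. (jb k powr s * cmod (a k))\<^sup>2)"
      by (intro sum_mono power_mono mult_left_mono) (auto simp: trunc_def)
    then show "(\<Sum>k\<in>F. (jb k powr s * cmod (trunc N a k))\<^sup>2) \<le> R\<^sup>2"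
      using hsbD[OF a(1) \<open>finite F\<close>] by linarith
  qed
  have gs: "g summable_on UNIV" unfolding g_def using qconv_summable(1)[OF ta a(2) ta a(2), of k] s by simp
  have tail: "(\<Sum>j\<in>F. y j) \<le> real N powr (- 3/4) * (zt (s - 7/4) * R)" if "finite F" for F
  proof -
    have "(\<Sum>j\<in>F. y j) = (\<Sum>j\<in>F - freqs N. x j)"
      unfolding y_def using that by (simp add: sum.If_cases Diff_eq Compl_eq)
    also have "\<dots> = (\<Sum>j\<in>F - freqs N. jb j powr 1 * cmod (a j))" by (simp add: x_def jb_nonneg)
    also have "\<dots> \<le> real N powr (- (3/4)) * (zt (s - 1 - 3/4) * R)"
      using s N that not_in_freqs by (intro hsb_tail[OF a]) auto
    finally show ?thesis by simp
  qed
  have tm: "norm (g j - f j) \<le> 18 * (y j * R + R * y (k - j))" for j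
  proof (cases "j \<in> freqs N \<and> k - j \<in> freqs N")
    case True
    then show ?thesis using y0 a(2) by (simp add: g_def f_def trunc_def)
  next
    case False
    then have "g j = 0" by (auto simp: g_def trunc_def)
    then have "norm (g j - f j) \<le> 18 * (x j * x (k - j))"
      using qterm_norm[of k j "a j" "a (k - j)"] by (simp add: f_def x_def)
    also have "x j * x (k - j) \<le> y j * R + R * y (k - j)"
    proof (cases "j \<in> freqs N")
      case False
      then have "x j * x (k - j) \<le> y j * R" using x0 xR by (simp add: y_def mult_left_mono)
      then show ?thesis using y0[of "k - j"] a(2) by (simp add: add_increasing2)
    next
      case True
      then have "k - j \<notin> freqs N" using False by auto
      then have "x j * x (k - j) \<le> R * y (k - j)" using x0 xR by (simp add: y_def mult_right_mono)
      then show ?thesis using y0[of j] a(2) by (simp add: add_increasing)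
    qed
    finally show ?thesis by simp
  qed
  have bound: "(\<Sum>j\<in>F. norm (g j - f j)) \<le> qerr s R N" if F: "finite F" for F
  proof -
    have "(\<Sum>j\<in>F. norm (g j - f j)) \<le> (\<Sum>j\<in>F. 18 * (y j * R + R * y (k - j)))" by (intro sum_mono tm)
    also have "\<dots> = 18 * ((\<Sum>j\<in>F. y j) * R + R * (\<Sum>j\<in>F. y (k - j)))"
      by (simp add: sum_distrib_left sum_distrib_right sum.distrib)
    also have "(\<Sum>j\<in>F. y (k - j)) = (\<Sum>j\<in>(\<lambda>j. k - j) ` F. y j)"
      by (subst sum.reindex) (auto simp: inj_on_def)
    also have "18 * ((\<Sum>j\<in>F. y j) * R + R * (\<Sum>j\<in>(\<lambda>j. k - j) ` F. y j))
       \<le> 18 * ((real N powr (- 3/4) * (zt (s - 7/4) * R)) * R + R * (real N powr (- 3/4) * (zt (s - 7/4) * R)))"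
      using F a(2) by (intro mult_left_mono add_mono mult_right_mono tail) auto
    also have "\<dots> = qerr s R N" by (simp add: qerr_def algebra_simps)
    finally show ?thesis .
  qed
  have "qfin (freqs N) (trunc N a) k = infsum g UNIV"
    unfolding g_def using qconv_eq_qfin[of "freqs N" "trunc N a" k] by (simp add: qconv_def trunc_def)
  moreover have fq: "qconv a a k = infsum f UNIV" unfolding qconv_def f_def ..
  ultimately have "qfin (freqs N) (trunc N a) k - qconv a a k = infsum (\<lambda>j. g j - f j) UNIV"
    using infsum_add[OF gs, of "\<lambda>j. - f j"] fs fq
    by (simp add: infsum_uminus summable_on_uminus)
  then show ?thesis using abs_summable_bounded(3)[OF bound, of UNIV] by simp
qed

section \<open>Stability of the coefficient system under truncation\<close>

lemma hsb_trunc: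
  assumes "hsb s R a" shows "hsb s R (trunc N a)"
  unfolding hsb_def
proof safe
  fix F :: "int set" assume "finite F"
  have "(\<Sum>k\<in>F. (jb k powr s * cmod (trunc N a k))\<^sup>2) \<le> (\<Sum>k\<in>F. (jb k powr s * cmod (a k))\<^sup>2)"
    by (intro sum_mono power_mono mult_left_mono) (auto simp: trunc_def)
  then show "(\<Sum>k\<in>F. (jb k powr s * cmod (trunc N a k))\<^sup>2) \<le> R\<^sup>2"
    using hsbD[OF assms \<open>finite F\<close>] by linarith
qed

lemma symm_trunc: "symm a \<Longrightarrow> symm (trunc N a)"
  by (simp add: symm_def trunc_def freqs_minus)

text \<open>Difference of two squares; the mixed terms cancel by the symmetry
  \<open>gam_flip\<close>.\<close>

lemma qfin_diff:
  fixes a b :: "int \<Rightarrow> complex"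
  assumes S: "finite S" and a: "\<And>k. k \<notin> S \<Longrightarrow> a k = 0" and b: "\<And>k. k \<notin> S \<Longrightarrow> b k = 0"
  shows "qfin S a k - qfin S b k = (\<Sum>j\<in>S. - \<i> * gam k j * ((a j - b j) * (a (k - j) + b (k - j))))"
proof -
  have "(\<Sum>j\<in>S. - \<i> * gam k j * (a j * b (k - j))) = (\<Sum>j\<in>S. - \<i> * gam k (k - j) * (a (k - j) * b (k - (k - j))))"
    by (rule sum_reflect[OF S]) (use a b in auto)
  then have "(\<Sum>j\<in>S. - \<i> * gam k j * (a j * b (k - j))) = (\<Sum>j\<in>S. - \<i> * gam k j * (b j * a (k - j)))"
    by (simp add: gam_flip mult_ac)
  moreover have "(\<Sum>j\<in>S. - \<i> * gam k j * ((a j - b j) * (a (k - j) + b (k - j))))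
     = (qfin S a k + (\<Sum>j\<in>S. - \<i> * gam k j * (a j * b (k - j))))
      - ((\<Sum>j\<in>S. - \<i> * gam k j * (b j * a (k - j))) + qfin S b k)"
    unfolding qfin_def sum.distrib[symmetric] sum_subtractf[symmetric]
    by (intro sum.cong refl) (simp only: algebra_simps)
  ultimately show ?thesis by simp
qed

text \<open>The Gronwall bound of \<open>compare\<close>: 2N + 1 modes with squared error (2
  \<open>qerr\<close>)^2 each. In the rate, 12 is the product of 2 from differentiating a square, 3
  from \<open>l2_difference_bound\<close> and 2 for the two summands of \<open>g\<close>; the 1 is
  Young's inequality for the error term.\<close>

definition cerr :: "real \<Rightarrow> real \<Rightarrow> real \<Rightarrow> nat \<Rightarrow> real" where
  "cerr s R T N = (4 * (2 * real N + 1) * (qerr s R N)\<^sup>2) * T * exp ((12 * zt (s - 2) * R + 1) * T)"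

lemma cerr_tendsto: "(\<lambda>N. cerr s R T N) \<longlonglongrightarrow> 0"
proof -
  define C where "C = 4 * (36 * ((zt (s - 7/4) * R) * R))\<^sup>2 * T * exp ((12 * zt (s - 2) * R + 1) * T)"
  have "(\<lambda>N. C * ((2 * real N + 1) * (real N powr (- 3/4))\<^sup>2)) \<longlonglongrightarrow> C * 0"
  proof (intro tendsto_mult tendsto_const)
    have "(\<lambda>N. 2 * real N powr (- (1/2)) + real N powr (- (3/2))) \<longlonglongrightarrow> 2 * 0 + 0"
      by (intro tendsto_intros tendsto_neg_powr filterlim_real_sequentially) auto
    moreover have "eventually (\<lambda>N. 2 * real N powr (- (1/2)) + real N powr (- (3/2)) = (2 * real N + 1) * (real N powr (- 3/4))\<^sup>2) sequentially"
      using eventually_ge_at_top[of 1]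
    proof eventually_elim
      case (elim N)
      have "(real N powr (- 3/4))\<^sup>2 = real N powr (- (3/2))" by (simp add: power2_eq_square flip: powr_add)
      moreover have "real N * real N powr (- (3/2)) = real N powr (- (1/2))"
        using elim powr_add[of "real N" 1 "- (3/2)"] by simp
      ultimately show ?case by (simp add: algebra_simps)
    qed
    ultimately show "(\<lambda>N. (2 * real N + 1) * (real N powr (- 3/4))\<^sup>2) \<longlonglongrightarrow> 0"
      using Lim_transform_eventually by fastforce
  qed
  moreover have "C * ((2 * real N + 1) * (real N powr (- 3/4))\<^sup>2) = cerr s R T N" for N
    by (simp add: C_def cerr_def qerr_def power_mult_distrib)
  ultimately show ?thesis by simp
qed

text \<open>The equation is asked for on the modes up to N only, but with the full nonlinearity. In
  this form one lemma compares two Galerkin solutions, a Galerkin solution with a solution, and two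
  solutions; a Galerkin solution qualifies because its finite support makes its truncated quadratic
  term complete.\<close>

lemma compare:
  assumes s: "s > 5/2" and R: "R \<ge> 0" and N: "N \<ge> 1"
    and a: "\<And>t. t \<in> {0..T} \<Longrightarrow> symm (a t)" "\<And>t. t \<in> {0..T} \<Longrightarrow> hsb s R (a t)"
      "\<And>t k. t \<in> {0..T} \<Longrightarrow> k \<in> freqs N \<Longrightarrow> ((\<lambda>t. a t k) has_vector_derivative qconv (a t) (a t) k) (at t within {0..T})"
    and b: "\<And>t. t \<in> {0..T} \<Longrightarrow> symm (b t)" "\<And>t. t \<in> {0..T} \<Longrightarrow> hsb s R (b t)"
      "\<And>t k. t \<in> {0..T} \<Longrightarrow> k \<in> freqs N \<Longrightarrow> ((\<lambda>t. b t k) has_vector_derivative qconv (b t) (b t) k) (at t within {0..T})"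
    and ab: "\<And>k. k \<in> freqs N \<Longrightarrow> a 0 k = b 0 k" and t: "t \<in> {0..T}"
  shows "(\<Sum>k\<in>freqs N. (cmod (a t k - b t k))\<^sup>2) \<le> cerr s R T N"
proof -
  define S where "S = freqs N"
  have S: "finite S" by (simp add: S_def)
  define q where "q = qerr s R N"
  define D where "D t = (\<Sum>k\<in>S. (cmod (a t k - b t k))\<^sup>2)" for t
  define D' where "D' t = (\<Sum>k\<in>S. 2 * Re (cnj (a t k - b t k) * (qconv (a t) (a t) k - qconv (b t) (b t) k)))" for t
  have dD: "(D has_real_derivative D' t) (at t within {0..T})" if t: "t \<in> {0..T}" for t
    unfolding D_def D'_def
    by (intro DERIV_sum cmod_sq_deriv has_vector_derivative_diff a(3) b(3) t) (auto simp: S_def)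
  define K where "K = 12 * zt (s - 2) * R + 1"
  have D'le: "D' t \<le> K * D t + 4 * (2 * real N + 1) * q\<^sup>2" if t: "t \<in> {0..T}" for t
  proof -
    \<comment> \<open>The bilinear estimate needs a finitely supported factor, so the truncations
      are compared; \<open>e\<close> collects what truncation changes in the two nonlinearities, at
      most 2 q on each mode.\<close>
    define d where "d k = trunc N (a t) k - trunc N (b t) k" for k
    define g where "g k = trunc N (a t) k + trunc N (b t) k" for k
    define B where "B k = (\<Sum>j\<in>S. - \<i> * gam k j * (d j * g (k - j)))" for k
    define e where "e k = qconv (a t) (a t) k - qconv (b t) (b t) k - B k" for k
    have g0: "g k = 0" if "k \<notin> S" for k using that by (simp add: g_def trunc_def S_def)
    have gs: "symm g" using symm_trunc[OF a(1)[OF t], of N] symm_trunc[OF b(1)[OF t], of N]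
      by (simp add: symm_def g_def)
    have Beq: "B k = qfin S (trunc N (a t)) k - qfin S (trunc N (b t)) k" for k
      unfolding B_def d_def g_def by (rule qfin_diff[symmetric]) (auto simp: S_def trunc_def)
    have e: "cmod (e k) \<le> 2 * q" for k
    proof -
      have "cmod (e k) = cmod ((qfin S (trunc N (b t)) k - qconv (b t) (b t) k) - (qfin S (trunc N (a t)) k - qconv (a t) (a t) k))"
        by (simp add: e_def Beq algebra_simps)
      also have "\<dots> \<le> q + q"
        unfolding q_def S_def
        by (rule order.trans[OF norm_triangle_ineq4], rule add_mono)
           (rule qconv_trunc[OF b(2)[OF t] R s N], rule qconv_trunc[OF a(2)[OF t] R s N])
      finally show ?thesis by simp
    qed
    have dD: "D t = (\<Sum>k\<in>S. (cmod (d k))\<^sup>2)" unfolding D_def d_def by (intro sum.cong) (auto simp: trunc_def S_def)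
    have W: "(\<Sum>k\<in>S. (jb k)\<^sup>2 * cmod (g k)) \<le> 2 * (zt (s - 2) * R)"
    proof -
      have h: "(\<Sum>k\<in>S. (jb k)\<^sup>2 * cmod (trunc N c k)) \<le> zt (s - 2) * R" if "hsb s R c" for c
        using hsb_l1[OF hsb_trunc[OF that, of N] R, of 2 S] s S by (simp add: powr_numeral jb_pos jb_nonneg)
      have "(\<Sum>k\<in>S. (jb k)\<^sup>2 * cmod (g k)) \<le> (\<Sum>k\<in>S. (jb k)\<^sup>2 * cmod (trunc N (a t) k) + (jb k)\<^sup>2 * cmod (trunc N (b t) k))"
        unfolding distrib_left[symmetric] g_def by (intro sum_mono mult_left_mono norm_triangle_ineq) auto
      also have "\<dots> \<le> zt (s - 2) * R + zt (s - 2) * R"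
        unfolding sum.distrib by (intro add_mono h a(2) b(2) t)
      finally show ?thesis by (simp add: mult.commute)
    qed
    have "D' t = (\<Sum>k\<in>S. 2 * Re (cnj (d k) * B k) + 2 * Re (cnj (d k) * e k))"
      unfolding D'_def by (intro sum.cong) (auto simp: e_def d_def trunc_def S_def algebra_simps)
    also have "\<dots> = 2 * (\<Sum>k\<in>S. Re (cnj (d k) * B k)) + (\<Sum>k\<in>S. 2 * Re (cnj (d k) * e k))"
      by (simp add: sum.distrib sum_distrib_left)
    also have "(\<Sum>k\<in>S. Re (cnj (d k) * B k)) \<le> 3 * (2 * (zt (s - 2) * R)) * D t"
    proof -
      have "(\<Sum>k\<in>S. Re (cnj (d k) * B k)) \<le> 3 * (\<Sum>k\<in>S. (jb k)\<^sup>2 * cmod (g k)) * (\<Sum>k\<in>S. (cmod (d k))\<^sup>2)"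
        using l2_difference_bound[OF S gs g0, of d] unfolding B_def by linarith
      also have "\<dots> \<le> 3 * (2 * (zt (s - 2) * R)) * D t"
        unfolding dD by (intro mult_right_mono mult_left_mono W) (auto intro: sum_nonneg)
      finally show ?thesis .
    qed
    also have "(\<Sum>k\<in>S. 2 * Re (cnj (d k) * e k)) \<le> (\<Sum>k\<in>S. (cmod (d k))\<^sup>2 + (2 * q)\<^sup>2)"
    proof (intro sum_mono)
      fix k
      have "Re (cnj (d k) * e k) \<le> cmod (cnj (d k) * e k)" by (rule complex_Re_le_cmod)
      also have "\<dots> \<le> cmod (d k) * (2 * q)" using e[of k] by (simp add: norm_mult mult_left_mono)
      finally show "2 * Re (cnj (d k) * e k) \<le> (cmod (d k))\<^sup>2 + (2 * q)\<^sup>2"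
        using sum_squares_bound[of "cmod (d k)" "2 * q"] by simp
    qed
    also have "\<dots> = D t + real (card S) * (4 * q\<^sup>2)" by (simp add: sum.distrib dD)
    finally show ?thesis by (simp add: K_def S_def card_freqs algebra_simps)
  qed
  have "D t \<le> (D 0 + 4 * (2 * real N + 1) * q\<^sup>2 * t) * exp (K * t)"
    by (rule gronwall[OF dD D'le _ _ t]) (auto simp: K_def R zt_nonneg)
  also have "D 0 = 0" using ab by (simp add: D_def S_def)
  also have "(0 + 4 * (2 * real N + 1) * q\<^sup>2 * t) * exp (K * t) \<le> (4 * (2 * real N + 1) * q\<^sup>2 * T) * exp (K * T)"
  proof -
    have "K \<ge> 0" using R zt_nonneg[of "s - 2"] by (simp add: K_def)
    then have "K * t \<le> K * T" using t by (intro mult_left_mono) auto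
    then show ?thesis using t by (simp only: add_0) (intro mult_mono mult_left_mono, auto)
  qed
  finally show ?thesis by (simp add: cerr_def D_def S_def q_def K_def)
qed

text \<open>The time derivative is taken coefficient by coefficient; the uniform radius R makes up
  for the weakness of this notion, as tails are uniform on Sobolev balls.\<close>

definition sol :: "real \<Rightarrow> real \<Rightarrow> real \<Rightarrow> (real \<Rightarrow> int \<Rightarrow> complex) \<Rightarrow> bool" where
  "sol s T R a \<longleftrightarrow> (\<forall>t\<in>{0..T}. symm (a t) \<and> hsb s R (a t) \<and>
     (\<forall>k. ((\<lambda>t. a t k) has_vector_derivative qconv (a t) (a t) k) (at t within {0..T})))"

lemma solD:
  assumes "sol s T R a" "t \<in> {0..T}"
  shows "symm (a t)" "hsb s R (a t)" "((\<lambda>t. a t k) has_vector_derivative qconv (a t) (a t) k) (at t within {0..T})"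
  using assms by (auto simp: sol_def)

lemma tendsto_le_zero:
  fixes x :: real
  assumes "\<And>n. n \<ge> N0 \<Longrightarrow> x \<le> f n" "f \<longlonglongrightarrow> 0"
  shows "x \<le> 0"
  using assms by (intro LIMSEQ_le_const[of f]) auto

lemma sol_unique:
  assumes s: "s > 5/2" and R: "R \<ge> 0" and a: "sol s T R a" and b: "sol s T R b"
    and ab: "a 0 = b 0" and t: "t \<in> {0..T}"
  shows "a t = b t"
proof
  fix k
  have "(cmod (a t k - b t k))\<^sup>2 \<le> 0"
  proof (rule tendsto_le_zero[OF _ cerr_tendsto[of s R T]])
    fix N assume N: "max 1 (nat \<bar>k\<bar>) \<le> N"
    have k: "k \<in> freqs N" using N by (auto simp: freqs_def)
    have "(cmod (a t k - b t k))\<^sup>2 \<le> (\<Sum>k\<in>freqs N. (cmod (a t k - b t k))\<^sup>2)"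
      using k by (intro member_le_sum) auto
    also have "\<dots> \<le> cerr s R T N"
      using compare[OF s R _ _ _ _ _ _ _ _ t, of N a b] solD[OF a] solD[OF b] ab N by auto
    finally show "(cmod (a t k - b t k))\<^sup>2 \<le> cerr s R T N" .
  qed
  then show "a t k = b t k" by simp
qed

text \<open>On a Sobolev ball a coefficient of the nonlinearity depends continuously on finitely
  many coefficients, up to a uniformly small tail. This allows coefficientwise limits to be taken in
  the equation.\<close>

lemma qconv_uniform:
  assumes s: "s > 5/2" and R: "R \<ge> 0" and e: "e > 0"
  obtains M \<delta> where "\<delta> > 0" "\<And>a b. \<lbrakk>hsb s R a; hsb s R b; \<And>j. j \<in> freqs M \<Longrightarrow> cmod (a j - b j) \<le> \<delta>\<rbrakk> \<Longrightarrow>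
      cmod (qconv a a k - qconv b b k) \<le> e"
proof -
  have "(\<lambda>N. 36 * (real N powr (- (3/4)) * (zt (s - 7/4) * R) * R)) \<longlonglongrightarrow> 36 * (0 * (zt (s - 7/4) * R) * R)"
    by (intro tendsto_intros tendsto_neg_powr filterlim_real_sequentially) auto
  then have "(\<lambda>N. qerr s R N) \<longlonglongrightarrow> 0" by (simp add: qerr_def)
  then have "eventually (\<lambda>N. qerr s R N < e / 3) sequentially" using e by (intro order_tendstoD) auto
  then have "eventually (\<lambda>N. qerr s R N < e / 3 \<and> N \<ge> 1) sequentially"
    using eventually_ge_at_top[of 1] by eventually_elim auto
  then obtain M where M: "qerr s R M < e / 3" "M \<ge> 1" by (auto simp: eventually_sequentially)
  define G where "G = (\<Sum>j\<in>freqs M. \<bar>gam k j\<bar>)"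
  have G: "G \<ge> 0" by (simp add: G_def sum_nonneg)
  define d where "d = e / 3 / (G * (2 * R) + 1)"
  have GR: "G * (2 * R) \<ge> 0" using G R by simp
  then have d: "d > 0" using e by (simp add: d_def add_nonneg_pos)
  have dG: "G * (d * (2 * R)) \<le> e / 3"
  proof -
    have "G * (d * (2 * R)) = (G * (2 * R)) / (G * (2 * R) + 1) * (e / 3)" by (simp add: d_def)
    also have "\<dots> \<le> 1 * (e / 3)" using GR e by (intro mult_right_mono) (auto simp: divide_le_eq_1)
    finally show ?thesis by simp
  qed
  show ?thesis
  proof (rule that[OF d])
    fix a b assume a: "hsb s R a" and b: "hsb s R b" and ab: "\<And>j. j \<in> freqs M \<Longrightarrow> cmod (a j - b j) \<le> d"
    have n: "cmod (trunc M c j) \<le> R" if "hsb s R c" for c j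
    proof -
      have "1 * cmod (c j) \<le> jb j * cmod (c j)" by (intro mult_right_mono jb_ge1) auto
      also have "\<dots> \<le> R" using hsb_jb_single[OF that R] s by simp
      finally show ?thesis using R by (simp add: trunc_def)
    qed
    have "qfin (freqs M) (trunc M a) k - qfin (freqs M) (trunc M b) k
      = (\<Sum>j\<in>freqs M. - \<i> * gam k j * ((trunc M a j - trunc M b j) * (trunc M a (k - j) + trunc M b (k - j))))"
      by (rule qfin_diff) (auto simp: trunc_def)
    also have "cmod \<dots> \<le> (\<Sum>j\<in>freqs M. \<bar>gam k j\<bar> * (d * (2 * R)))"
    proof (rule sum_norm_le)
      fix j assume j: "j \<in> freqs M"
      have "cmod ((trunc M a j - trunc M b j) * (trunc M a (k - j) + trunc M b (k - j))) \<le> d * (R + R)"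
        unfolding norm_mult using ab[OF j] j d
        by (intro mult_mono order.trans[OF norm_triangle_ineq] add_mono n a b) (auto simp: trunc_def)
      then show "cmod (- \<i> * gam k j * ((trunc M a j - trunc M b j) * (trunc M a (k - j) + trunc M b (k - j)))) \<le> \<bar>gam k j\<bar> * (d * (2 * R))"
        by (simp add: norm_mult mult_left_mono)
    qed
    also have "\<dots> = G * (d * (2 * R))" by (simp add: G_def sum_distrib_right)
    also have "\<dots> \<le> e / 3" by (rule dG)
    finally have 1: "cmod (qfin (freqs M) (trunc M a) k - qfin (freqs M) (trunc M b) k) \<le> e / 3" .
    have 2: "cmod (qfin (freqs M) (trunc M a) k - qconv a a k) \<le> e / 3"
      using qconv_trunc[OF a R s M(2), of k] M(1) by linarith
    have 3: "cmod (qfin (freqs M) (trunc M b) k - qconv b b k) \<le> e / 3"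
      using qconv_trunc[OF b R s M(2), of k] M(1) by linarith
    have "qconv a a k - qconv b b k = (qfin (freqs M) (trunc M a) k - qfin (freqs M) (trunc M b) k)
       - (qfin (freqs M) (trunc M a) k - qconv a a k) + (qfin (freqs M) (trunc M b) k - qconv b b k)" by simp
    then have "cmod (qconv a a k - qconv b b k) \<le> e / 3 + e / 3 + e / 3"
      using 1 2 3 by (smt (verit) norm_triangle_ineq norm_triangle_ineq4)
    then show "cmod (qconv a a k - qconv b b k) \<le> e" by simp
  qed
qed

subsection \<open>Local existence and continuation\<close>

text \<open>Termwise differentiation from an index m on: the Galerkin system of order n contains the
  equation of mode k only once n >= |k|.\<close>

lemma has_vector_derivative_limit:
  fixes f :: "nat \<Rightarrow> real \<Rightarrow> 'b::banach"
  assumes S: "convex S"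
    and d: "\<And>n t. n \<ge> m \<Longrightarrow> t \<in> S \<Longrightarrow> (f n has_vector_derivative f' n t) (at t within S)"
    and u: "\<And>e. e > 0 \<Longrightarrow> \<exists>N. \<forall>n\<ge>N. \<forall>t\<in>S. norm (f' n t - g' t) \<le> e"
    and lim: "\<And>t. t \<in> S \<Longrightarrow> (\<lambda>n. f n t) \<longlonglongrightarrow> g t"
    and t: "t \<in> S"
  shows "(g has_vector_derivative g' t) (at t within S)"
proof -
  have "\<exists>h. \<forall>x\<in>S. (\<lambda>n. f (n + m) x) \<longlonglongrightarrow> h x \<and> (h has_derivative (\<lambda>y. y *\<^sub>R g' x)) (at x within S)"
  proof (rule has_derivative_sequence[OF S _ _ t])
    show "(f (n + m) has_derivative (\<lambda>y. y *\<^sub>R f' (n + m) x)) (at x within S)" if "x \<in> S" for n x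
      using d[of "n + m" x] that by (simp add: has_vector_derivative_def)
    show "(\<lambda>n. f (n + m) t) \<longlonglongrightarrow> g t" by (rule LIMSEQ_ignore_initial_segment[OF lim[OF t]])
    fix e :: real assume "e > 0"
    then obtain N where N: "\<forall>n\<ge>N. \<forall>t\<in>S. norm (f' n t - g' t) \<le> e" using u by blast
    show "\<forall>\<^sub>F n in sequentially. \<forall>x\<in>S. \<forall>h. norm (h *\<^sub>R f' (n + m) x - h *\<^sub>R g' x) \<le> e * norm h"
      unfolding eventually_sequentially
    proof (intro exI[of _ N] allI impI ballI)
      fix n x h assume n: "N \<le> n" and x: "x \<in> S"
      have "norm (h *\<^sub>R f' (n + m) x - h *\<^sub>R g' x) = norm h * norm (f' (n + m) x - g' x)"
        by (simp flip: scaleR_diff_right)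
      also have "\<dots> \<le> norm h * e" using N n x by (intro mult_left_mono) auto
      finally show "norm (h *\<^sub>R f' (n + m) x - h *\<^sub>R g' x) \<le> e * norm h" by (simp add: mult.commute)
    qed
  qed
  then obtain h where h: "\<And>x. x \<in> S \<Longrightarrow> (\<lambda>n. f (n + m) x) \<longlonglongrightarrow> h x"
    "\<And>x. x \<in> S \<Longrightarrow> (h has_derivative (\<lambda>y. y *\<^sub>R g' x)) (at x within S)" by blast
  have "h x = g x" if "x \<in> S" for x
    using h(1)[OF that] LIMSEQ_ignore_initial_segment[OF lim[OF that], of m] LIMSEQ_unique by blast
  then have "(g has_derivative (\<lambda>y. y *\<^sub>R g' t)) (at t within S)"
    using has_derivative_transform[OF t, of g h] h(2)[OF t] by auto
  then show ?thesis by (simp add: has_vector_derivative_def)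
qed

lemma freqs_mono: "N \<le> M \<Longrightarrow> k \<in> freqs N \<Longrightarrow> k \<in> freqs M"
  by (auto simp: freqs_def)

lemma galerkin_qconv:
  assumes "\<And>k. k \<notin> freqs N \<Longrightarrow> a k = 0"
  shows "qfin (freqs N) a k = qconv a a k"
  using qconv_eq_qfin[of "freqs N" a k] assms by simp

text \<open>A Fatou argument on finite partial sums.\<close>

lemma hsb_limit:
  assumes lim: "\<And>k. (\<lambda>n. f n k) \<longlonglongrightarrow> g k" and f: "\<And>n. n \<ge> N0 \<Longrightarrow> hsb s R (f n)"
  shows "hsb s R g"
  unfolding hsb_def
proof safe
  fix S :: "int set" assume S: "finite S"
  have "(\<lambda>n. \<Sum>k\<in>S. (jb k powr s * cmod (f n k))\<^sup>2) \<longlonglongrightarrow> (\<Sum>k\<in>S. (jb k powr s * cmod (g k))\<^sup>2)"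
    by (intro tendsto_intros lim)
  then show "(\<Sum>k\<in>S. (jb k powr s * cmod (g k))\<^sup>2) \<le> R\<^sup>2"
    by (rule LIMSEQ_le_const2) (use f hsbD[OF _ S] in blast)
qed

text \<open>Truncations of orders N <= M differ on their common modes by at most the root of
  \<open>cerr\<close>, uniformly in time, so every coefficient forms a Cauchy sequence. The radius 3
  R is the one of \<open>riccati_bound\<close> and is the same for all truncations.\<close>

lemma local_existence:
  assumes s: "s > 5/2" and R: "R > 0" and a0: "symm a0" "hsb s R a0"
    and T: "T \<ge> 0" "gal_const s * R * T \<le> 1/2"
  obtains a where "sol s T (3 * R) a" "a 0 = a0"
proof -
  have s': "s > 3/2" using s by simp
  have "\<exists>a. (\<forall>k. a 0 k = (if k \<in> freqs N then a0 k else 0)) \<and> 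
    (\<forall>t\<in>{0..T}. symm (a t) \<and> hsb s (3 * R) (a t) \<and> (\<forall>k\<in>freqs N. ((\<lambda>t. a t k) has_vector_derivative qconv (a t) (a t) k) (at t within {0..T})))" for N
  proof -
    obtain a where a: "\<And>k. a 0 k = (if k \<in> freqs N then a0 k else 0)"
      "\<And>t k. t \<in> {0..T} \<Longrightarrow> k \<notin> freqs N \<Longrightarrow> a t k = 0"
      "\<And>t. t \<in> {0..T} \<Longrightarrow> symm (a t)"
      "\<And>t. t \<in> {0..T} \<Longrightarrow> hsb s (3 * R) (a t)"
      "\<And>t k. t \<in> {0..T} \<Longrightarrow> k \<in> freqs N \<Longrightarrow>
        ((\<lambda>t. a t k) has_vector_derivative qfin (freqs N) (a t) k) (at t within {0..T})"
      "\<And>K t. \<lbrakk>K \<ge> 0; t \<in> {0..T}; \<And>t. t \<in> {0..T} \<Longrightarrow> (\<Sum>k\<in>freqs N. jb k * cmod (a t k)) \<le> K\<rbrakk> \<Longrightarrow>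
        (\<Sum>k\<in>freqs N. (jb k powr s * cmod (a t k))\<^sup>2)
          \<le> (\<Sum>k\<in>freqs N. (jb k powr s * cmod (a0 k))\<^sup>2) * exp (2 * en_const s * K * t)"
      using galerkin[OF s' R a0 T, of N] by blast
    then show ?thesis using galerkin_qconv[OF a(2)] by (intro exI[of _ a]) auto
  qed
  then obtain A where A0: "\<And>N k. A N 0 k = (if k \<in> freqs N then a0 k else 0)"
    and A: "\<And>N t. t \<in> {0..T} \<Longrightarrow> symm (A N t)" "\<And>N t. t \<in> {0..T} \<Longrightarrow> hsb s (3 * R) (A N t)"
     "\<And>N t k. t \<in> {0..T} \<Longrightarrow> k \<in> freqs N \<Longrightarrow> ((\<lambda>t. A N t k) has_vector_derivative qconv (A N t) (A N t) k) (at t within {0..T})"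
    by metis
  define c where "c N = sqrt (cerr s (3 * R) T N)" for N
  have c: "c \<longlonglongrightarrow> 0" unfolding c_def using tendsto_real_sqrt[OF cerr_tendsto[of s "3 * R" T]] by simp
  have cau: "cmod (A N t k - A M t k) \<le> c N" if "N \<ge> 1" "M \<ge> N" "t \<in> {0..T}" "k \<in> freqs N" for N M t k
  proof -
    have "(cmod (A N t k - A M t k))\<^sup>2 \<le> (\<Sum>k\<in>freqs N. (cmod (A N t k - A M t k))\<^sup>2)"
      using that by (intro member_le_sum) auto
    also have "\<dots> \<le> cerr s (3 * R) T N"
      by (rule compare[OF s]) (use R A A0 that freqs_mono in auto)
    finally show ?thesis unfolding c_def by (rule real_le_rsqrt)
  qed
  have ink: "k \<in> freqs N" if "N \<ge> nat \<bar>k\<bar>" for k N using that by (auto simp: freqs_def)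
  have "\<exists>l. (\<lambda>N. A N t k) \<longlonglongrightarrow> l" if t: "t \<in> {0..T}" for t k
  proof -
    have "Cauchy (\<lambda>N. A N t k)"
      unfolding Cauchy_altdef2
    proof (intro allI impI)
      fix e :: real assume "e > 0"
      then have "eventually (\<lambda>N. c N < e) sequentially" using c by (intro order_tendstoD) auto
      then have "eventually (\<lambda>N. c N < e \<and> N \<ge> max 1 (nat \<bar>k\<bar>)) sequentially"
        using eventually_ge_at_top[of "max 1 (nat \<bar>k\<bar>)"] by eventually_elim auto
      then obtain N where N: "c N < e" "N \<ge> max 1 (nat \<bar>k\<bar>)" by (auto simp: eventually_sequentially)
      have "dist (A n t k) (A N t k) < e" if "n \<ge> N" for n
        using cau[of N n t k] N that t ink[of k N] by (simp add: dist_norm norm_minus_commute)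
      then show "\<exists>N. \<forall>n\<ge>N. dist (A n t k) (A N t k) < e" by blast
    qed
    then show ?thesis using Cauchy_convergent_iff convergent_def by blast
  qed
  then obtain a where a: "\<And>t k. t \<in> {0..T} \<Longrightarrow> (\<lambda>N. A N t k) \<longlonglongrightarrow> a t k" by metis
  have rate: "cmod (A N t k - a t k) \<le> c N" if "N \<ge> 1" "t \<in> {0..T}" "k \<in> freqs N" for N t k
  proof (rule LIMSEQ_le_const2)
    show "(\<lambda>M. cmod (A N t k - A M t k)) \<longlonglongrightarrow> cmod (A N t k - a t k)"
      by (intro tendsto_intros a that)
    show "\<exists>N'. \<forall>M\<ge>N'. cmod (A N t k - A M t k) \<le> c N" using cau that by blast
  qed
  have ah: "hsb s (3 * R) (a t)" if t: "t \<in> {0..T}" for t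
    by (rule hsb_limit[OF a[OF t], of 0]) (use A(2)[OF t] in auto)
  have as: "symm (a t)" if t: "t \<in> {0..T}" for t
    unfolding symm_def
  proof
    fix k
    have "(\<lambda>N. A N t (- k)) = (\<lambda>N. cnj (A N t k))" using symmD[OF A(1)[OF t]] by auto
    then show "a t (- k) = cnj (a t k)"
      using LIMSEQ_unique[OF a[OF t, of "- k"]] tendsto_cnj[OF a[OF t, of k]] by simp
  qed
  have ad: "((\<lambda>t. a t k) has_vector_derivative qconv (a t) (a t) k) (at t within {0..T})" if t: "t \<in> {0..T}" for t k
  proof (rule has_vector_derivative_limit[where f = "\<lambda>N t. A N t k" and f' = "\<lambda>N t. qconv (A N t) (A N t) k" and m = "nat \<bar>k\<bar>"])
    fix e :: real assume e: "e > 0"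
    obtain M d where d: "d > 0" and M: "\<And>a b. \<lbrakk>hsb s (3 * R) a; hsb s (3 * R) b; \<And>j. j \<in> freqs M \<Longrightarrow> cmod (a j - b j) \<le> d\<rbrakk> \<Longrightarrow>
      cmod (qconv a a k - qconv b b k) \<le> e"
      using qconv_uniform[OF s _ e, of "3 * R" k] R by (metis less_imp_le mult_pos_pos zero_less_numeral)
    have "eventually (\<lambda>N. c N < d) sequentially" using c d by (intro order_tendstoD) auto
    then have "eventually (\<lambda>N. c N < d \<and> N \<ge> max 1 M) sequentially"
      using eventually_ge_at_top[of "max 1 M"] by eventually_elim auto
    then obtain N where N: "\<And>n. n \<ge> N \<Longrightarrow> c n < d \<and> n \<ge> max 1 M" by (auto simp: eventually_sequentially)
    show "\<exists>N. \<forall>n\<ge>N. \<forall>t\<in>{0..T}. norm (qconv (A n t) (A n t) k - qconv (a t) (a t) k) \<le> e"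
    proof (intro exI[of _ N] allI impI ballI)
      fix n t assume n: "n \<ge> N" and t: "t \<in> {0..T}"
      show "norm (qconv (A n t) (A n t) k - qconv (a t) (a t) k) \<le> e"
      proof (rule M[OF A(2)[OF t] ah[OF t]])
        fix j assume "j \<in> freqs M"
        then have "j \<in> freqs n" using N[OF n] freqs_mono[of M n j] by auto
        then show "cmod (A n t j - a t j) \<le> d" using rate[of n t j] N[OF n] t by force
      qed
    qed
  qed (use A(3) ink a t in auto)
  have "a 0 = a0"
  proof
    fix k
    have "(\<lambda>N. A N 0 k) \<longlonglongrightarrow> a0 k"
      by (rule tendsto_eventually) (use ink[of k] A0 in \<open>auto simp: eventually_sequentially\<close>)
    then show "a 0 k = a0 k" using a[of 0 k] T LIMSEQ_unique by auto
  qed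
  then show ?thesis using that[of a] ah as ad by (auto simp: sol_def)
qed

text \<open>The energy of \<open>b\<close> cannot be differentiated, as the time derivative of
  \<open>b\<close> lies in H^(s-1) only. The bound holds for the truncations started from
  \<open>b 0\<close>, which converge to \<open>b\<close> by \<open>compare\<close>, and survives the
  limit. The initial radius r enters sharply; the radius R governs only the admissible length of
  time.\<close>

lemma tame_local:
  assumes s: "s > 5/2" and R: "R > 0" and b: "sol s T R b"
    and T: "T \<ge> 0" "gal_const s * R * T \<le> 1/2" and r: "r \<ge> 0" "hsb s r (b 0)"
    and K: "K \<ge> 0" "\<And>t F. t \<in> {0..T} \<Longrightarrow> finite F \<Longrightarrow> (\<Sum>k\<in>F. jb k * cmod (b t k)) \<le> K"
    and t: "t \<in> {0..T}"
  shows "hsb s (r * exp (en_const s * K * t)) (b t)"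
proof -
  have s': "s > 3/2" using s by simp
  have T0: "0 \<in> {0..T}" using T by simp
  have b3: "hsb s (3 * R) (b t)" if "t \<in> {0..T}" for t
    using hsb_mono[OF solD(2)[OF b that], of "3 * R"] R by simp
  define CG where "CG = (\<lambda>N a. (\<forall>k. a 0 k = (if k \<in> freqs N then b 0 k else 0)) \<and> 
    (\<forall>t\<in>{0..T}. symm (a t) \<and> hsb s (3 * R) (a t) \<and> (\<forall>k\<in>freqs N. ((\<lambda>t. a t k) has_vector_derivative qconv (a t) (a t) k) (at t within {0..T}))) \<and>
    (\<forall>K t. K \<ge> 0 \<longrightarrow> t \<in> {0..T} \<longrightarrow> (\<forall>t\<in>{0..T}. (\<Sum>k\<in>freqs N. jb k * cmod (a t k)) \<le> K) \<longrightarrow>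
        (\<Sum>k\<in>freqs N. (jb k powr s * cmod (a t k))\<^sup>2)
          \<le> (\<Sum>k\<in>freqs N. (jb k powr s * cmod (b 0 k))\<^sup>2) * exp (2 * en_const s * K * t)))"
  have "\<exists>a. CG N a" for N
  proof -
    obtain a where a: "\<And>k. a 0 k = (if k \<in> freqs N then b 0 k else 0)"
      "\<And>t k. t \<in> {0..T} \<Longrightarrow> k \<notin> freqs N \<Longrightarrow> a t k = 0"
      "\<And>t. t \<in> {0..T} \<Longrightarrow> symm (a t)"
      "\<And>t. t \<in> {0..T} \<Longrightarrow> hsb s (3 * R) (a t)"
      "\<And>t k. t \<in> {0..T} \<Longrightarrow> k \<in> freqs N \<Longrightarrow>
        ((\<lambda>t. a t k) has_vector_derivative qfin (freqs N) (a t) k) (at t within {0..T})"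
      "\<And>K t. \<lbrakk>K \<ge> 0; t \<in> {0..T}; \<And>t. t \<in> {0..T} \<Longrightarrow> (\<Sum>k\<in>freqs N. jb k * cmod (a t k)) \<le> K\<rbrakk> \<Longrightarrow>
        (\<Sum>k\<in>freqs N. (jb k powr s * cmod (a t k))\<^sup>2)
          \<le> (\<Sum>k\<in>freqs N. (jb k powr s * cmod (b 0 k))\<^sup>2) * exp (2 * en_const s * K * t)"
      using galerkin[OF s' R solD(1,2)[OF b T0] T, of N] by blast
    have "CG N a" unfolding CG_def using a(1,3,4) a(5) galerkin_qconv[OF a(2)] a(6) by auto
    then show ?thesis by blast
  qed
  then obtain A where CG: "\<And>N. CG N (A N)" by metis
  have A0: "A N 0 k = (if k \<in> freqs N then b 0 k else 0)" for N k using CG[of N] by (simp add: CG_def)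
  have A: "symm (A N t)" "hsb s (3 * R) (A N t)" if "t \<in> {0..T}" for N t using CG[of N] that by (auto simp: CG_def)
  have A': "((\<lambda>t. A N t k) has_vector_derivative qconv (A N t) (A N t) k) (at t within {0..T})"
    if "t \<in> {0..T}" "k \<in> freqs N" for N t k using CG[of N] that by (auto simp: CG_def)
  have AE: "(\<Sum>k\<in>freqs N. (jb k powr s * cmod (A N t k))\<^sup>2)
          \<le> (\<Sum>k\<in>freqs N. (jb k powr s * cmod (b 0 k))\<^sup>2) * exp (2 * en_const s * K * t)"
    if "K \<ge> 0" "t \<in> {0..T}" "\<And>t. t \<in> {0..T} \<Longrightarrow> (\<Sum>k\<in>freqs N. jb k * cmod (A N t k)) \<le> K" for N K t
    using CG[of N] that by (auto simp: CG_def)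
  define c where "c N = sqrt (cerr s (3 * R) T N)" for N
  have c: "c \<longlonglongrightarrow> 0" unfolding c_def using tendsto_real_sqrt[OF cerr_tendsto[of s "3 * R" T]] by simp
  have rate: "cmod (A N t k - b t k) \<le> c N" if "N \<ge> 1" "t \<in> {0..T}" "k \<in> freqs N" for N t k
  proof -
    have "(cmod (A N t k - b t k))\<^sup>2 \<le> (\<Sum>k\<in>freqs N. (cmod (A N t k - b t k))\<^sup>2)"
      using that by (intro member_le_sum) auto
    also have "\<dots> \<le> cerr s (3 * R) T N"
      by (rule compare[OF s]) (use R A A' A0 that b3 solD[OF b] in auto)
    finally show ?thesis unfolding c_def by (rule real_le_rsqrt)
  qed
  have ink: "k \<in> freqs N" if "N \<ge> nat \<bar>k\<bar>" for k N using that by (auto simp: freqs_def)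
  have lim: "(\<lambda>N. A N t k) \<longlonglongrightarrow> b t k" if t: "t \<in> {0..T}" for t k
  proof -
    have "(\<lambda>N. A N t k - b t k) \<longlonglongrightarrow> 0"
    proof (rule Lim_null_comparison[OF _ c])
      show "eventually (\<lambda>N. norm (A N t k - b t k) \<le> c N) sequentially"
        unfolding eventually_sequentially
        using rate[OF _ t] ink by (intro exI[of _ "max 1 (nat \<bar>k\<bar>)"]) auto
    qed
    then show ?thesis using LIM_zero_iff by blast
  qed
  \<comment> \<open>The l^1 bound of the truncations eventually exceeds that of \<open>b\<close> by
    at most e: low modes converge uniformly in time, high ones have a uniformly small tail.\<close>
  have W: "\<exists>N0. \<forall>N\<ge>N0. \<forall>t\<in>{0..T}. (\<Sum>k\<in>freqs N. jb k * cmod (A N t k)) \<le> K + e" if e: "e > 0" for e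
  proof -
    define Z where "Z = zt (s - 3/2) * (3 * R)"
    have Z: "Z \<ge> 0" using R by (simp add: Z_def zt_nonneg)
    have "(\<lambda>n. real n powr (- (1/2)) * Z) \<longlonglongrightarrow> 0 * Z"
      by (intro tendsto_intros tendsto_neg_powr filterlim_real_sequentially) auto
    then have "eventually (\<lambda>n. real n powr (- (1/2)) * Z < e / 3) sequentially" using e by (intro order_tendstoD) auto
    then have "eventually (\<lambda>n. real n powr (- (1/2)) * Z < e / 3 \<and> n \<ge> 1) sequentially"
      using eventually_ge_at_top[of 1] by eventually_elim auto
    then obtain n where n: "real n powr (- (1/2)) * Z < e / 3" "n \<ge> 1" by (auto simp: eventually_sequentially)
    define B where "B = (\<Sum>k\<in>freqs n. jb k)"
    have "(\<lambda>N. B * c N) \<longlonglongrightarrow> B * 0" by (intro tendsto_intros c)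
    then have "eventually (\<lambda>N. B * c N < e / 3) sequentially" using e by (intro order_tendstoD) auto
    then have "eventually (\<lambda>N. B * c N < e / 3 \<and> N \<ge> n) sequentially"
      using eventually_ge_at_top[of n] by eventually_elim auto
    then obtain N0 where N0: "\<And>N. N \<ge> N0 \<Longrightarrow> B * c N < e / 3 \<and> N \<ge> n" by (auto simp: eventually_sequentially)
    show ?thesis
    proof (intro exI[of _ N0] allI impI ballI)
      fix N t assume N: "N \<ge> N0" and t: "t \<in> {0..T}"
      have Nn: "N \<ge> n" "N \<ge> 1" "B * c N < e / 3" using N0[OF N] n by auto
      have split: "freqs N = freqs n \<union> (freqs N - freqs n)" using Nn(1) freqs_mono by auto
      have tl: "(\<Sum>k\<in>freqs N - freqs n. jb k * cmod (x k)) \<le> e / 3" if "hsb s (3 * R) x" for x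
      proof -
        have "(\<Sum>k\<in>freqs N - freqs n. jb k powr 1 * cmod (x k)) \<le> real n powr (- (1/2)) * (zt (s - 1 - 1/2) * (3 * R))"
          by (rule hsb_tail[OF that]) (use R s n not_in_freqs in auto)
        then show ?thesis using n(1) by (simp add: Z_def jb_nonneg)
      qed
      have "(\<Sum>k\<in>freqs N. jb k * cmod (A N t k)) = (\<Sum>k\<in>freqs n. jb k * cmod (A N t k)) + (\<Sum>k\<in>freqs N - freqs n. jb k * cmod (A N t k))"
        by (subst split, subst sum.union_disjoint) auto
      also have "(\<Sum>k\<in>freqs n. jb k * cmod (A N t k)) \<le> (\<Sum>k\<in>freqs n. jb k * cmod (b t k) + jb k * c N)"
        unfolding distrib_left[symmetric]
      proof (intro sum_mono mult_left_mono)
        fix k assume "k \<in> freqs n"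
        then have "cmod (A N t k - b t k) \<le> c N" using rate[OF Nn(2) t] freqs_mono[OF Nn(1)] by auto
        then show "cmod (A N t k) \<le> cmod (b t k) + c N" using norm_triangle_sub[of "A N t k" "b t k"] by linarith
      qed (rule jb_nonneg)
      also have "\<dots> = (\<Sum>k\<in>freqs n. jb k * cmod (b t k)) + B * c N" by (simp add: sum.distrib B_def sum_distrib_right)
      also have "(\<Sum>k\<in>freqs n. jb k * cmod (b t k)) \<le> K" by (rule K(2)[OF t]) simp
      also have "(\<Sum>k\<in>freqs N - freqs n. jb k * cmod (A N t k)) \<le> e / 3" by (rule tl[OF A(2)[OF t]])
      finally show "(\<Sum>k\<in>freqs N. jb k * cmod (A N t k)) \<le> K + e" using Nn(3) e by simp
    qed
  qed
  have bd: "hsb s (r * exp (en_const s * (K + e) * t)) (b t)" if e: "e > 0" for e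
  proof -
    obtain N0 where N0: "\<And>N t. N \<ge> N0 \<Longrightarrow> t \<in> {0..T} \<Longrightarrow> (\<Sum>k\<in>freqs N. jb k * cmod (A N t k)) \<le> K + e"
      using W[OF e] by blast
    show ?thesis unfolding hsb_def
    proof safe
      fix S :: "int set" assume S: "finite S"
      have "\<exists>n. S \<subseteq> freqs n"
      proof -
        have "S \<subseteq> freqs (nat (\<Sum>k\<in>S. \<bar>k\<bar>))"
        proof
          fix k assume "k \<in> S"
          then have "\<bar>k\<bar> \<le> (\<Sum>k\<in>S. \<bar>k\<bar>)" using S by (intro member_le_sum) auto
          then show "k \<in> freqs (nat (\<Sum>k\<in>S. \<bar>k\<bar>))" by (auto simp: freqs_def)
        qed
        then show ?thesis by blast
      qed
      then obtain n where n: "S \<subseteq> freqs n" by blast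
      have "(\<lambda>N. \<Sum>k\<in>S. (jb k powr s * cmod (A N t k))\<^sup>2) \<longlonglongrightarrow> (\<Sum>k\<in>S. (jb k powr s * cmod (b t k))\<^sup>2)"
        by (intro tendsto_intros lim t)
      then show "(\<Sum>k\<in>S. (jb k powr s * cmod (b t k))\<^sup>2) \<le> (r * exp (en_const s * (K + e) * t))\<^sup>2"
      proof (rule LIMSEQ_le_const2, intro exI[of _ "max N0 n"] allI impI)
        fix N assume N: "max N0 n \<le> N"
        have "(\<Sum>k\<in>S. (jb k powr s * cmod (A N t k))\<^sup>2) \<le> (\<Sum>k\<in>freqs N. (jb k powr s * cmod (A N t k))\<^sup>2)"
          using n N freqs_mono[of n N] by (intro sum_mono2) auto
        also have "\<dots> \<le> (\<Sum>k\<in>freqs N. (jb k powr s * cmod (b 0 k))\<^sup>2) * exp (2 * en_const s * (K + e) * t)"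
          by (rule AE) (use K e t N N0 in auto)
        also have "\<dots> \<le> r\<^sup>2 * exp (2 * en_const s * (K + e) * t)"
          by (intro mult_right_mono hsbD[OF r(2)]) auto
        also have "\<dots> = (r * exp (en_const s * (K + e) * t))\<^sup>2"
          by (simp add: power_mult_distrib power2_eq_square flip: exp_add)
        finally show "(\<Sum>k\<in>S. (jb k powr s * cmod (A N t k))\<^sup>2) \<le> (r * exp (en_const s * (K + e) * t))\<^sup>2" .
      qed
    qed
  qed
  show ?thesis unfolding hsb_def
  proof safe
    fix S :: "int set" assume S: "finite S"
    have "((\<lambda>e. (r * exp (en_const s * (K + e) * t))\<^sup>2) \<longlongrightarrow> (r * exp (en_const s * (K + 0) * t))\<^sup>2) (at_right 0)"
      by (intro tendsto_intros)
    moreover have "eventually (\<lambda>e. (\<Sum>k\<in>S. (jb k powr s * cmod (b t k))\<^sup>2) \<le> (r * exp (en_const s * (K + e) * t))\<^sup>2) (at_right 0)"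
      by (rule eventually_mono[OF eventually_at_right_less[of 0]]) (rule hsbD[OF bd S])
    ultimately show "(\<Sum>k\<in>S. (jb k powr s * cmod (b t k))\<^sup>2) \<le> (r * exp (en_const s * K * t))\<^sup>2"
      using tendsto_lowerbound trivial_limit_at_right_real by fastforce
  qed
qed

section \<open>Translation, concatenation and persistence over long times\<close>

lemma sol_shift:
  assumes a: "sol s T R a" and t0: "t0 \<ge> 0" "t0 + T' \<le> T"
  shows "sol s T' R (\<lambda>t. a (t0 + t))"
  unfolding sol_def
proof safe
  fix t k assume t: "t \<in> {0..T'}"
  then have t': "t0 + t \<in> {0..T}" using t0 by auto
  show "symm (a (t0 + t))" "hsb s R (a (t0 + t))" using solD[OF a t'] by auto
  have "((\<lambda>t. t0 + t) has_vector_derivative 1) (at t within {0..T'})"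
    by (auto intro!: derivative_eq_intros simp flip: has_real_derivative_iff_has_vector_derivative)
  moreover have "((\<lambda>t. a t k) has_vector_derivative qconv (a (t0 + t)) (a (t0 + t)) k) (at (t0 + t) within (\<lambda>t. t0 + t) ` {0..T'})"
    by (rule has_vector_derivative_within_subset[OF solD(3)[OF a t']]) (use t0 in auto)
  ultimately have "((\<lambda>t. a t k) \<circ> (\<lambda>t. t0 + t) has_vector_derivative 1 *\<^sub>R qconv (a (t0 + t)) (a (t0 + t)) k) (at t within {0..T'})"
    by (rule vector_diff_chain_within)
  then show "((\<lambda>t. a (t0 + t) k) has_vector_derivative qconv (a (t0 + t)) (a (t0 + t)) k) (at t within {0..T'})"
    by (simp add: o_def)
qed

lemma sol_concat:
  assumes a: "sol s T1 R a" and b: "sol s T2 R b" and ab: "b 0 = a T1" and T: "T1 \<ge> 0" "T2 \<ge> 0"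
  shows "sol s (T1 + T2) R (\<lambda>t. if t \<in> {0..T1} then a t else b (t - T1))"
  unfolding sol_def
proof safe
  define c where "c t = (if t \<in> {0..T1} then a t else b (t - T1))" for t
  have b': "((\<lambda>t. b (t - T1) k) has_vector_derivative qconv (b (t - T1)) (b (t - T1)) k) (at t within {T1..T1+T2})"
    if t: "t \<in> {T1..T1+T2}" for t k
  proof -
    have "((\<lambda>t. t - T1) has_vector_derivative 1) (at t within {T1..T1+T2})"
      by (auto intro!: derivative_eq_intros simp flip: has_real_derivative_iff_has_vector_derivative)
    moreover have "((\<lambda>t. b t k) has_vector_derivative qconv (b (t - T1)) (b (t - T1)) k) (at (t - T1) within (\<lambda>t. t - T1) ` {T1..T1+T2})"
      by (rule has_vector_derivative_within_subset[OF solD(3)[OF b]]) (use t in auto)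
    ultimately have "((\<lambda>t. b t k) \<circ> (\<lambda>t. t - T1) has_vector_derivative 1 *\<^sub>R qconv (b (t - T1)) (b (t - T1)) k) (at t within {T1..T1+T2})"
      by (rule vector_diff_chain_within)
    then show ?thesis by (simp add: o_def)
  qed
  fix t k assume t: "t \<in> {0..T1 + T2}"
  show "symm (if t \<in> {0..T1} then a t else b (t - T1))" "hsb s R (if t \<in> {0..T1} then a t else b (t - T1))"
    using solD(1,2)[OF a, of t] solD(1,2)[OF b, of "t - T1"] t by auto
  have cl: "closure {0..T1} \<inter> closure {T1..T1+T2} = {T1}" using T by auto
  have "((\<lambda>t. if t \<in> {0..T1} then a t k else b (t - T1) k) has_vector_derivative
       (if t \<in> {0..T1} then qconv (a t) (a t) k else qconv (b (t - T1)) (b (t - T1)) k)) (at t within {0..T1+T2})"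
  proof (rule has_vector_derivative_If_within_closures[where T = "{T1..T1+T2}"])
    show "t \<in> {0..T1} \<union> {T1..T1+T2}" "{0..T1+T2} = {0..T1} \<union> {T1..T1+T2}" using t T by auto
    have e: "{0..T1} \<union> {T1} = {0..T1}" "{T1..T1+T2} \<union> {T1} = {T1..T1+T2}" using T by auto
    show "((\<lambda>t. a t k) has_vector_derivative qconv (a t) (a t) k) (at t within {0..T1} \<union> (closure {0..T1} \<inter> closure {T1..T1+T2}))"
      if "t \<in> {0..T1} \<union> (closure {0..T1} \<inter> closure {T1..T1+T2})"
      using that solD(3)[OF a] unfolding cl e by auto
    show "((\<lambda>t. b (t - T1) k) has_vector_derivative qconv (b (t - T1)) (b (t - T1)) k) (at t within {T1..T1+T2} \<union> (closure {0..T1} \<inter> closure {T1..T1+T2}))"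
      if "t \<in> {T1..T1+T2} \<union> (closure {0..T1} \<inter> closure {T1..T1+T2})"
      using that b' unfolding cl e by auto
    show "a t k = b (t - T1) k" "qconv (a t) (a t) k = qconv (b (t - T1)) (b (t - T1)) k"
      if "t \<in> closure {0..T1}" "t \<in> closure {T1..T1+T2}"
      using that ab T by auto
  qed
  then have "((\<lambda>t. c t k) has_vector_derivative qconv (c t) (c t) k) (at t within {0..T1+T2})"
    unfolding c_def if_distrib[of "\<lambda>f. f k"] if_distrib[of "\<lambda>f. qconv f f k"]
    by (simp add: if_distrib[of "\<lambda>f. f k"] cong: if_cong)
  then show "((\<lambda>t. (if t \<in> {0..T1} then a t else b (t - T1)) k) has_vector_derivative
      qconv (if t \<in> {0..T1} then a t else b (t - T1)) (if t \<in> {0..T1} then a t else b (t - T1)) k) (at t within {0..T1+T2})"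
    unfolding c_def .
qed

text \<open>Steps of the length allowed by \<open>tame_local\<close> are chained. The exponential
  factors multiply, so the bound does not deteriorate with the number of steps.\<close>

lemma tame:
  assumes s: "s > 5/2" and R: "R > 0" and b: "sol s T R b" and r: "r \<ge> 0" "hsb s r (b 0)"
    and K: "K \<ge> 0" "\<And>t F. t \<in> {0..T} \<Longrightarrow> finite F \<Longrightarrow> (\<Sum>k\<in>F. jb k * cmod (b t k)) \<le> K"
    and t: "t \<in> {0..T}"
  shows "hsb s (r * exp (en_const s * K * t)) (b t)"
proof -
  have g: "gal_const s * R > 0" using gal_const_pos[of s] s R by simp
  define d where "d = 1 / (2 * (gal_const s * R))"
  have d: "d > 0" "gal_const s * R * d = 1/2" using g by (auto simp: d_def field_simps)
  have "\<forall>t\<in>{0..T}. t \<le> real n * d \<longrightarrow> hsb s (r * exp (en_const s * K * t)) (b t)" for n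
  proof (induction n)
    case 0
    then show ?case using r by auto
  next
    case (Suc n)
    show ?case
    proof safe
      fix t assume t: "t \<in> {0..T}" "t \<le> real (Suc n) * d"
      define t0 where "t0 = max 0 (t - d)"
      have t0: "t0 \<in> {0..T}" "t0 \<le> real n * d" "t0 \<le> t" "t - t0 \<le> d"
        using t d by (auto simp: t0_def algebra_simps)
      have h: "hsb s (r * exp (en_const s * K * t0)) (b t0)" using Suc t0 by auto
      have "hsb s ((r * exp (en_const s * K * t0)) * exp (en_const s * K * (t - t0))) ((\<lambda>t. b (t0 + t)) (t - t0))"
      proof (rule tame_local[OF s R sol_shift[OF b]])
        show "gal_const s * R * (t - t0) \<le> 1/2"
          using mult_left_mono[OF t0(4), of "gal_const s * R"] g d by simp
      qed (use t t0 K r h in auto)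
      then show "hsb s (r * exp (en_const s * K * t)) (b t)"
        by (simp add: mult.assoc flip: exp_add) (simp add: algebra_simps)
    qed
  qed
  moreover have "\<exists>n. t \<le> real n * d" using d reals_Archimedean3[of d] less_imp_le by blast
  ultimately show ?thesis using t by blast
qed

subsection \<open>Fourier coefficients of continuous periodic functions\<close>

definition cper :: "(real \<Rightarrow> real) \<Rightarrow> bool" where
  "cper u \<longleftrightarrow> periodic1 u \<and> continuous_on UNIV u"

definition ek :: "int \<Rightarrow> real \<Rightarrow> complex" where
  "ek k x = cis (2 * pi * of_int k * x)"

lemma cperD: "cper u \<Longrightarrow> u (x + 1) = u x" "cper u \<Longrightarrow> continuous_on A u"
  by (auto simp: cper_def periodic1_def intro: continuous_on_subset)

lemma cper_nat: "cper u \<Longrightarrow> u (x + real n) = u x"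
  by (induction n) (auto simp: add.assoc[symmetric] cperD add.commute[of 1])

lemma cper_int: assumes "cper u" shows "u (x + of_int n) = u x"
proof (cases "n \<ge> 0")
  case True
  then show ?thesis using cper_nat[OF assms, of x "nat n"] by simp
next
  case False
  then show ?thesis using cper_nat[OF assms, of "x + of_int n" "nat (- n)"] by simp
qed

lemma cper_const [simp]: "cper (\<lambda>x. c)"
  and cper_add: "cper u \<Longrightarrow> cper v \<Longrightarrow> cper (\<lambda>x. u x + v x)"
  and cper_diff: "cper u \<Longrightarrow> cper v \<Longrightarrow> cper (\<lambda>x. u x - v x)"
  and cper_minus: "cper u \<Longrightarrow> cper (\<lambda>x. - u x)"
  and cper_mult: "cper u \<Longrightarrow> cper v \<Longrightarrow> cper (\<lambda>x. u x * v x)"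
  and cper_power: "cper u \<Longrightarrow> cper (\<lambda>x. u x ^ n)"
  by (auto simp: cper_def periodic1_def intro!: continuous_intros)

lemmas cper_intros = cper_const cper_add cper_diff cper_minus cper_mult cper_power

lemma ek_0 [simp]: "ek 0 x = 1" and norm_ek [simp]: "norm (ek k x) = 1"
  and ek_add: "ek (k + l) x = ek k x * ek l x" and cnj_ek: "cnj (ek k x) = ek (- k) x"
  by (auto simp: ek_def cis_mult algebra_simps cis_cnj)

lemma continuous_ek [continuous_intros]: "continuous_on A (ek k)"
  unfolding ek_def by (intro continuous_intros)

lemma ek_deriv: "(ek k has_vector_derivative 2 * pi * \<i> * of_int k * ek k x) (at x within A)"
proof -
  have "((\<lambda>x. cis (2 * pi * of_int k * x)) has_derivative (\<lambda>h. (2 * pi * of_int k * h) *\<^sub>R (\<i> * cis (2 * pi * of_int k * x)))) (at x within A)"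
    by (rule has_derivative_cis) (auto intro!: derivative_eq_intros)
  then show ?thesis
    unfolding has_vector_derivative_def ek_def
    by (rule has_derivative_eq_rhs) (auto simp: fun_eq_iff scaleR_conv_of_real)
qed

lemma ek_periodic: "ek k (x + 1) = ek k x"
proof -
  have "ek k (x + 1) = cis (2 * pi * of_int k * x) * cis (2 * pi * of_int k)"
    unfolding ek_def cis_mult by (simp add: algebra_simps)
  then show ?thesis using cis_multiple_2pi[of "of_int k"] by (simp add: ek_def)
qed

lemma ek_at_1 [simp]: "ek k 1 = 1" "ek k 0 = 1"
  using ek_periodic[of k 0] by (auto simp: ek_def)

lemma integral_ek: "integral {0..1} (ek k) = (if k = 0 then 1 else 0)"
proof (cases "k = 0")
  case True
  then have "ek k = (\<lambda>x. 1)" by (auto simp: fun_eq_iff)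
  then show ?thesis using True by simp
next
  case False
  have "((\<lambda>x. 2 * pi * \<i> * of_int k * ek k x) has_integral (ek k 1 - ek k 0)) {0..1}"
    by (rule fundamental_theorem_of_calculus) (simp, rule ek_deriv)
  from integral_unique[OF this] have "2 * pi * \<i> * of_int k * integral {0..1} (ek k) = 0"
    unfolding integral_mult_right by simp
  then show ?thesis using False by simp
qed

lemma fcoeff_ek: "fcoeff u k = integral {0..1} (\<lambda>x. of_real (u x) * ek (- k) x)"
  by (simp add: fcoeff_def ek_def)

lemma ek_integrable: "continuous_on {0..1} u \<Longrightarrow> (\<lambda>x. complex_of_real (u x) * ek k x) integrable_on {0..1}"
  by (intro integrable_continuous_real continuous_intros)

lemma fcoeff_add: "cper u \<Longrightarrow> cper v \<Longrightarrow> fcoeff (\<lambda>x. u x + v x) k = fcoeff u k + fcoeff v k"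
  unfolding fcoeff_ek by (simp add: distrib_right integral_add ek_integrable cperD)

lemma fcoeff_diff: "cper u \<Longrightarrow> cper v \<Longrightarrow> fcoeff (\<lambda>x. u x - v x) k = fcoeff u k - fcoeff v k"
  unfolding fcoeff_ek by (simp add: left_diff_distrib integral_diff ek_integrable cperD)

lemma fcoeff_cmult: "fcoeff (\<lambda>x. c * u x) k = of_real c * fcoeff u k"
  unfolding fcoeff_ek by (simp add: mult.assoc)

lemma fcoeff_const: "fcoeff (\<lambda>x. c) k = (if k = 0 then of_real c else 0)"
  unfolding fcoeff_ek by (simp add: integral_ek)

lemma integral_of_real:
  fixes f :: "real \<Rightarrow> real"
  assumes "continuous_on {a..b} f"
  shows "integral {a..b} (\<lambda>x. complex_of_real (f x)) = complex_of_real (integral {a..b} f)"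
  using integral_linear[OF integrable_continuous_real[OF assms], of complex_of_real]
  by (simp add: o_def bounded_linear_of_real)

lemma fcoeff_0: "fcoeff u 0 = of_real (mu u)" if "cper u"
  unfolding fcoeff_ek mu_def by (simp add: integral_of_real cperD[OF that])

lemma symm_fcoeff: "symm (fcoeff u)"
  unfolding symm_def
proof
  fix k
  have "cnj (fcoeff u k) = integral {0..1} (\<lambda>x. cnj (of_real (u x) * ek (- k) x))"
    unfolding fcoeff_ek by (rule integral_cnj)
  then show "fcoeff u (- k) = cnj (fcoeff u k)" by (simp add: fcoeff_ek cnj_ek)
qed

text \<open>By Stone--Weierstrass on the unit circle, \<open>f\<close> is a uniform limit of trigonometric polynomials, to all of which
  it is orthogonal.\<close>

lemma fourier_uniqueness:
  assumes f: "cper f" and z: "\<And>k. fcoeff f k = 0"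
  shows "f x = 0"
proof -
  define p where "p t = cis (2 * pi * t)" for t
  \<comment> \<open>\<open>f\<close> descends to the unit circle; any preimage in [0,1] serves,
    since \<open>f\<close> has period 1.\<close>
  define ft where "ft w = f (SOME t. t \<in> {0..1} \<and> p t = w)" for w
  have pcont: "continuous_on A p" for A unfolding p_def by (intro continuous_intros)
  have peq: "f t = f t'" if "p t = p t'" for t t'
  proof -
    have "exp (\<i> * of_real (2 * pi * t)) = exp (\<i> * of_real (2 * pi * t'))"
      using that by (simp add: p_def cis_conv_exp)
    then obtain n :: int where "\<i> * of_real (2 * pi * t) = \<i> * of_real (2 * pi * t') + (of_int (2 * n) * pi) * \<i>"
      unfolding exp_eq by blast
    then have "\<i> * of_real (2 * pi * t) = \<i> * of_real (2 * pi * (t' + of_int n))" by (simp add: algebra_simps)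
    then have "2 * pi * t = 2 * pi * (t' + of_int n)" by (metis complex_i_not_zero mult_left_cancel of_real_eq_iff)
    then show ?thesis using cper_int[OF f, of t' n] by simp
  qed
  have ftp: "ft (p t) = f t" if "t \<in> {0..1}" for t
  proof -
    have "\<exists>t'. t' \<in> {0..1} \<and> p t' = p t" using that by blast
    from someI_ex[OF this] show ?thesis unfolding ft_def by (intro peq) simp
  qed
  have surj: "p ` {0..1} = sphere 0 1"
  proof
    show "p ` {0..1} \<subseteq> sphere 0 1" by (auto simp: p_def)
    show "sphere 0 1 \<subseteq> p ` {0..1}"
    proof
      fix w :: complex assume "w \<in> sphere 0 1"
      then have w: "w = exp (\<i> * of_real (Arg2pi w))" using Arg2pi_eq[of w] by simp
      define t where "t = Arg2pi w / (2 * pi)"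
      have "t \<in> {0..1}" using Arg2pi_ge_0[of w] Arg2pi_lt_2pi[of w] by (simp add: t_def)
      moreover have "p t = w" using w by (simp add: p_def t_def cis_conv_exp)
      ultimately show "w \<in> p ` {0..1}" by blast
    qed
  qed
  have fc: "continuous_on {0..1} f" by (rule cperD(2)[OF f])
  \<comment> \<open>The parametrisation identifies the endpoints of [0,1] and has no continuous
    inverse; continuity is read off from the graph, a continuous image of a compact
    interval.\<close>
  have "continuous_on (sphere 0 1) ft"
  proof (rule continuous_from_closed_graph)
    show "compact (f ` {0..1})" by (intro compact_continuous_image fc) auto
    show "ft \<in> sphere 0 1 \<rightarrow> f ` {0..1}" using ftp unfolding surj[symmetric] by auto
    have "(\<lambda>w. (w, ft w)) ` sphere 0 1 = (\<lambda>t. (p t, f t)) ` {0..1}"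
      unfolding surj[symmetric] image_image by (intro image_cong refl) (simp add: ftp)
    moreover have "compact ((\<lambda>t. (p t, f t)) ` {0..1})"
      by (intro compact_continuous_image continuous_intros fc pcont) auto
    ultimately show "closed ((\<lambda>w. (w, ft w)) ` sphere 0 1)" by (simp add: compact_imp_closed)
  qed
  note ftc = this
  \<comment> \<open>Orthogonality to all characters is stable under multiplication by linear
    functions on the circle, which shift frequencies by 1, and hence by polynomials.\<close>
  define Z where "Z h \<longleftrightarrow> continuous_on {0..1} h \<and> (\<forall>k. integral {0..1} (\<lambda>x. complex_of_real (h x) * ek k x) = 0)" for h :: "real \<Rightarrow> real"
  have Zf: "Z f" unfolding Z_def
  proof (intro conjI fc allI)
    fix k show "integral {0..1} (\<lambda>x. complex_of_real (f x) * ek k x) = 0"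
      using z[of "- k"] by (simp add: fcoeff_ek)
  qed
  have Zint: "(\<lambda>x. complex_of_real (h x) * ek k x) integrable_on {0..1}" if "Z h" for h k
    using that by (intro ek_integrable) (simp add: Z_def)
  have Zmul: "Z (\<lambda>x. h x * g (p x))" if g: "real_polynomial_function g" and h: "Z h" for g h
    using g h
  proof (induction g arbitrary: h rule: real_polynomial_function.induct)
    case (linear g)
    interpret g: bounded_linear g by (rule linear.hyps)
    have hc: "continuous_on {0..1} h" using linear.prems by (simp add: Z_def)
    have gp: "g (p x) = g 1 * cos (2 * pi * x) + g \<i> * sin (2 * pi * x)" for x
    proof -
      have "p x = cos (2 * pi * x) *\<^sub>R 1 + sin (2 * pi * x) *\<^sub>R \<i>" by (simp add: p_def complex_eq_iff)
      then show ?thesis by (simp add: g.add g.scaleR)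
    qed
    define A where "A = (of_real (g 1) - \<i> * of_real (g \<i>)) / 2"
    define B where "B = (of_real (g 1) + \<i> * of_real (g \<i>)) / 2"
    have AB: "complex_of_real (h x * g (p x)) * ek k x = A * (of_real (h x) * ek (k + 1) x) + B * (of_real (h x) * ek (k - 1) x)" for x k
    proof -
      have "complex_of_real (g (p x)) = A * ek 1 x + B * ek (- 1) x"
        unfolding gp A_def B_def ek_def by (simp add: complex_eq_iff field_simps)
      moreover have "ek (k + 1) x = ek k x * ek 1 x" "ek (k - 1) x = ek k x * ek (- 1) x"
        using ek_add[of k 1 x] ek_add[of k "-1" x] by simp_all
      ultimately show ?thesis by (simp add: algebra_simps)
    qed
    have "continuous_on {0..1} (\<lambda>x. h x * g (p x))"
      unfolding gp by (intro continuous_intros hc)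
    moreover have "integral {0..1} (\<lambda>x. complex_of_real (h x * g (p x)) * ek k x) = 0" for k
      unfolding AB
      by (subst integral_add, (intro integrable_continuous_real continuous_intros hc)+)
         (use linear.prems in \<open>simp add: Z_def\<close>)
    ultimately show ?case unfolding Z_def by blast
  next
    case (const c)
    then show ?case unfolding Z_def
      by (auto intro!: continuous_intros simp: mult.commute[of _ "complex_of_real c"] mult.assoc)
  next
    case (add g1 g2)
    have 1: "Z (\<lambda>x. h x * g1 (p x))" and 2: "Z (\<lambda>x. h x * g2 (p x))" using add by auto
    have "continuous_on {0..1} (\<lambda>x. h x * g1 (p x) + h x * g2 (p x))"
      using 1 2 by (intro continuous_on_add) (auto simp: Z_def)
    moreover have "integral {0..1} (\<lambda>x. complex_of_real (h x * g1 (p x) + h x * g2 (p x)) * ek k x) = 0" for k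
      using Zint[OF 1, of k] Zint[OF 2, of k] 1 2
      by (simp only: of_real_add distrib_right) (subst integral_add, auto simp: Z_def)
    ultimately show ?case unfolding Z_def distrib_left by blast
  next
    case (mult g1 g2)
    have "Z (\<lambda>x. (h x * g1 (p x)) * g2 (p x))" using mult by blast
    then show ?case by (simp add: mult.assoc)
  qed
  define I where "I = integral {0..1} (\<lambda>x. f x * f x)"
  define M where "M = integral {0..1} (\<lambda>x. \<bar>f x\<bar>)"
  have M0: "M \<ge> 0" unfolding M_def by (intro integral_nonneg integrable_continuous_real continuous_intros fc) auto
  \<comment> \<open>One factor of f^2 is replaced by a polynomial within e of it: the product then
    integrates to 0, at the cost of e times the L^1 norm of \<open>f\<close>.\<close>
  have Ie: "I \<le> e * M" if e: "e > 0" for e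
  proof -
    obtain g where g: "real_polynomial_function g" "\<And>w. w \<in> sphere 0 1 \<Longrightarrow> \<bar>ft w - g w\<bar> < e"
      using Stone_Weierstrass_real_polynomial_function[OF compact_sphere ftc e] by blast
    have Zg: "Z (\<lambda>x. f x * g (p x))" by (rule Zmul[OF g(1) Zf])
    have gc: "continuous_on {0..1} (\<lambda>x. f x * g (p x))" using Zg by (simp add: Z_def)
    have "integral {0..1} (\<lambda>x. complex_of_real (f x * g (p x)) * ek 0 x) = 0" using Zg unfolding Z_def by blast
    then have "complex_of_real (integral {0..1} (\<lambda>x. f x * g (p x))) = 0"
      using integral_of_real[OF gc] by (simp only: ek_0 mult_1_right)
    then have gz: "integral {0..1} (\<lambda>x. f x * g (p x)) = 0" by simp
    have "I = integral {0..1} (\<lambda>x. f x * f x) - integral {0..1} (\<lambda>x. f x * g (p x))" by (simp add: I_def gz)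
    also have "\<dots> = integral {0..1} (\<lambda>x. f x * f x - f x * g (p x))"
      by (rule integral_diff[symmetric]) (intro integrable_continuous_real continuous_intros fc gc)+
    also have "\<dots> \<le> integral {0..1} (\<lambda>x. e * \<bar>f x\<bar>)"
    proof (rule integral_le)
      show "(\<lambda>x. f x * f x - f x * g (p x)) integrable_on {0..1}" "(\<lambda>x. e * \<bar>f x\<bar>) integrable_on {0..1}"
        by (intro integrable_continuous_real continuous_intros fc gc)+
      fix x :: real assume x: "x \<in> {0..1}"
      have "p x \<in> sphere 0 1" using surj x by blast
      then have "\<bar>f x - g (p x)\<bar> < e" using g(2) ftp[OF x] by fastforce
      then have "\<bar>f x\<bar> * \<bar>f x - g (p x)\<bar> \<le> \<bar>f x\<bar> * e" by (intro mult_left_mono) auto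
      then show "f x * f x - f x * g (p x) \<le> e * \<bar>f x\<bar>"
        by (simp add: abs_mult[symmetric] right_diff_distrib abs_le_iff mult.commute)
    qed
    also have "\<dots> = e * M" by (simp add: M_def)
    finally show ?thesis .
  qed
  have "I \<le> 0"
  proof (rule field_le_epsilon)
    fix e :: real assume e: "e > 0"
    have "I \<le> e / (M + 1) * M" by (rule Ie) (use e M0 in simp)
    also have "\<dots> = e * (M / (M + 1))" by simp
    also have "\<dots> \<le> e * 1" using e M0 by (intro mult_left_mono) auto
    finally show "I \<le> 0 + e" by simp
  qed
  moreover have "I \<ge> 0" unfolding I_def by (intro integral_nonneg integrable_continuous_real continuous_intros fc) auto
  ultimately have "I = 0" by simp
  then have "\<forall>x\<in>{0..1}. f x * f x = 0"
    unfolding I_def by (subst (asm) integral_eq_0_iff) (auto intro!: continuous_intros fc)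
  then have f0: "f x = 0" if "x \<in> {0..1}" for x using that by auto
  have "frac x \<in> {0..1}" using frac_ge_0[of x] frac_lt_1[of x] by auto
  then show ?thesis using cper_int[OF f, of "frac x" "\<lfloor>x\<rfloor>"] f0[of "frac x"] by (simp add: frac_def)
qed

lemma cper_eqI:
  assumes "cper u" "cper v" "\<And>k. fcoeff u k = fcoeff v k"
  shows "u = v"
proof
  fix x
  have "u x - v x = 0"
    by (rule fourier_uniqueness[of "\<lambda>x. u x - v x"]) (use assms in \<open>auto simp: fcoeff_diff intro: cper_diff\<close>)
  then show "u x = v x" by simp
qed

lemma fcoeff_deriv:
  assumes u: "cper u" and d: "\<And>x. (u has_real_derivative u' x) (at x)" and u': "continuous_on UNIV u'"
  shows "cper u'" "fcoeff u' k = 2 * pi * \<i> * of_int k * fcoeff u k"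
proof -
  have "u' (x + 1) = u' x" for x
  proof -
    have "((\<lambda>x. u (x + 1)) has_real_derivative u' (x + 1)) (at x)"
      using DERIV_shift d by blast
    then have "(u has_real_derivative u' (x + 1)) (at x)" using cperD(1)[OF u] by simp
    then show ?thesis using d DERIV_unique by blast
  qed
  then show c: "cper u'" using u' by (simp add: cper_def periodic1_def)
  define G where "G x = complex_of_real (u x) * ek (- k) x" for x
  have "((\<lambda>x. of_real (u x) * (2 * pi * \<i> * of_int (- k) * ek (- k) x) + of_real (u' x) * ek (- k) x) has_integral (G 1 - G 0)) {0..1}"
  proof (rule fundamental_theorem_of_calculus)
    fix x :: real
    have "((\<lambda>x. complex_of_real (u x)) has_vector_derivative of_real (u' x)) (at x within {0..1})"
      using bounded_linear.has_vector_derivative[OF bounded_linear_of_real, of u "u' x" "at x within {0..1}"]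
        has_field_derivative_at_within[OF d[of x]]
      by (simp add: has_real_derivative_iff_has_vector_derivative)
    then show "(G has_vector_derivative of_real (u x) * (2 * pi * \<i> * of_int (- k) * ek (- k) x) + of_real (u' x) * ek (- k) x) (at x within {0..1})"
      unfolding G_def by (rule has_vector_derivative_mult[OF _ ek_deriv])
  qed simp
  moreover have "G 1 - G 0 = 0" using cperD(1)[OF u, of 0] by (simp add: G_def)
  ultimately have "0 = integral {0..1} (\<lambda>x. of_real (u x) * (2 * pi * \<i> * of_int (- k) * ek (- k) x) + of_real (u' x) * ek (- k) x)"
    by (simp add: integral_unique)
  also have "\<dots> = integral {0..1} (\<lambda>x. of_real (u x) * (2 * pi * \<i> * of_int (- k) * ek (- k) x)) + integral {0..1} (\<lambda>x. of_real (u' x) * ek (- k) x)"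
    by (intro integral_add integrable_continuous_real continuous_intros cperD[OF u] cperD[OF c])
  also have "integral {0..1} (\<lambda>x. of_real (u x) * (2 * pi * \<i> * of_int (- k) * ek (- k) x)) = (2 * pi * \<i> * of_int (- k)) * fcoeff u k"
    unfolding fcoeff_ek integral_mult_right[symmetric] by (simp add: mult_ac)
  finally show "fcoeff u' k = 2 * pi * \<i> * of_int k * fcoeff u k"
    unfolding fcoeff_ek[of u', symmetric] by (simp add: algebra_simps)
qed

text \<open>Vanishing mean is what makes a primitive periodic; the integration constant is fixed by
  asking for mean zero again.\<close>

lemma antiderivative_cper:
  assumes v: "cper v" and z: "mu v = 0"
  obtains w where "cper w" "\<And>x. (w has_real_derivative v x) (at x)" "mu w = 0"
proof -
  define W where "W x = (if x \<ge> 0 then integral {0..x} v else - integral {x..0} v)" for x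
  have W: "(W has_real_derivative v x) (at x)" for x
  proof -
    define m where "m = \<bar>x\<bar> + 1"
    have m: "- m < x" "x < m" "- m < 0" "0 < m" unfolding m_def by auto
    have int: "v integrable_on {a..b}" for a b by (intro integrable_continuous_real cperD[OF v])
    have eq: "W y = integral {-m..y} v - integral {-m..0} v" if "y \<in> {-m..m}" for y
    proof (cases "y \<ge> 0")
      case True
      then show ?thesis using Henstock_Kurzweil_Integration.integral_combine[of "-m" 0 y v] m int by (simp add: W_def)
    next
      case False
      then show ?thesis using Henstock_Kurzweil_Integration.integral_combine[of "-m" y 0 v] m int that by (simp add: W_def)
    qed
    have "((\<lambda>y. integral {-m..y} v) has_real_derivative v x) (at x within {-m..m})"
      by (rule integral_has_real_derivative) (use m in \<open>auto intro: cperD(2)[OF v]\<close>)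
    then have "((\<lambda>y. integral {-m..y} v) has_real_derivative v x) (at x)"
      using at_within_Icc_at[OF m(1,2)] by simp
    then have "((\<lambda>y. integral {-m..y} v - integral {-m..0} v) has_real_derivative v x) (at x)"
      by (auto intro!: derivative_eq_intros)
    then show ?thesis
    proof (rule has_field_derivative_transform_within_open[of _ _ _ "{-m<..<m}"])
      show "x \<in> {-m<..<m}" using m by simp
      show "integral {-m..y} v - integral {-m..0} v = W y" if "y \<in> {-m<..<m}" for y
        using eq[of y] that by simp
    qed simp
  qed
  have Wc: "continuous_on UNIV W" using W by (intro DERIV_continuous_on) auto
  have "W (x + 1) = W x" for x
  proof -
    have "((\<lambda>x. W (x + 1) - W x) has_real_derivative 0) (at x)" for x
    proof -
      have "((\<lambda>x. W (x + 1)) has_real_derivative v (x + 1)) (at x)" using DERIV_shift W by blast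
      then have "((\<lambda>x. W (x + 1) - W x) has_real_derivative v (x + 1) - v x) (at x)" by (intro DERIV_diff W)
      then show ?thesis using cperD(1)[OF v] by simp
    qed
    then have "W (x + 1) - W x = W (0 + 1) - W 0" using DERIV_isconst_all[of "\<lambda>x. W (x + 1) - W x"] by blast
    also have "\<dots> = 0" using z by (simp add: W_def mu_def)
    finally show ?thesis by simp
  qed
  then have Wp: "cper W" using Wc by (simp add: cper_def periodic1_def)
  show ?thesis
  proof (rule that[of "\<lambda>x. W x - mu W"])
    show "cper (\<lambda>x. W x - mu W)" by (intro cper_intros Wp)
    show "((\<lambda>x. W x - mu W) has_real_derivative v x) (at x)" for x
      using W by (auto intro!: derivative_eq_intros)
    have "W integrable_on {0..1}" by (intro integrable_continuous_real cperD[OF Wp])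
    then show "mu (\<lambda>x. W x - mu W) = 0" unfolding mu_def by (subst integral_diff) auto
  qed
qed

text \<open>The squared L^2 distance from \<open>u\<close> to its partial Fourier sum
  \<open>P\<close> is nonnegative; the pairing of \<open>u\<close> with \<open>P\<close> and the
  squared norm of \<open>P\<close> both equal the sum on the left.\<close>

lemma bessel:
  assumes u: "cper u" and S: "finite S"
  shows "(\<Sum>k\<in>S. (cmod (fcoeff u k))\<^sup>2) \<le> integral {0..1} (\<lambda>x. (u x)\<^sup>2)"
proof -
  define c where "c = fcoeff u"
  define P where "P x = (\<Sum>k\<in>S. c k * ek k x)" for x
  have Pc: "continuous_on {0..1} P" unfolding P_def by (intro continuous_intros)
  have uc: "continuous_on {0..1} u" by (rule cperD[OF u])
  have up: "integral {0..1} (\<lambda>x. of_real (u x) * cnj (P x)) = of_real (\<Sum>k\<in>S. (cmod (c k))\<^sup>2)"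
  proof -
    have "integral {0..1} (\<lambda>x. of_real (u x) * cnj (P x)) = integral {0..1} (\<lambda>x. \<Sum>k\<in>S. cnj (c k) * (of_real (u x) * ek (- k) x))"
      unfolding P_def by (simp add: sum_distrib_left cnj_ek mult_ac)
    also have "\<dots> = (\<Sum>k\<in>S. integral {0..1} (\<lambda>x. cnj (c k) * (of_real (u x) * ek (- k) x)))"
      by (rule integral_sum[OF S]) (intro integrable_continuous_real continuous_intros uc)
    also have "\<dots> = (\<Sum>k\<in>S. cnj (c k) * c k)" by (simp add: c_def fcoeff_ek)
    also have "\<dots> = of_real (\<Sum>k\<in>S. (cmod (c k))\<^sup>2)"
      unfolding of_real_sum complex_norm_square by (simp add: mult.commute)
    finally show ?thesis .
  qed
  have pp: "integral {0..1} (\<lambda>x. P x * cnj (P x)) = of_real (\<Sum>k\<in>S. (cmod (c k))\<^sup>2)"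
  proof -
    have "integral {0..1} (\<lambda>x. P x * cnj (P x)) = integral {0..1} (\<lambda>x. \<Sum>k\<in>S. \<Sum>l\<in>S. c k * cnj (c l) * ek (k - l) x)"
    proof -
      have "P x * cnj (P x) = (\<Sum>k\<in>S. \<Sum>l\<in>S. c k * cnj (c l) * ek (k - l) x)" for x
        unfolding P_def cnj_sum sum_product
        using ek_add[of _ "- _" x] by (intro sum.cong refl) (simp add: cnj_ek ek_add[of k "- l" x for k l, simplified])
      then show ?thesis by simp
    qed
    also have "\<dots> = (\<Sum>k\<in>S. \<Sum>l\<in>S. integral {0..1} (\<lambda>x. c k * cnj (c l) * ek (k - l) x))"
      by (subst integral_sum[OF S], (intro integrable_continuous_real continuous_intros)[1])
         (intro sum.cong refl integral_sum[OF S] integrable_continuous_real continuous_intros)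
    also have "\<dots> = (\<Sum>k\<in>S. \<Sum>l\<in>S. if l = k then c k * cnj (c l) else 0)"
      by (intro sum.cong refl) (simp add: integral_ek)
    also have "\<dots> = of_real (\<Sum>k\<in>S. (cmod (c k))\<^sup>2)"
      using S unfolding of_real_sum complex_norm_square by simp
    finally show ?thesis .
  qed
  have "0 \<le> integral {0..1} (\<lambda>x. (cmod (of_real (u x) - P x))\<^sup>2)"
    by (intro integral_nonneg integrable_continuous_real continuous_intros uc Pc) auto
  also have "(\<lambda>x. (cmod (of_real (u x) - P x))\<^sup>2) = (\<lambda>x. (u x)\<^sup>2 - 2 * Re (of_real (u x) * cnj (P x)) + Re (P x * cnj (P x)))"
    unfolding cmod_power2 by (simp add: fun_eq_iff power2_eq_square algebra_simps)
  also have "integral {0..1} \<dots> = integral {0..1} (\<lambda>x. (u x)\<^sup>2) - 2 * Re (integral {0..1} (\<lambda>x. of_real (u x) * cnj (P x))) + Re (integral {0..1} (\<lambda>x. P x * cnj (P x)))"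
  proof -
    have i: "(\<lambda>x. of_real (u x) * cnj (P x)) integrable_on {0..1}" "(\<lambda>x. P x * cnj (P x)) integrable_on {0..1}"
      by (intro integrable_continuous_real continuous_intros uc Pc)+
    have r: "integral {0..1} (\<lambda>x. Re (of_real (u x) * cnj (P x))) = Re (integral {0..1} (\<lambda>x. of_real (u x) * cnj (P x)))"
      "integral {0..1} (\<lambda>x. Re (P x * cnj (P x))) = Re (integral {0..1} (\<lambda>x. P x * cnj (P x)))"
      using integral_linear[OF i(1) bounded_linear_Re] integral_linear[OF i(2) bounded_linear_Re] by (simp_all add: o_def)
    have "integral {0..1} (\<lambda>x. (u x)\<^sup>2 - 2 * Re (of_real (u x) * cnj (P x)) + Re (P x * cnj (P x)))
      = integral {0..1} (\<lambda>x. (u x)\<^sup>2 - 2 * Re (of_real (u x) * cnj (P x))) + integral {0..1} (\<lambda>x. Re (P x * cnj (P x)))"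
      by (rule integral_add) (intro integrable_continuous_real continuous_intros uc Pc)+
    also have "integral {0..1} (\<lambda>x. (u x)\<^sup>2 - 2 * Re (of_real (u x) * cnj (P x))) = integral {0..1} (\<lambda>x. (u x)\<^sup>2) - integral {0..1} (\<lambda>x. 2 * Re (of_real (u x) * cnj (P x)))"
      by (rule integral_diff) (intro integrable_continuous_real continuous_intros uc Pc)+
    finally show ?thesis using r by simp
  qed
  finally show ?thesis unfolding up pp by (simp add: c_def)
qed

subsection \<open>Synthesis from absolutely summable coefficients\<close>

abbreviation asum :: "(int \<Rightarrow> complex) \<Rightarrow> bool" where
  "asum a \<equiv> (\<lambda>k. norm (a k)) summable_on UNIV"

definition cs :: "(int \<Rightarrow> complex) \<Rightarrow> real \<Rightarrow> complex" where
  "cs a x = infsum (\<lambda>k. a k * ek k x) UNIV"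

text \<open>The real part makes the function real for every sequence; under \<open>symm\<close> the
  imaginary part vanishes anyway, by \<open>of_real_syn\<close>.\<close>

definition syn :: "(int \<Rightarrow> complex) \<Rightarrow> real \<Rightarrow> real" where
  "syn a x = Re (cs a x)"

lemma cs_has_sum:
  assumes "asum a"
  shows "((\<lambda>k. a k * ek k x) has_sum cs a x) UNIV"
  unfolding cs_def
  by (rule has_sum_infsum, rule abs_summable_summable) (use assms in \<open>simp add: norm_mult\<close>)

lemma cs_uniform:
  assumes "asum a"
  shows "uniform_limit UNIV (\<lambda>X x. \<Sum>k\<in>X. a k * ek k x) (cs a) (finite_subsets_at_top UNIV)"
  by (rule Weierstrass_m_test_general'[OF _ cs_has_sum[OF assms] assms]) (simp add: norm_mult)

lemma cs_continuous:
  assumes "asum a"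
  shows "continuous_on A (cs a)"
proof -
  have "continuous_on UNIV (cs a)"
    by (rule uniform_limit_theorem[OF _ cs_uniform[OF assms]]) (auto intro!: always_eventually continuous_intros)
  then show ?thesis by (rule continuous_on_subset) auto
qed

lemma integral_cs:
  assumes a: "asum a" and g: "continuous_on {0..1} g"
  shows "((\<lambda>k. a k * integral {0..1} (\<lambda>x. ek k x * g x)) has_sum integral {0..1} (\<lambda>x. cs a x * g x)) UNIV"
proof -
  have "bounded (g ` {0..1})" by (intro compact_imp_bounded compact_continuous_image g) auto
  then obtain B where B: "\<forall>x\<in>{0..1}. norm (g x) \<le> B" unfolding bounded_iff by auto
  have "uniform_limit {0..1} (\<lambda>X x. \<Sum>k\<in>X. a k * ek k x * g x) (\<lambda>x. cs a x * g x) (finite_subsets_at_top UNIV)"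
  proof (rule Weierstrass_m_test_general'[where M = "\<lambda>k. norm (a k) * B"])
    show "norm (a k * ek k x * g x) \<le> norm (a k) * B" if "x \<in> {0..1}" for k x
      using B that by (simp add: norm_mult mult_left_mono)
    show "((\<lambda>k. a k * ek k x * g x) has_sum cs a x * g x) UNIV" for x
      by (rule has_sum_cmult_left[OF cs_has_sum[OF a]])
    show "(\<lambda>k. norm (a k) * B) summable_on UNIV" by (rule summable_on_cmult_left[OF a])
  qed
  then obtain I J where IJ: "\<And>X. ((\<lambda>x. \<Sum>k\<in>X. a k * ek k x * g x) has_integral I X) {0..1}"
    "((\<lambda>x. cs a x * g x) has_integral J) {0..1}" "(I \<longlongrightarrow> J) (finite_subsets_at_top UNIV)"
    by (rule uniform_limit_integral) (auto intro!: continuous_intros g)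
  have "I X = (\<Sum>k\<in>X. a k * integral {0..1} (\<lambda>x. ek k x * g x))" for X
  proof (cases "finite X")
    case True
    have "I X = integral {0..1} (\<lambda>x. \<Sum>k\<in>X. a k * ek k x * g x)" by (rule integral_unique[symmetric, OF IJ(1)])
    also have "\<dots> = (\<Sum>k\<in>X. integral {0..1} (\<lambda>x. a k * ek k x * g x))"
      by (rule integral_sum[OF True]) (intro integrable_continuous_real continuous_intros g)
    finally show ?thesis by (simp add: mult.assoc)
  next
    \<comment> \<open>Over an infinite index set the sum is 0 by convention, and so is its
      integral.\<close>
    case False
    then show ?thesis using IJ(1)[of X] by (simp add: has_integral_0_eq)
  qed
  then have "I = (\<lambda>X. \<Sum>k\<in>X. a k * integral {0..1} (\<lambda>x. ek k x * g x))" by blast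
  then show ?thesis using IJ(2,3) by (simp add: has_sum_def integral_unique)
qed

lemma cs_coeff:
  assumes a: "asum a"
  shows "integral {0..1} (\<lambda>x. cs a x * ek (- k) x) = a k"
proof -
  have 1: "((\<lambda>j. a j * integral {0..1} (\<lambda>x. ek j x * ek (- k) x)) has_sum integral {0..1} (\<lambda>x. cs a x * ek (- k) x)) UNIV"
    by (rule integral_cs[OF a]) (intro continuous_intros)
  have 2: "(\<lambda>j. a j * integral {0..1} (\<lambda>x. ek j x * ek (- k) x)) = (\<lambda>j. if j = k then a k else 0)"
  proof
    fix j
    have "(\<lambda>x. ek j x * ek (- k) x) = ek (j - k)" using ek_add[of j "- k"] by (simp add: fun_eq_iff)
    then show "a j * integral {0..1} (\<lambda>x. ek j x * ek (- k) x) = (if j = k then a k else 0)"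
      by (simp add: integral_ek)
  qed
  have "((\<lambda>j. if j = k then a k else 0) has_sum a k) UNIV"
    using has_sum_finite_neutralI[of "{k}" UNIV "\<lambda>j. if j = k then a k else 0"] by simp
  with 1 show ?thesis unfolding 2 by (rule has_sum_unique)
qed

lemma of_real_syn:
  assumes a: "asum a" and s: "symm a"
  shows "of_real (syn a x) = cs a x"
proof -
  have "((\<lambda>k. cnj (a k * ek k x)) has_sum cnj (cs a x)) UNIV"
    using cs_has_sum[OF a, of x] by (simp only: has_sum_cnj_iff)
  then have "((\<lambda>k. a (- k) * ek (- k) x) has_sum cnj (cs a x)) UNIV"
    by (simp add: cnj_ek symmD[OF s])
  then have "((\<lambda>k. a k * ek k x) has_sum cnj (cs a x)) UNIV"
    using has_sum_reindex_bij_witness[of UNIV uminus uminus UNIV "\<lambda>k. a k * ek k x" "\<lambda>k. a (- k) * ek (- k) x"] by simp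
  then have "cnj (cs a x) = cs a x" using has_sum_unique cs_has_sum[OF a] by blast
  then show ?thesis unfolding syn_def by (metis Reals_cnj_iff of_real_Re)
qed

lemma syn_cper:
  assumes a: "asum a"
  shows "cper (syn a)"
proof -
  have "continuous_on UNIV (syn a)" unfolding syn_def by (intro continuous_intros cs_continuous a)
  then show ?thesis by (simp add: cper_def periodic1_def syn_def cs_def ek_periodic)
qed

lemma fcoeff_syn:
  assumes "asum a" "symm a"
  shows "fcoeff (syn a) k = a k"
  unfolding fcoeff_ek of_real_syn[OF assms] by (rule cs_coeff[OF assms(1)])

lemma cper_eq_syn:
  assumes "cper u" "asum (fcoeff u)"
  shows "u = syn (fcoeff u)"
  using assms by (intro cper_eqI syn_cper) (simp_all add: fcoeff_syn symm_fcoeff)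

text \<open>The absolutely convergent series of \<open>u\<close> is inserted and integrated term by
  term; \<open>v\<close> enters through integrals only and may be merely continuous.\<close>

lemma fcoeff_mult:
  assumes u: "cper u" "asum (fcoeff u)" and v: "cper v"
  shows "((\<lambda>j. fcoeff u j * fcoeff v (k - j)) has_sum fcoeff (\<lambda>x. u x * v x) k) UNIV"
proof -
  have ux: "complex_of_real (u x) = cs (fcoeff u) x" for x
    using of_real_syn[OF u(2) symm_fcoeff, of x] cper_eq_syn[OF u] by simp
  have "((\<lambda>j. fcoeff u j * integral {0..1} (\<lambda>x. ek j x * (of_real (v x) * ek (- k) x))) has_sum
      integral {0..1} (\<lambda>x. cs (fcoeff u) x * (of_real (v x) * ek (- k) x))) UNIV"
    by (rule integral_cs[OF u(2)]) (intro continuous_intros cperD[OF v])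
  moreover have "integral {0..1} (\<lambda>x. ek j x * (of_real (v x) * ek (- k) x)) = fcoeff v (k - j)" for j
    unfolding fcoeff_ek using ek_add[of j "- k"] by (simp add: mult_ac)
  moreover have "integral {0..1} (\<lambda>x. cs (fcoeff u) x * (of_real (v x) * ek (- k) x)) = fcoeff (\<lambda>x. u x * v x) k"
    unfolding fcoeff_ek ux[symmetric] by (simp add: mult.assoc)
  ultimately show ?thesis by simp
qed

text \<open>The series is not differentiated. Its formal derivative converges uniformly to a
  function of mean zero, whose periodic primitive has the coefficients of \<open>u\<close> up to the
  mean and so is \<open>u\<close> up to a constant by uniqueness.\<close>

lemma cper_deriv_exists:
  assumes u: "cper u" and b: "asum (\<lambda>k. 2 * pi * \<i> * of_int k * fcoeff u k)"
  shows "(u has_real_derivative deriv u x) (at x)" "cper (deriv u)"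
    "fcoeff (deriv u) k = 2 * pi * \<i> * of_int k * fcoeff u k"
    "deriv u = syn (\<lambda>k. 2 * pi * \<i> * of_int k * fcoeff u k)"
proof -
  define b where "b = (\<lambda>k. 2 * pi * \<i> * of_int k * fcoeff u k)"
  have bs: "symm b" unfolding symm_def b_def using symmD[OF symm_fcoeff, of u] by simp
  define v where "v = syn b"
  have v: "cper v" "fcoeff v k = b k" for k
    unfolding v_def using b bs by (auto simp only: b_def intro!: syn_cper fcoeff_syn)
  have "mu v = 0" using fcoeff_0[OF v(1)] v(2)[of 0] by (simp add: b_def)
  then obtain w where w: "cper w" "\<And>x. (w has_real_derivative v x) (at x)" "mu w = 0"
    using antiderivative_cper[OF v(1)] by blast
  have "u = (\<lambda>x. w x + mu u)"
  proof (rule cper_eqI[OF u])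
    show "cper (\<lambda>x. w x + mu u)" by (intro cper_intros w)
    fix k
    have "fcoeff (\<lambda>x. w x + mu u) k = fcoeff w k + (if k = 0 then of_real (mu u) else 0)"
      using fcoeff_add[OF w(1) cper_const] by (simp add: fcoeff_const)
    also have "\<dots> = fcoeff u k"
    proof (cases "k = 0")
      case True
      then show ?thesis using w fcoeff_0[OF u] fcoeff_0[OF w(1)] by simp
    next
      case False
      have "b k = 2 * pi * \<i> * of_int k * fcoeff w k"
        using fcoeff_deriv(2)[OF w(1,2) cperD(2)[OF v(1)], of k] v(2) by simp
      then show ?thesis using False by (simp add: b_def)
    qed
    finally show "fcoeff u k = fcoeff (\<lambda>x. w x + mu u) k" by simp
  qed
  moreover have "((\<lambda>x. w x + mu u) has_real_derivative v x) (at x)" for x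
    using w(2) by (auto intro!: derivative_eq_intros)
  ultimately have "(u has_real_derivative v x) (at x)" for x by metis
  then have "(u has_real_derivative v x) (at x)" "deriv u = v" for x
    by (auto intro!: DERIV_imp_deriv)
  then show "(u has_real_derivative deriv u x) (at x)" "cper (deriv u)"
    "fcoeff (deriv u) k = 2 * pi * \<i> * of_int k * fcoeff u k"
    "deriv u = syn (\<lambda>k. 2 * pi * \<i> * of_int k * fcoeff u k)"
    using v by (auto simp: b_def v_def)
qed

subsection \<open>The inverse of the inertia operator\<close>

text \<open>A derivative of a periodic function has mean zero, so A w = f' forces
  \<open>mu w = 0\<close>, and one integration leaves w' = \<open>mu f\<close> - f. Continuous
  differentiability of \<open>f\<close> makes \<open>w\<close> a \<open>C2\<close> function, as the
  description in \<open>opA_inv\<close> asks.\<close>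

lemma opA_inv_deriv:
  assumes f: "cper f" and d: "\<And>x. (f has_real_derivative f' x) (at x)" and f': "continuous_on UNIV f'"
  defines "w \<equiv> opA_inv (deriv f)"
  shows "cper w" "(w has_real_derivative mu f - f x) (at x)" "fcoeff w k = \<i> * fcoeff f k / (2 * pi * of_int k)"
proof -
  have df: "deriv f = f'" using d by (auto intro!: DERIV_imp_deriv)
  have "mu (\<lambda>x. mu f - f x) = 0"
  proof -
    have "f integrable_on {0..1}" by (intro integrable_continuous_real cperD[OF f])
    then show ?thesis unfolding mu_def by (subst integral_diff) auto
  qed
  then obtain z where z: "cper z" "\<And>x. (z has_real_derivative mu f - f x) (at x)" "mu z = 0"
    using antiderivative_cper[OF cper_diff[OF cper_const f]] by blast
  have dz: "deriv z = (\<lambda>x. mu f - f x)" using z(2) by (auto intro!: DERIV_imp_deriv)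
  have d2: "((\<lambda>x. mu f - f x) has_real_derivative - f' x) (at x)" for x
    using d by (auto intro!: derivative_eq_intros)
  have ddz: "deriv (deriv z) = (\<lambda>x. - f' x)" unfolding dz using d2 by (auto intro!: DERIV_imp_deriv)
  have "opA_inv (deriv f) = z"
    unfolding opA_inv_def df
  proof (rule the_equality)
    show "periodic1 z \<and> C2 z \<and> (\<forall>x. opA z x = f' x)"
    proof (intro conjI allI)
      show "periodic1 z" using z(1) by (simp add: cper_def)
      show "C2 z" unfolding C2_def ddz using z(2) d2 f' by (auto simp: dz intro!: continuous_intros)
      show "opA z x = f' x" for x by (simp add: opA_def ddz z(3))
    qed
    \<comment> \<open>Uniqueness: taking coefficients in A y = f' determines the nonzero modes of
      \<open>y\<close>, and mode 0 gives mean zero.\<close>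
    fix y assume y: "periodic1 y \<and> C2 y \<and> (\<forall>x. opA y x = f' x)"
    have y1: "(y has_real_derivative deriv y x) (at x)" "(deriv y has_real_derivative deriv (deriv y) x) (at x)"
      and y2: "continuous_on UNIV (deriv (deriv y))" for x using y by (auto simp: C2_def)
    have yc: "cper y" using y y1(1) by (auto simp: cper_def intro!: DERIV_continuous_on)
    have y1c: "continuous_on UNIV (deriv y)" using y1(2) by (intro DERIV_continuous_on) auto
    note yd = fcoeff_deriv[OF yc y1(1) y1c]
    note ydd = fcoeff_deriv[OF yd(1) y1(2) y2]
    have f'y: "f' = (\<lambda>x. mu y - deriv (deriv y) x)" using y by (auto simp: opA_def)
    have co: "fcoeff f' k = (if k = 0 then of_real (mu y) else 0) + (2 * pi * of_int k)\<^sup>2 * fcoeff y k" for k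
      unfolding f'y fcoeff_diff[OF cper_const ydd(1)] fcoeff_const ydd(2) yd(2)
      by (simp add: power2_eq_square algebra_simps)
    have f0: "fcoeff f' 0 = 0" using fcoeff_deriv(2)[OF f d f', of 0] by simp
    have muy: "mu y = 0" using co[of 0] f0 by simp
    show "y = z"
    proof (rule cper_eqI[OF yc z(1)])
      fix k
      have zc: "continuous_on UNIV (\<lambda>x. mu f - f x)" by (intro continuous_intros cperD[OF f])
      have "fcoeff (\<lambda>x. - f' x) k = 2 * pi * \<i> * of_int k * (2 * pi * \<i> * of_int k * fcoeff z k)"
        using fcoeff_deriv[OF fcoeff_deriv(1)[OF z(1,2) zc] d2] f' fcoeff_deriv(2)[OF z(1,2) zc]
        by (simp add: continuous_on_minus)
      moreover have "fcoeff (\<lambda>x. - f' x) k = - fcoeff f' k" using fcoeff_cmult[of "-1" f' k] by simp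
      ultimately have "fcoeff f' k = (2 * pi * of_int k)\<^sup>2 * fcoeff z k"
        by (simp add: power2_eq_square algebra_simps minus_equation_iff)
      then show "fcoeff y k = fcoeff z k"
        using co[of k] muy fcoeff_0[OF yc] fcoeff_0[OF z(1)] z(3) by (cases "k = 0") auto
    qed
  qed
  then have w: "w = z" by (simp add: w_def)
  show "cper w" "(w has_real_derivative mu f - f x) (at x)" using w z by auto
  show "fcoeff w k = \<i> * fcoeff f k / (2 * pi * of_int k)"
  proof (cases "k = 0")
    \<comment> \<open>In mode 0 division by zero gives 0, in agreement with the mean of
      \<open>w\<close>.\<close>
    case True then show ?thesis using w z(3) fcoeff_0[OF z(1)] by simp
  next
    case False
    have zc: "continuous_on UNIV (\<lambda>x. mu f - f x)" by (intro continuous_intros cperD[OF f])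
    have "fcoeff (\<lambda>x. mu f - f x) k = 2 * pi * \<i> * of_int k * fcoeff z k" by (rule fcoeff_deriv(2)[OF z(1,2) zc])
    then have "- fcoeff f k = 2 * pi * \<i> * of_int k * fcoeff z k"
      using False fcoeff_diff[OF cper_const f, of "mu f" k] by (simp add: fcoeff_const)
    then have "fcoeff f k = - (2 * pi * \<i> * of_int k * fcoeff z k)" by (metis add.inverse_inverse)
    then show ?thesis using False w by simp
  qed
qed

subsection \<open>Sobolev functions and their coefficients\<close>

lemma Hs_weight_eq: "Hs_weight s u k = (jb k powr s * cmod (fcoeff u k))\<^sup>2"
proof -
  have "(1 + (2 * pi * of_int k)\<^sup>2) powr s = ((jb k)\<^sup>2) powr s" by (simp add: jb_sq)
  also have "\<dots> = (jb k powr s)\<^sup>2"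
    using jb_pos[of k] by (simp add: power2_eq_square powr_mult)
  finally show ?thesis by (simp add: Hs_weight_def power_mult_distrib)
qed

lemma in_Hs_hsb:
  assumes "in_Hs s u"
  shows "cper u" "hsb s (Hs_norm s u) (fcoeff u)" "Hs_norm s u \<ge> 0"
proof -
  have sm: "(\<lambda>k. (jb k powr s * cmod (fcoeff u k))\<^sup>2) summable_on UNIV"
    using assms unfolding in_Hs_def Hs_weight_eq[abs_def] by simp
  show "cper u" using assms by (auto simp: in_Hs_def cper_def)
  have n: "(Hs_norm s u)\<^sup>2 = infsum (\<lambda>k. (jb k powr s * cmod (fcoeff u k))\<^sup>2) UNIV"
    unfolding Hs_norm_def Hs_weight_eq[abs_def] by (intro real_sqrt_pow2 infsum_nonneg) simp
  show "hsb s (Hs_norm s u) (fcoeff u)"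
    unfolding hsb_def n by (auto intro!: finite_sum_le_infsum sm)
  show "Hs_norm s u \<ge> 0" unfolding Hs_norm_def by (simp add: infsum_nonneg Hs_weight_def)
qed

lemma hsb_in_Hs:
  assumes "cper u" "hsb s R (fcoeff u)" "R \<ge> 0"
  shows "in_Hs s u" "Hs_norm s u \<le> R"
proof -
  have sm: "(\<lambda>k. (jb k powr s * cmod (fcoeff u k))\<^sup>2) summable_on UNIV"
    using hsbD[OF assms(2)] by (intro nonneg_bdd_above_summable_on bdd_aboveI[of _ "R\<^sup>2"]) auto
  then show "in_Hs s u" using assms(1) unfolding in_Hs_def Hs_weight_eq[abs_def] by (simp add: cper_def)
  have "infsum (\<lambda>k. (jb k powr s * cmod (fcoeff u k))\<^sup>2) UNIV \<le> R\<^sup>2"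
    using hsbD[OF assms(2)] by (intro infsum_le_finite_sums sm) auto
  then show "Hs_norm s u \<le> R"
    unfolding Hs_norm_def Hs_weight_eq[abs_def] using assms(3) by (simp add: real_le_lsqrt)
qed

lemma hsb_scaled_sum:
  assumes a: "hsb s R a" "R \<ge> 0" "s - p > 1/2" and c: "\<And>k. cmod (c k) \<le> C * jb k powr p" "C \<ge> 0" and F: "finite F"
  shows "(\<Sum>k\<in>F. cmod (c k * a k)) \<le> C * (zt (s - p) * R)"
proof -
  have "(\<Sum>k\<in>F. cmod (c k * a k)) \<le> (\<Sum>k\<in>F. C * (jb k powr p * cmod (a k)))"
    unfolding norm_mult mult.assoc[symmetric] by (intro sum_mono mult_right_mono c) auto
  also have "\<dots> \<le> C * (zt (s - p) * R)"
    unfolding sum_distrib_left[symmetric] by (intro mult_left_mono hsb_l1[OF a(1,2,3) F] c)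
  finally show ?thesis .
qed

lemma asum_hsb:
  assumes "hsb s R a" "R \<ge> 0" "s - p > 1/2" "\<And>k. cmod (c k) \<le> C * jb k powr p" "C \<ge> 0"
  shows "asum (\<lambda>k. c k * a k)"
  by (rule abs_summable_bounded(1)[OF hsb_scaled_sum[OF assms]])

lemma dcoef_bound: "cmod (2 * pi * \<i> * of_int k) \<le> 1 * jb k powr 1"
  using jb_ge[of k] jb_nonneg[of k] by (simp add: norm_mult)

lemma d2coef_bound: "cmod (2 * pi * \<i> * of_int k * (2 * pi * \<i> * of_int k)) \<le> 1 * jb k powr 2"
proof -
  have "cmod (2 * pi * \<i> * of_int k * (2 * pi * \<i> * of_int k)) \<le> jb k * jb k"
    unfolding norm_mult[of "2 * pi * \<i> * of_int k"] using dcoef_bound[of k] jb_nonneg[of k]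
    by (intro mult_mono) auto
  also have "jb k * jb k = jb k powr 2" using jb_pos[of k] by (simp add: powr_numeral power2_eq_square)
  finally show ?thesis by simp
qed

lemma asum_0: "hsb s R a \<Longrightarrow> R \<ge> 0 \<Longrightarrow> s > 1/2 \<Longrightarrow> asum a"
  using asum_hsb[of s R a 0 "\<lambda>k. 1" 1] jb_powr_ge1[of 0] by simp

text \<open>The rate is uniform in \<open>x\<close> and on Sobolev balls, so along a solution the
  truncated series converge uniformly in space and time.\<close>

lemma cs_tail:
  assumes a: "hsb s R a" "R \<ge> 0" and c: "\<And>k. cmod (c k) \<le> 1 * jb k powr p"
    and q: "q \<ge> 0" "s - p - q > 1/2" and n: "n \<ge> 1"
  shows "cmod ((\<Sum>k\<in>freqs n. c k * a k * ek k x) - cs (\<lambda>k. c k * a k) x) \<le> real n powr (- q) * (zt (s - p - q) * R)"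
proof -
  define h where "h k = (if k \<in> freqs n then 0 else c k * a k * ek k x)" for k
  have "(\<Sum>k\<in>F. cmod (h k)) \<le> real n powr (- q) * (zt (s - p - q) * R)" if F: "finite F" for F
  proof -
    have "(\<Sum>k\<in>F. cmod (h k)) = (\<Sum>k\<in>F - freqs n. cmod (c k * a k * ek k x))"
      using F by (intro sum.mono_neutral_cong_right) (auto simp: h_def)
    also have "\<dots> \<le> (\<Sum>k\<in>F - freqs n. jb k powr p * cmod (a k))"
      using c by (intro sum_mono) (auto simp: norm_mult intro!: mult_right_mono)
    also have "\<dots> \<le> real n powr (- q) * (zt (s - p - q) * R)"
      by (rule hsb_tail[OF a q _ n]) (use F not_in_freqs in auto)
    finally show ?thesis .
  qed
  note 1 = abs_summable_bounded(2,3)[OF this, where A = UNIV]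
  have as: "asum (\<lambda>k. c k * a k)" by (rule asum_hsb[OF a _ c]) (use q in auto)
  have "(h has_sum infsum h UNIV) UNIV" using 1(1) by (rule has_sum_infsum)
  moreover have "((\<lambda>k. if k \<in> freqs n then c k * a k * ek k x else 0) has_sum (\<Sum>k\<in>freqs n. c k * a k * ek k x)) UNIV"
    by (rule has_sum_finite_neutralI[of "freqs n"]) auto
  ultimately have "((\<lambda>k. h k + (if k \<in> freqs n then c k * a k * ek k x else 0)) has_sum (infsum h UNIV + (\<Sum>k\<in>freqs n. c k * a k * ek k x))) UNIV"
    by (rule has_sum_add)
  then have "((\<lambda>k. c k * a k * ek k x) has_sum (infsum h UNIV + (\<Sum>k\<in>freqs n. c k * a k * ek k x))) UNIV"
    by (rule has_sum_cong[THEN iffD1, rotated]) (auto simp: h_def)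
  then have "cs (\<lambda>k. c k * a k) x = infsum h UNIV + (\<Sum>k\<in>freqs n. c k * a k * ek k x)"
    using cs_has_sum[OF as, of x] has_sum_unique by blast
  then have "(\<Sum>k\<in>freqs n. c k * a k * ek k x) - cs (\<lambda>k. c k * a k) x = - infsum h UNIV" by simp
  then show ?thesis using 1(2) by simp
qed

subsection \<open>The nonlinearity loses one derivative\<close>

text \<open>\<open>18 * 2 powr s\<close> is the constant of \<open>weight_gam\<close>; the further 2
  comes from its two terms, through the square of a sum.\<close>

definition cq :: "real \<Rightarrow> real" where "cq s = 2 * (18 * 2 powr s) * zt (s - 1)"

lemma cq_nonneg: "cq s \<ge> 0" by (simp add: cq_def zt_nonneg)

text \<open>Young's inequality for the convolution of l^1 with l^2, with the l^1 factor in either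
  place.\<close>

lemma young_finite:
  fixes f g :: "int \<Rightarrow> real"
  assumes f: "\<And>j. f j \<ge> 0" "\<And>F. finite F \<Longrightarrow> (\<Sum>j\<in>F. f j) \<le> A"
    and g: "\<And>F. finite F \<Longrightarrow> (\<Sum>j\<in>F. (g j)\<^sup>2) \<le> B\<^sup>2" and S: "finite S" and F: "finite F"
  shows "(\<Sum>k\<in>S. (\<Sum>j\<in>F. f j * g (k - j))\<^sup>2) \<le> A\<^sup>2 * B\<^sup>2"
    "(\<Sum>k\<in>S. (\<Sum>j\<in>F. g j * f (k - j))\<^sup>2) \<le> A\<^sup>2 * B\<^sup>2"
proof -
  have A0: "A \<ge> 0" using f(2)[of "{}"] by simp
  have re: "(\<Sum>j\<in>G. f (k - j)) \<le> A" if "finite G" for G k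
  proof -
    have "(\<Sum>j\<in>G. f (k - j)) = (\<Sum>j\<in>(\<lambda>j. k - j) ` G. f j)" by (subst sum.reindex) (auto simp: inj_on_def)
    then show ?thesis using f(2)[of "(\<lambda>j. k - j) ` G"] that by simp
  qed
  have re': "(\<Sum>k\<in>G. f (k - j)) \<le> A" "(\<Sum>k\<in>G. (g (k - j))\<^sup>2) \<le> B\<^sup>2" if "finite G" for G j
  proof -
    have "(\<Sum>k\<in>G. h (k - j)) = (\<Sum>k\<in>(\<lambda>k. k - j) ` G. h k)" for h :: "int \<Rightarrow> real"
      by (subst sum.reindex) (auto simp: inj_on_def)
    note r = this
    show "(\<Sum>k\<in>G. f (k - j)) \<le> A" using r[of f] f(2)[of "(\<lambda>k. k - j) ` G"] that by simp
    show "(\<Sum>k\<in>G. (g (k - j))\<^sup>2) \<le> B\<^sup>2" using r[of "\<lambda>k. (g k)\<^sup>2"] g[of "(\<lambda>k. k - j) ` G"] that by simp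
  qed
  have cs: "(\<Sum>j\<in>F. x j * y j)\<^sup>2 \<le> (\<Sum>j\<in>F. x j) * (\<Sum>j\<in>F. x j * (y j)\<^sup>2)" if x: "\<And>j. x j \<ge> 0" for x y :: "int \<Rightarrow> real"
  proof -
    have "(\<Sum>j\<in>F. sqrt (x j) * (sqrt (x j) * y j))\<^sup>2 \<le> (\<Sum>j\<in>F. (sqrt (x j))\<^sup>2) * (\<Sum>j\<in>F. (sqrt (x j) * y j)\<^sup>2)"
      by (rule Cauchy_Schwarz_ineq_sum)
    then show ?thesis using x by (simp add: power_mult_distrib mult.assoc[symmetric])
  qed
  have "(\<Sum>k\<in>S. (\<Sum>j\<in>F. f j * g (k - j))\<^sup>2) \<le> (\<Sum>k\<in>S. A * (\<Sum>j\<in>F. f j * (g (k - j))\<^sup>2))"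
    by (intro sum_mono order.trans[OF cs] mult_right_mono f F sum_nonneg mult_nonneg_nonneg) auto
  also have "\<dots> = A * (\<Sum>j\<in>F. f j * (\<Sum>k\<in>S. (g (k - j))\<^sup>2))"
    unfolding sum_distrib_left[symmetric] by (subst sum.swap) (simp add: sum_distrib_left)
  also have "\<dots> \<le> A * (\<Sum>j\<in>F. f j * B\<^sup>2)"
    by (intro mult_left_mono sum_mono re' S f A0)
  also have "\<dots> = A * ((\<Sum>j\<in>F. f j) * B\<^sup>2)" by (simp add: sum_distrib_right)
  also have "\<dots> \<le> A * (A * B\<^sup>2)" by (intro mult_left_mono mult_right_mono f F A0) auto
  finally show "(\<Sum>k\<in>S. (\<Sum>j\<in>F. f j * g (k - j))\<^sup>2) \<le> A\<^sup>2 * B\<^sup>2" by (simp add: power2_eq_square)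
  have "(\<Sum>k\<in>S. (\<Sum>j\<in>F. g j * f (k - j))\<^sup>2) \<le> (\<Sum>k\<in>S. A * (\<Sum>j\<in>F. f (k - j) * (g j)\<^sup>2))"
  proof (intro sum_mono)
    fix k
    have "(\<Sum>j\<in>F. f (k - j) * g j)\<^sup>2 \<le> (\<Sum>j\<in>F. f (k - j)) * (\<Sum>j\<in>F. f (k - j) * (g j)\<^sup>2)" by (rule cs) (rule f)
    also have "\<dots> \<le> A * (\<Sum>j\<in>F. f (k - j) * (g j)\<^sup>2)"
      by (intro mult_right_mono re F sum_nonneg mult_nonneg_nonneg f) auto
    finally show "(\<Sum>j\<in>F. g j * f (k - j))\<^sup>2 \<le> A * (\<Sum>j\<in>F. f (k - j) * (g j)\<^sup>2)" by (simp add: mult.commute)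
  qed
  also have "\<dots> = A * (\<Sum>j\<in>F. (g j)\<^sup>2 * (\<Sum>k\<in>S. f (k - j)))"
    unfolding sum_distrib_left[symmetric] by (subst sum.swap) (simp add: sum_distrib_left mult.commute)
  also have "\<dots> \<le> A * (\<Sum>j\<in>F. (g j)\<^sup>2 * A)"
    by (intro mult_left_mono sum_mono re' S A0) auto
  also have "\<dots> = A * ((\<Sum>j\<in>F. (g j)\<^sup>2) * A)" by (simp add: sum_distrib_right)
  also have "\<dots> \<le> A * (B\<^sup>2 * A)" by (intro mult_left_mono mult_right_mono g F A0)
  finally show "(\<Sum>k\<in>S. (\<Sum>j\<in>F. g j * f (k - j))\<^sup>2) \<le> A\<^sup>2 * B\<^sup>2" by (simp add: power2_eq_square mult_ac)
qed

lemma qconv_hsb: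
  assumes s: "s > 3/2" and a: "hsb s R a" "R \<ge> 0" and b: "hsb s R' b" "R' \<ge> 0"
  shows "hsb (s - 1) (cq s * R * R') (qconv a b)"
  unfolding hsb_def
proof safe
  fix S :: "int set" assume S: "finite S"
  define c where "c = 18 * 2 powr s"
  define Z where "Z = zt (s - 1)"
  define tm where "tm k j = - \<i> * gam k j * (a j * b (k - j))" for k j
  define za where "za j = jb j powr s * cmod (a j)" for j
  define zb where "zb j = jb j powr s * cmod (b j)" for j
  define la where "la j = jb j * cmod (a j)" for j
  define lb where "lb j = jb j * cmod (b j)" for j
  have lz: "la j \<ge> 0" "lb j \<ge> 0" for j by (auto simp: la_def lb_def jb_nonneg)
  \<comment> \<open>The bilinear series is cut to finitely many \<open>j\<close>; the bound is free
    of the cut and passes to the limit.\<close>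
  have F1: "(\<Sum>k\<in>S. (jb k powr (s - 1) * cmod (\<Sum>j\<in>F. tm k j))\<^sup>2) \<le> (cq s * R * R')\<^sup>2" if F: "finite F" for F
  proof -
    define X where "X k = (\<Sum>j\<in>F. la j * zb (k - j))" for k
    define Y where "Y k = (\<Sum>j\<in>F. za j * lb (k - j))" for k
    have "jb k powr (s - 1) * cmod (\<Sum>j\<in>F. tm k j) \<le> c * (X k + Y k)" for k
    proof -
      have "jb k powr (s - 1) * cmod (\<Sum>j\<in>F. tm k j) \<le> jb k powr (s - 1) * (\<Sum>j\<in>F. cmod (tm k j))"
        by (intro mult_left_mono norm_sum) auto
      also have "\<dots> = (\<Sum>j\<in>F. (jb k powr (s - 1) * \<bar>gam k j\<bar>) * (cmod (a j) * cmod (b (k - j))))"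
        unfolding sum_distrib_left by (intro sum.cong) (auto simp: tm_def norm_mult)
      also have "\<dots> \<le> (\<Sum>j\<in>F. (c * paraprod s k j) * (cmod (a j) * cmod (b (k - j))))"
        unfolding c_def using s by (intro sum_mono mult_right_mono weight_gam) auto
      also have "\<dots> = c * (X k + Y k)"
        unfolding X_def Y_def sum.distrib[symmetric] sum_distrib_left
        by (intro sum.cong refl) (simp add: la_def lb_def za_def zb_def algebra_simps)
      finally show ?thesis .
    qed
    then have "(jb k powr (s - 1) * cmod (\<Sum>j\<in>F. tm k j))\<^sup>2 \<le> (c * (X k + Y k))\<^sup>2" for k
      by (intro power_mono) auto
    also have "(c * (X k + Y k))\<^sup>2 \<le> 2 * c\<^sup>2 * ((X k)\<^sup>2 + (Y k)\<^sup>2)" for k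
    proof -
      have "(X k + Y k)\<^sup>2 \<le> 2 * ((X k)\<^sup>2 + (Y k)\<^sup>2)"
        using sum_squares_bound[of "X k" "Y k"] by (simp add: power2_sum)
      then show ?thesis by (simp add: power_mult_distrib mult_left_mono mult.assoc mult.left_commute[of 2])
    qed
    finally have sq: "(jb k powr (s - 1) * cmod (\<Sum>j\<in>F. tm k j))\<^sup>2 \<le> 2 * c\<^sup>2 * ((X k)\<^sup>2 + (Y k)\<^sup>2)" for k .
    have "(\<Sum>k\<in>S. (jb k powr (s - 1) * cmod (\<Sum>j\<in>F. tm k j))\<^sup>2) \<le> (\<Sum>k\<in>S. 2 * c\<^sup>2 * ((X k)\<^sup>2 + (Y k)\<^sup>2))"
      by (intro sum_mono sq)
    also have "\<dots> = 2 * c\<^sup>2 * ((\<Sum>k\<in>S. (X k)\<^sup>2) + (\<Sum>k\<in>S. (Y k)\<^sup>2))"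
      unfolding sum.distrib[symmetric] sum_distrib_left ..
    also have "\<dots> \<le> 2 * c\<^sup>2 * ((Z * R)\<^sup>2 * R'\<^sup>2 + (Z * R')\<^sup>2 * R\<^sup>2)"
    proof (intro mult_left_mono add_mono)
      show "(\<Sum>k\<in>S. (X k)\<^sup>2) \<le> (Z * R)\<^sup>2 * R'\<^sup>2"
        unfolding X_def
      proof (rule young_finite(1)[OF lz(1) _ _ S F])
        show "sum la F \<le> Z * R" if "finite F" for F
          unfolding la_def Z_def using hsb_jb_l1[OF a s that] .
        show "(\<Sum>j\<in>F. (zb j)\<^sup>2) \<le> R'\<^sup>2" if "finite F" for F
          unfolding zb_def using hsbD[OF b(1) that] .
      qed
      show "(\<Sum>k\<in>S. (Y k)\<^sup>2) \<le> (Z * R')\<^sup>2 * R\<^sup>2"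
        unfolding Y_def
      proof (rule young_finite(2)[OF lz(2) _ _ S F])
        show "sum lb F \<le> Z * R'" if "finite F" for F
          unfolding lb_def Z_def using hsb_jb_l1[OF b s that] .
        show "(\<Sum>j\<in>F. (za j)\<^sup>2) \<le> R\<^sup>2" if "finite F" for F
          unfolding za_def using hsbD[OF a(1) that] .
      qed
    qed auto
    also have "\<dots> = (cq s * R * R')\<^sup>2"
      by (simp add: cq_def c_def Z_def power_mult_distrib power2_eq_square)
    finally show ?thesis .
  qed
  have lim: "((\<lambda>F. \<Sum>j\<in>F. tm k j) \<longlongrightarrow> qconv a b k) (finite_subsets_at_top UNIV)" for k
    unfolding qconv_def tm_def by (rule infsum_tendsto[OF qconv_summable(1)[OF a b s]])
  have "((\<lambda>F. \<Sum>k\<in>S. (jb k powr (s - 1) * cmod (\<Sum>j\<in>F. tm k j))\<^sup>2) \<longlongrightarrow> (\<Sum>k\<in>S. (jb k powr (s - 1) * cmod (qconv a b k))\<^sup>2)) (finite_subsets_at_top UNIV)"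
    by (intro tendsto_intros lim)
  then show "(\<Sum>k\<in>S. (jb k powr (s - 1) * cmod (qconv a b k))\<^sup>2) \<le> (cq s * R * R')\<^sup>2"
    by (rule tendsto_upperbound) (auto intro!: eventually_finite_subsets_at_top_weakI F1)
qed

subsection \<open>The equation in Fourier space\<close>

text \<open>Two derivatives of the series still have absolutely summable coefficients, because s - 2
  > 1/2.\<close>

lemma regularity:
  assumes u: "cper u" and a: "hsb s R (fcoeff u)" "R \<ge> 0" and s: "s > 5/2"
  shows "(u has_real_derivative deriv u x) (at x)" "cper (deriv u)"
    "fcoeff (deriv u) k = 2 * pi * \<i> * of_int k * fcoeff u k"
    "deriv u = syn (\<lambda>k. 2 * pi * \<i> * of_int k * fcoeff u k)"
    "(deriv u has_real_derivative deriv (deriv u) x) (at x)" "cper (deriv (deriv u))"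
    "fcoeff (deriv (deriv u)) k = (2 * pi * \<i> * of_int k) * (2 * pi * \<i> * of_int k) * fcoeff u k"
    "asum (fcoeff u)" "asum (fcoeff (deriv u))"
proof -
  have 1: "asum (\<lambda>k. 2 * pi * \<i> * of_int k * fcoeff u k)"
    by (rule asum_hsb[OF a _ dcoef_bound]) (use s in auto)
  note d = cper_deriv_exists[OF u 1]
  show "(u has_real_derivative deriv u x) (at x)" "cper (deriv u)"
    "fcoeff (deriv u) k = 2 * pi * \<i> * of_int k * fcoeff u k"
    "deriv u = syn (\<lambda>k. 2 * pi * \<i> * of_int k * fcoeff u k)"
    by (rule d)+
  have e: "2 * pi * \<i> * of_int k * fcoeff (deriv u) k = (2 * pi * \<i> * of_int k) * (2 * pi * \<i> * of_int k) * fcoeff u k" for k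
    by (simp add: d(3) mult.assoc)
  have 2: "asum (\<lambda>k. 2 * pi * \<i> * of_int k * fcoeff (deriv u) k)"
    unfolding e by (rule asum_hsb[OF a _ d2coef_bound]) (use s in auto)
  note dd = cper_deriv_exists[OF d(2) 2]
  show "(deriv u has_real_derivative deriv (deriv u) x) (at x)" "cper (deriv (deriv u))"
    "fcoeff (deriv (deriv u)) k = (2 * pi * \<i> * of_int k) * (2 * pi * \<i> * of_int k) * fcoeff u k"
    using dd d(3) by (simp_all add: mult.assoc)
  show "asum (fcoeff u)" using asum_0[OF a] s by simp
  show "asum (fcoeff (deriv u))" using 1 by (simp add: d(3))
qed

definition flux :: "(real \<Rightarrow> real) \<Rightarrow> real \<Rightarrow> real" where
  "flux u = (\<lambda>y. 2 * mu u * u y + 1/2 * (deriv u y)\<^sup>2)"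

text \<open>With this sign the equation reads u_t = - \<open>rhs u\<close>.\<close>

definition rhs :: "(real \<Rightarrow> real) \<Rightarrow> real \<Rightarrow> real" where
  "rhs u x = u x * deriv u x + opA_inv (deriv (flux u)) x"

lemma flux_props:
  assumes u: "cper u" and a: "hsb s R (fcoeff u)" "R \<ge> 0" and s: "s > 5/2"
  shows "cper (flux u)" "(flux u has_real_derivative 2 * mu u * deriv u x + deriv u x * deriv (deriv u) x) (at x)"
    "continuous_on UNIV (\<lambda>x. 2 * mu u * deriv u x + deriv u x * deriv (deriv u) x)"
proof -
  note r = regularity[OF assms]
  show "cper (flux u)" unfolding flux_def by (intro cper_intros u r)
  show "(flux u has_real_derivative 2 * mu u * deriv u x + deriv u x * deriv (deriv u) x) (at x)"
    unfolding flux_def by (rule derivative_eq_intros r refl)+ (simp add: power2_eq_square)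
  show "continuous_on UNIV (\<lambda>x. 2 * mu u * deriv u x + deriv u x * deriv (deriv u) x)"
    by (intro continuous_intros cperD(2) r)
qed

text \<open>The bridge between the equation and its coefficients. In the last claim the nonlocal
  term contributes \<open>mu (flux u) - flux u x\<close>: half of u_x^2 cancels, and only a constant
  in \<open>x\<close> remains nonlocal.\<close>

lemma rhs_props:
  assumes u: "cper u" and a: "hsb s R (fcoeff u)" "R \<ge> 0" and s: "s > 5/2"
  shows "cper (rhs u)" "fcoeff (rhs u) k = - qconv (fcoeff u) (fcoeff u) k"
    "(rhs u has_real_derivative u x * deriv (deriv u) x + 1/2 * (deriv u x)\<^sup>2 - 2 * mu u * u x + mu (flux u)) (at x)"
proof -
  note r = regularity[OF assms]
  note f = flux_props[OF assms]
  note w = opA_inv_deriv[OF f]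
  have uu: "cper (\<lambda>x. u x * deriv u x)" by (intro cper_intros u r)
  show "cper (rhs u)" unfolding rhs_def by (intro cper_add uu w)
  have "(rhs u has_real_derivative (deriv u x * deriv u x + deriv (deriv u) x * u x) + (mu (flux u) - flux u x)) (at x)"
    unfolding rhs_def by (intro DERIV_add DERIV_mult r w(2))
  then show "(rhs u has_real_derivative u x * deriv (deriv u) x + 1/2 * (deriv u x)\<^sup>2 - 2 * mu u * u x + mu (flux u)) (at x)"
    by (rule DERIV_cong) (simp add: flux_def power2_eq_square algebra_simps)
  define A where "A = fcoeff u"
  define P where "P j = A j * A (k - j)" for j
  define S1 where "S1 = fcoeff (\<lambda>x. u x * deriv u x) k"
  define S2 where "S2 = fcoeff (\<lambda>x. deriv u x * deriv u x) k"
  have A0: "A 0 = of_real (mu u)" by (simp add: A_def fcoeff_0[OF u])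
  have h1: "((\<lambda>j. 2 * pi * \<i> * of_int (k - j) * P j) has_sum S1) UNIV"
    using fcoeff_mult[OF u r(8,2), of k] by (simp add: S1_def P_def A_def r(3) mult_ac)
  \<comment> \<open>The reflected sum; averaging it with \<open>h1\<close> replaces
    \<open>k - j\<close> by \<open>k / 2\<close> and yields the symmetric symbol
    \<open>pi * k\<close>.\<close>
  have h2: "((\<lambda>j. 2 * pi * \<i> * of_int j * P j) has_sum S1) UNIV"
    using has_sum_reindex_bij_witness[of UNIV "\<lambda>j. k - j" "\<lambda>j. k - j" UNIV "\<lambda>j. 2 * pi * \<i> * of_int (k - j) * P j" "\<lambda>j. 2 * pi * \<i> * of_int j * P j" S1 S1] h1
    by (simp add: P_def mult_ac)
  have h3: "((\<lambda>j. (2 * pi * \<i> * of_int j) * (2 * pi * \<i> * of_int (k - j)) * P j) has_sum S2) UNIV"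
    using fcoeff_mult[OF r(2,9,2), of k] by (simp add: S2_def P_def A_def r(3) mult_ac)
  have fl: "fcoeff (flux u) k = 2 * of_real (mu u) * A k + S2 / 2"
  proof -
    have "fcoeff (flux u) k = fcoeff (\<lambda>y. 2 * mu u * u y) k + fcoeff (\<lambda>y. 1/2 * (deriv u y * deriv u y)) k"
      unfolding flux_def power2_eq_square by (intro fcoeff_add cper_intros u r)
    then show ?thesis unfolding fcoeff_cmult by (simp add: A_def S2_def)
  qed
  have R: "fcoeff (rhs u) k = S1 + \<i> * (2 * of_real (mu u) * A k + S2 / 2) / (2 * pi * of_int k)"
    unfolding rhs_def fcoeff_add[OF uu w(1)] w(3) fl S1_def ..
  \<comment> \<open>The linear-looking term 2 mu u is written as a convolution: mode 0 sits at
    \<open>j = 0\<close> and, symmetrically, at \<open>j = k\<close>.\<close>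
  define e where "e j = (if j = 0 then A 0 * A k else 0) + (if j = k then A k * A 0 else 0)" for j
  have h4: "(e has_sum 2 * (A 0 * A k)) UNIV"
  proof -
    have "((\<lambda>j. if j = 0 then A 0 * A k else 0) has_sum A 0 * A k) UNIV"
      by (rule has_sum_finite_neutralI[of "{0}"]) auto
    moreover have "((\<lambda>j. if j = k then A k * A 0 else 0) has_sum A k * A 0) UNIV"
      by (rule has_sum_finite_neutralI[of "{k}"]) auto
    ultimately show ?thesis unfolding e_def using has_sum_add by (fastforce simp: mult.commute)
  qed
  have "((\<lambda>j. (1/2) * (2 * pi * \<i> * of_int (k - j) * P j + 2 * pi * \<i> * of_int j * P j)
      + (\<i> / (2 * pi * of_int k)) * (e j + (1/2) * ((2 * pi * \<i> * of_int j) * (2 * pi * \<i> * of_int (k - j)) * P j)))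
      has_sum ((1/2) * (S1 + S1) + (\<i> / (2 * pi * of_int k)) * (2 * (A 0 * A k) + (1/2) * S2))) UNIV"
    by (intro has_sum_add has_sum_cmult_right h1 h2 h3 h4)
  also have "(1/2) * (S1 + S1) + (\<i> / (2 * pi * of_int k)) * (2 * (A 0 * A k) + (1/2) * S2) = fcoeff (rhs u) k"
    unfolding R A0 by (cases "k = 0") (simp_all add: field_simps)
  also have "(\<lambda>j. (1/2) * (2 * pi * \<i> * of_int (k - j) * P j + 2 * pi * \<i> * of_int j * P j)
      + (\<i> / (2 * pi * of_int k)) * (e j + (1/2) * ((2 * pi * \<i> * of_int j) * (2 * pi * \<i> * of_int (k - j)) * P j)))
     = (\<lambda>j. - (- \<i> * gam k j * (A j * A (k - j))))"
  proof
    fix j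
    have e: "e j = of_real ((if j = 0 then 1 else 0) + (if j = k then 1 else 0)) * P j"
      by (auto simp: e_def P_def)
    have "(1/2) * (2 * pi * \<i> * of_int (k - j) * P j + 2 * pi * \<i> * of_int j * P j)
      + (\<i> / (2 * pi * of_int k)) * (e j + (1/2) * ((2 * pi * \<i> * of_int j) * (2 * pi * \<i> * of_int (k - j)) * P j))
      = \<i> * P j * of_real (gam k j)"
      unfolding e gam_def by (cases "k = 0") (auto simp: field_simps power2_eq_square)
    then show "(1/2) * (2 * pi * \<i> * of_int (k - j) * P j + 2 * pi * \<i> * of_int j * P j)
      + (\<i> / (2 * pi * of_int k)) * (e j + (1/2) * ((2 * pi * \<i> * of_int j) * (2 * pi * \<i> * of_int (k - j)) * P j))
      = - (- \<i> * gam k j * (A j * A (k - j)))" by (simp add: P_def mult_ac)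
  qed
  finally have "infsum (\<lambda>j. - (- \<i> * gam k j * (A j * A (k - j)))) UNIV = fcoeff (rhs u) k" by (rule infsumI)
  then show "fcoeff (rhs u) k = - qconv (fcoeff u) (fcoeff u) k"
    unfolding infsum_uminus qconv_def A_def by simp
qed

subsection \<open>Solutions in physical space\<close>

lemma sol_syn:
  assumes a: "sol s T R a" and R: "R \<ge> 0" and s: "s > 5/2" and t: "t \<in> {0..T}"
  shows "cper (syn (a t))" "fcoeff (syn (a t)) = a t" "hsb s R (fcoeff (syn (a t)))"
proof -
  note A = solD(1,2)[OF a t]
  have as: "asum (a t)" using asum_0[OF A(2) R] s by simp
  show "cper (syn (a t))" by (rule syn_cper[OF as])
  show "fcoeff (syn (a t)) = a t" using fcoeff_syn[OF as A(1)] by blast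
  then show "hsb s R (fcoeff (syn (a t)))" using A(2) by simp
qed

lemma symm_dcoef: "symm a \<Longrightarrow> symm (\<lambda>k. 2 * pi * \<i> * of_int k * a k)"
  by (simp add: symm_def)

lemma sol_ux:
  assumes a: "sol s T R a" and R: "R \<ge> 0" and s: "s > 5/2" and t: "t \<in> {0..T}"
  shows "of_real (deriv (syn (a t)) x) = cs (\<lambda>k. 2 * pi * \<i> * of_int k * a t k) x"
    "\<bar>deriv (syn (a t)) x\<bar> \<le> zt (s - 1) * R"
proof -
  note S = sol_syn[OF assms]
  note r = regularity[OF S(1,3) R s]
  note A = solD(1,2)[OF a t]
  have as: "asum (\<lambda>k. 2 * pi * \<i> * of_int k * a t k)"
    by (rule asum_hsb[OF A(2) R _ dcoef_bound]) (use s in auto)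
  have d: "deriv (syn (a t)) = syn (\<lambda>k. 2 * pi * \<i> * of_int k * a t k)" using r(4) S(2) by simp
  show e: "of_real (deriv (syn (a t)) x) = cs (\<lambda>k. 2 * pi * \<i> * of_int k * a t k) x"
    unfolding d by (rule of_real_syn[OF as symm_dcoef[OF A(1)]])
  have "cmod (cs (\<lambda>k. 2 * pi * \<i> * of_int k * a t k) x) \<le> 1 * (zt (s - 1) * R)"
    unfolding cs_def
  proof (rule abs_summable_bounded(3))
    fix F :: "int set" assume F: "finite F"
    have "(\<Sum>k\<in>F. norm (2 * pi * \<i> * of_int k * a t k * ek k x)) = (\<Sum>k\<in>F. norm (2 * pi * \<i> * of_int k * a t k))"
      by (simp add: norm_mult)
    also have "\<dots> \<le> 1 * (zt (s - 1) * R)"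
      by (rule hsb_scaled_sum[OF A(2) R _ dcoef_bound _ F]) (use s in auto)
    finally show "(\<Sum>k\<in>F. norm (2 * pi * \<i> * of_int k * a t k * ek k x)) \<le> 1 * (zt (s - 1) * R)" .
  qed
  then show "\<bar>deriv (syn (a t)) x\<bar> \<le> zt (s - 1) * R"
    unfolding e[symmetric] by simp
qed

lemma tail_tendsto: "q > 0 \<Longrightarrow> (\<lambda>n. real n powr (- q) * C) \<longlonglongrightarrow> 0"
  using tendsto_mult_right[OF tendsto_neg_powr[OF _ filterlim_real_sequentially, of "- q"], of C] by (simp add: mult.commute)

lemma tail_small:
  assumes "q > 0" "e > 0"
  shows "\<exists>N. \<forall>n\<ge>N. n \<ge> 1 \<and> real n powr (- q) * C \<le> e"
proof -
  have "eventually (\<lambda>n. real n powr (- q) * C < e) sequentially"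
    using tail_tendsto[OF assms(1)] assms(2) by (rule order_tendstoD)
  then have "eventually (\<lambda>n. n \<ge> 1 \<and> real n powr (- q) * C \<le> e) sequentially"
    using eventually_ge_at_top[of 1] by eventually_elim auto
  then show ?thesis by (simp add: eventually_sequentially)
qed

text \<open>Partial Fourier sums of u_x are differentiated in time; their derivatives converge
  uniformly because the nonlinearity lies in H^(s-1) and its first derivative still has summable
  coefficients. The limit is recognised as the space derivative of - \<open>rhs u\<close>.\<close>

lemma sol_ux_deriv:
  assumes a: "sol s T R a" and R: "R \<ge> 0" and s: "s > 5/2" and t: "t \<in> {0..T}"
  defines "u \<equiv> syn (a t)"
  shows "((\<lambda>t. deriv (syn (a t)) x) has_real_derivative
     - (u x * deriv (deriv u) x + 1/2 * (deriv u x)\<^sup>2 - 2 * mu u * u x + mu (flux u))) (at t within {0..T})"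
proof -
  \<comment> \<open>Half of the excess of s over 5/2 is spent on a decay rate for the tails; the
    other half keeps the remaining series summable.\<close>
  define q where "q = (s - 5/2) / 2"
  have q: "q > 0" "q \<ge> 0" "s - 1 - 1 - q > 1/2" "s - 1 - q > 1/2" using s by (simp_all add: q_def field_simps)
  define b where "b k = 2 * pi * \<i> * of_int k" for k
  have bb: "cmod (b k) \<le> 1 * jb k powr 1" for k unfolding b_def by (rule dcoef_bound)
  define R2 where "R2 = cq s * R * R"
  have R2: "R2 \<ge> 0" unfolding R2_def using cq_nonneg R by simp
  have qh: "hsb (s - 1) R2 (qconv (a t) (a t))" if "t \<in> {0..T}" for t
    unfolding R2_def by (rule qconv_hsb[OF _ solD(2)[OF a that] R solD(2)[OF a that] R]) (use s in simp)
  define D where "D t x = - (syn (a t) x * deriv (deriv (syn (a t))) x + 1/2 * (deriv (syn (a t)) x)\<^sup>2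
      - 2 * mu (syn (a t)) * syn (a t) x + mu (flux (syn (a t))))" for t x
  have Dcs: "of_real (D t x) = cs (\<lambda>k. b k * qconv (a t) (a t) k) x" if t: "t \<in> {0..T}" for t x
  proof -
    note S = sol_syn[OF a R s t]
    note r = regularity[OF S(1,3) R s]
    note rp = rhs_props[OF S(1,3) R s]
    have cont: "continuous_on UNIV (\<lambda>x. syn (a t) x * deriv (deriv (syn (a t))) x + 1/2 * (deriv (syn (a t)) x)\<^sup>2
      - 2 * mu (syn (a t)) * syn (a t) x + mu (flux (syn (a t))))"
      by (intro continuous_intros cperD(2) S r)
    note fd = fcoeff_deriv[OF rp(1) rp(3) cont]
    have c: "cper (D t)" unfolding D_def using fd(1) by (rule cper_minus)
    have "D t = (\<lambda>x. (- 1) * (syn (a t) x * deriv (deriv (syn (a t))) x + 1/2 * (deriv (syn (a t)) x)\<^sup>2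
      - 2 * mu (syn (a t)) * syn (a t) x + mu (flux (syn (a t)))))" by (simp add: D_def fun_eq_iff)
    then have fk: "fcoeff (D t) k = b k * qconv (a t) (a t) k" for k
      by (simp only: fcoeff_cmult fd(2) rp(2) S(2)) (simp add: b_def)
    have as: "asum (fcoeff (D t))" unfolding fk
      by (rule asum_hsb[OF qh[OF t] R2 _ bb]) (use s in auto)
    have "D t = syn (fcoeff (D t))" by (rule cper_eq_syn[OF c as])
    then have "of_real (D t x) = cs (fcoeff (D t)) x" using of_real_syn[OF as symm_fcoeff] by metis
    moreover have "fcoeff (D t) = (\<lambda>k. b k * qconv (a t) (a t) k)" using fk by blast
    ultimately show ?thesis by simp
  qed
  define f where "f n t = (\<Sum>k\<in>freqs n. b k * a t k * ek k x)" for n t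
  define f' where "f' n t = (\<Sum>k\<in>freqs n. b k * qconv (a t) (a t) k * ek k x)" for n t
  have "((\<lambda>t. cs (\<lambda>k. b k * a t k) x) has_vector_derivative cs (\<lambda>k. b k * qconv (a t) (a t) k) x) (at t within {0..T})"
  proof (rule has_vector_derivative_limit[of _ 0 f f', OF _ _ _ _ t])
    show "(f n has_vector_derivative f' n t) (at t within {0..T})" if "t \<in> {0..T}" for n t
      unfolding f_def f'_def
      by (intro has_vector_derivative_sum has_vector_derivative_mult_left has_vector_derivative_mult_right solD(3)[OF a that])
    show "\<exists>N. \<forall>n\<ge>N. \<forall>t\<in>{0..T}. norm (f' n t - cs (\<lambda>k. b k * qconv (a t) (a t) k) x) \<le> e" if e: "e > 0" for e
    proof -
      obtain N where N: "\<And>n. n \<ge> N \<Longrightarrow> n \<ge> 1 \<and> real n powr (- q) * (zt (s - 1 - 1 - q) * R2) \<le> e"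
        using tail_small[OF q(1) e] by blast
      show ?thesis
      proof (intro exI[of _ N] allI impI ballI)
        fix n t assume "n \<ge> N" and t: "t \<in> {0..T}"
        then have n: "n \<ge> 1" "real n powr (- q) * (zt (s - 1 - 1 - q) * R2) \<le> e" using N by auto
        show "norm (f' n t - cs (\<lambda>k. b k * qconv (a t) (a t) k) x) \<le> e"
          unfolding f'_def by (rule order.trans[OF cs_tail[OF qh[OF t] R2 bb q(2,3) n(1)] n(2)])
      qed
    qed
    show "(\<lambda>n. f n t) \<longlonglongrightarrow> cs (\<lambda>k. b k * a t k) x" if t: "t \<in> {0..T}" for t
    proof (rule LIM_zero_cancel, rule Lim_null_comparison[OF _ tail_tendsto[OF q(1)]])
      show "\<forall>\<^sub>F n in sequentially. norm (f n t - cs (\<lambda>k. b k * a t k) x) \<le> real n powr - q * (zt (s - 1 - q) * R)"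
        using eventually_ge_at_top[of 1]
        by eventually_elim (auto simp: f_def intro!: cs_tail[OF solD(2)[OF a t] R bb q(2,4)])
    qed
  qed simp
  then have "((\<lambda>t. Re (cs (\<lambda>k. b k * a t k) x)) has_vector_derivative Re (cs (\<lambda>k. b k * qconv (a t) (a t) k) x)) (at t within {0..T})"
    by (rule bounded_linear.has_vector_derivative[OF bounded_linear_Re])
  moreover have "Re (cs (\<lambda>k. b k * qconv (a t) (a t) k) x) = D t x"
    unfolding Dcs[OF t, symmetric] by simp
  ultimately have "((\<lambda>t. Re (cs (\<lambda>k. b k * a t k) x)) has_vector_derivative D t x) (at t within {0..T})" by simp
  then have "((\<lambda>t. deriv (syn (a t)) x) has_vector_derivative D t x) (at t within {0..T})"
  proof (rule has_vector_derivative_transform[OF t, rotated])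
    fix t assume t: "t \<in> {0..T}"
    show "deriv (syn (a t)) x = Re (cs (\<lambda>k. b k * a t k) x)"
      using sol_ux(1)[OF a R s t, of x] unfolding b_def by (metis Re_complex_of_real)
  qed
  then show ?thesis by (simp add: has_real_derivative_iff_has_vector_derivative D_def u_def)
qed

text \<open>Joint continuity in time and space serves the compactness argument of
  \<open>doubling_maximum\<close>.\<close>

lemma sol_ux_continuous:
  assumes a: "sol s T R a" and R: "R \<ge> 0" and s: "s > 5/2"
  shows "continuous_on ({0..T} \<times> UNIV) (\<lambda>(t, x). deriv (syn (a t)) x)"
proof -
  define q where "q = (s - 5/2) / 2"
  have q: "q > 0" "q \<ge> 0" "s - 1 - q > 1/2" using s by (simp_all add: q_def field_simps)
  define b where "b k = 2 * pi * \<i> * of_int k" for k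
  have bb: "cmod (b k) \<le> 1 * jb k powr 1" for k unfolding b_def by (rule dcoef_bound)
  have ac: "continuous_on {0..T} (\<lambda>t. a t k)" for k
    using has_vector_derivative_continuous[OF solD(3)[OF a]]
    by (auto simp: continuous_on_eq_continuous_within)
  have "continuous_on ({0..T} \<times> UNIV) (\<lambda>p. cs (\<lambda>k. b k * a (fst p) k) (snd p))"
  proof (rule uniform_limit_theorem[where F = sequentially and f = "\<lambda>n p. \<Sum>k\<in>freqs n. b k * a (fst p) k * ek k (snd p)"])
    have cn: "continuous_on ({0..T} \<times> UNIV) (\<lambda>p. \<Sum>k\<in>freqs n. b k * a (fst p) k * ek k (snd p))" for n
      by (intro continuous_intros continuous_on_compose2[OF ac] continuous_on_compose2[OF continuous_ek[of UNIV]]) auto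
    show "\<forall>\<^sub>F n in sequentially. continuous_on ({0..T} \<times> UNIV) (\<lambda>p. \<Sum>k\<in>freqs n. b k * a (fst p) k * ek k (snd p))"
      by (rule always_eventually, rule allI, rule cn)
    show "uniform_limit ({0..T} \<times> UNIV) (\<lambda>n p. \<Sum>k\<in>freqs n. b k * a (fst p) k * ek k (snd p)) (\<lambda>p. cs (\<lambda>k. b k * a (fst p) k) (snd p)) sequentially"
    proof (rule uniform_limitI)
      fix e :: real assume e: "e > 0"
      obtain N where N: "\<And>n. n \<ge> N \<Longrightarrow> n \<ge> 1 \<and> real n powr (- q) * (zt (s - 1 - q) * R) \<le> e / 2"
        using tail_small[OF q(1), of "e/2"] e by auto
      show "\<forall>\<^sub>F n in sequentially. \<forall>p\<in>{0..T} \<times> UNIV. dist (\<Sum>k\<in>freqs n. b k * a (fst p) k * ek k (snd p)) (cs (\<lambda>k. b k * a (fst p) k) (snd p)) < e"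
        unfolding eventually_sequentially
      proof (intro exI[of _ N] allI impI ballI)
        fix n p assume "n \<ge> N" and p: "p \<in> {0..T} \<times> (UNIV :: real set)"
        then have n: "n \<ge> 1" "real n powr (- q) * (zt (s - 1 - q) * R) \<le> e / 2" using N by auto
        have t: "fst p \<in> {0..T}" using p by auto
        show "dist (\<Sum>k\<in>freqs n. b k * a (fst p) k * ek k (snd p)) (cs (\<lambda>k. b k * a (fst p) k) (snd p)) < e"
          using order.trans[OF cs_tail[OF solD(2)[OF a t] R bb q(2,3) n(1)] n(2), of "snd p"] e
          by (simp add: dist_norm)
      qed
    qed
  qed simp
  then have "continuous_on ({0..T} \<times> UNIV) (\<lambda>p. Re (cs (\<lambda>k. b k * a (fst p) k) (snd p)))"
    by (intro continuous_intros)
  moreover have "Re (cs (\<lambda>k. b k * a (fst p) k) (snd p)) = (case p of (t, x) \<Rightarrow> deriv (syn (a t)) x)"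
    if "p \<in> {0..T} \<times> UNIV" for p
  proof -
    have t: "fst p \<in> {0..T}" using that by auto
    show ?thesis using sol_ux(1)[OF a R s t, of "snd p"] unfolding b_def
      by (metis Re_complex_of_real case_prod_beta)
  qed
  ultimately show ?thesis by (rule continuous_on_eq)
qed

text \<open>Mode 0 has no source, as \<open>gam 0 j = 0\<close>.\<close>

lemma sol_mu:
  assumes a: "sol s T R a" and R: "R \<ge> 0" and s: "s > 5/2" and t: "t \<in> {0..T}"
  shows "mu (syn (a t)) = mu (syn (a 0))"
proof -
  have T: "0 \<in> {0..T}" using t by auto
  have "((\<lambda>t. a t 0) has_vector_derivative 0) (at t within {0..T})" if "t \<in> {0..T}" for t
    using solD(3)[OF a that, of 0] by (simp add: qconv_def)
  then obtain c where "\<And>t. t \<in> {0..T} \<Longrightarrow> a t 0 = c"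
    using has_vector_derivative_zero_constant[of "{0..T}" "\<lambda>t. a t 0"] by auto
  then have "a t 0 = a 0 0" using t T by metis
  then have "complex_of_real (mu (syn (a t))) = of_real (mu (syn (a 0)))"
    using fcoeff_0[OF sol_syn(1)[OF a R s t]] fcoeff_0[OF sol_syn(1)[OF a R s T]]
      sol_syn(2)[OF a R s t] sol_syn(2)[OF a R s T] by simp
  then show ?thesis by simp
qed

subsection \<open>A maximum principle with doubled variables\<close>

text \<open>At a positive maximum of \<open>exp (- lam * t) * w\<close> the choice
  \<open>lam = L + 1\<close> makes the time derivative strictly negative, so a larger value occurred
  earlier. The argument looks only to earlier times and so covers a maximum at time T. On the lines
  y = x and y = x + 1, where a spatial maximum would not be interior, positivity is excluded by
  \<open>diag\<close>.\<close>

lemma doubling_maximum: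
  fixes w :: "real \<Rightarrow> real \<Rightarrow> real \<Rightarrow> real"
  assumes cont: "continuous_on ({0..T} \<times> UNIV) (\<lambda>(t, x, y). w t x y)"
    and per: "\<And>t x y n. w t (x + of_int n) (y + of_int n) = w t x y"
    and diag: "\<And>t x. w t x x \<le> 0" "\<And>t x. t \<in> {0..T} \<Longrightarrow> w t x (x + 1) \<le> 0"
    and init: "\<And>x y. x \<le> y \<Longrightarrow> y \<le> x + 1 \<Longrightarrow> w 0 x y \<le> 0"
    and step: "\<And>t x y. \<lbrakk>t \<in> {0..T}; x < y; y < x + 1; w t x y > 0;
        \<And>x' y'. x' \<le> y' \<Longrightarrow> y' \<le> x' + 1 \<Longrightarrow> w t x' y' \<le> w t x y\<rbrakk> \<Longrightarrow>
        \<exists>D. ((\<lambda>t. w t x y) has_real_derivative D) (at t within {0..T}) \<and> D \<le> L * w t x y"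
    and t: "t \<in> {0..T}" and xy: "x \<le> y" "y \<le> x + 1"
  shows "w t x y \<le> 0"
proof (rule ccontr)
  assume neg: "\<not> w t x y \<le> 0"
  define C where "C = ({0..T} \<times> {0..1} \<times> {0..2}) \<inter> {p :: real \<times> real \<times> real. fst (snd p) \<le> snd (snd p) \<and> snd (snd p) \<le> fst (snd p) + 1}"
  define lam where "lam = L + 1"
  define g where "g p = exp (- lam * fst p) * w (fst p) (fst (snd p)) (snd (snd p))" for p :: "real \<times> real \<times> real"
  \<comment> \<open>Shifting both points by the same integer brings \<open>x\<close> into [0,1] and
    makes the domain compact.\<close>
  have red: "\<exists>x' y'. x' \<in> {0..1} \<and> y' \<in> {0..2} \<and> x' \<le> y' \<and> y' \<le> x' + 1 \<and> (\<forall>t. w t x' y' = w t x y)"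
    if "x \<le> y" "y \<le> x + 1" for x y
  proof (intro exI conjI allI)
    show "frac x \<in> {0..1}" using frac_ge_0[of x] frac_lt_1[of x] by auto
    show "y - of_int \<lfloor>x\<rfloor> \<in> {0..2}" "frac x \<le> y - of_int \<lfloor>x\<rfloor>" "y - of_int \<lfloor>x\<rfloor> \<le> frac x + 1"
      using that frac_ge_0[of x] frac_lt_1[of x] by (auto simp: frac_def intro: order.trans[OF of_int_floor_le])
    show "w t (frac x) (y - of_int \<lfloor>x\<rfloor>) = w t x y" for t
      using per[of t x "- \<lfloor>x\<rfloor>" y] by (simp add: frac_def)
  qed
  have "closed {p :: real \<times> real \<times> real. fst (snd p) \<le> snd (snd p) \<and> snd (snd p) \<le> fst (snd p) + 1}"
    by (intro closed_Collect_conj closed_Collect_le continuous_intros)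
  then have "compact C" unfolding C_def by (intro compact_Int_closed compact_Times) auto
  moreover obtain x1 y1 where x1: "x1 \<in> {0..1}" "y1 \<in> {0..2}" "x1 \<le> y1" "y1 \<le> x1 + 1" "\<And>t. w t x1 y1 = w t x y"
    using red[OF xy] by blast
  moreover from x1 have inC: "(t, x1, y1) \<in> C" using t by (simp add: C_def)
  moreover have "continuous_on C g"
  proof -
    have "continuous_on C (\<lambda>(t, x, y). w t x y)"
      by (rule continuous_on_subset[OF cont]) (auto simp: C_def)
    then have "continuous_on C (\<lambda>p. w (fst p) (fst (snd p)) (snd (snd p)))"
      by (simp add: case_prod_beta')
    then show ?thesis unfolding g_def by (intro continuous_intros)
  qed
  ultimately obtain m where m: "m \<in> C" "\<And>p. p \<in> C \<Longrightarrow> g p \<le> g m"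
    using continuous_attains_sup[of C g] by blast
  obtain t0 x0 y0 where m0: "m = (t0, x0, y0)" by (cases m) auto
  have mC: "t0 \<in> {0..T}" "x0 \<le> y0" "y0 \<le> x0 + 1" using m(1) by (auto simp: m0 C_def)
  have "g (t, x1, y1) > 0" using neg x1(5) by (simp add: g_def)
  then have "g m > 0" using m(2)[OF inC] by linarith
  then have w0: "w t0 x0 y0 > 0" by (simp add: g_def m0 zero_less_mult_iff)
  have mx: "exp (- lam * t') * w t' x' y' \<le> exp (- lam * t0) * w t0 x0 y0"
    if p: "t' \<in> {0..T}" "x' \<le> y'" "y' \<le> x' + 1" for t' x' y'
  proof -
    obtain x2 y2 where x2: "x2 \<in> {0..1}" "y2 \<in> {0..2}" "x2 \<le> y2" "y2 \<le> x2 + 1" "\<And>t. w t x2 y2 = w t x' y'"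
      using red[OF p(2,3)] by blast
    then have "(t', x2, y2) \<in> C" using p by (simp add: C_def)
    from m(2)[OF this] show ?thesis by (simp add: g_def m0 x2(5))
  qed
  have st: "x0 < y0" "y0 < x0 + 1"
    using mC w0 diag(1)[of t0 x0] diag(2)[OF mC(1), of x0] by (cases "x0 = y0"; cases "y0 = x0 + 1"; force)+
  have t0: "t0 > 0" using init[OF mC(2,3)] w0 mC(1) by (cases "t0 = 0") auto
  obtain D where D: "((\<lambda>t. w t x0 y0) has_real_derivative D) (at t0 within {0..T})" "D \<le> L * w t0 x0 y0"
    using step[OF mC(1) st w0] mx[OF mC(1)] by auto
  have "((\<lambda>t. exp (- lam * t) * w t x0 y0) has_real_derivative (exp (- lam * t0) * D - lam * exp (- lam * t0) * w t0 x0 y0)) (at t0 within {0..T})"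
    by (auto intro!: derivative_eq_intros D(1))
  moreover have "exp (- lam * t0) * D - lam * exp (- lam * t0) * w t0 x0 y0 < 0"
  proof -
    have "D < lam * w t0 x0 y0" using D(2) w0 by (simp add: lam_def algebra_simps)
    then have "exp (- lam * t0) * D < exp (- lam * t0) * (lam * w t0 x0 y0)" by (intro mult_strict_left_mono) auto
    then show ?thesis by (simp add: mult_ac)
  qed
  ultimately obtain d where d: "d > 0" "\<And>h. \<lbrakk>0 < h; t0 - h \<in> {0..T}; h < d\<rbrakk> \<Longrightarrow>
      exp (- lam * t0) * w t0 x0 y0 < exp (- lam * (t0 - h)) * w (t0 - h) x0 y0"
    using has_real_derivative_neg_dec_left[of "\<lambda>t. exp (- lam * t) * w t x0 y0" _ t0 "{0..T}"] by blast
  define h where "h = min (d / 2) t0"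
  have h: "0 < h" "t0 - h \<in> {0..T}" "h < d" using d(1) t0 mC(1) by (auto simp: h_def)
  show False using d(2)[OF h] mx[OF h(2) mC(2,3)] by linarith
qed

lemma interior_max_derivs:
  fixes W :: "real \<Rightarrow> real \<Rightarrow> real"
  assumes "x < y" "y < x + 1" and mx: "\<And>x' y'. x' \<le> y' \<Longrightarrow> y' \<le> x' + 1 \<Longrightarrow> W x' y' \<le> W x y"
    and "((\<lambda>x. W x y) has_real_derivative dx) (at x)" "((\<lambda>y. W x y) has_real_derivative dy) (at y)"
  shows "dx = 0" "dy = 0"
proof -
  define d where "d = min (y - x) (x + 1 - y)"
  have d: "d > 0" using assms by (simp add: d_def)
  show "dx = 0" by (rule DERIV_local_max[OF assms(4) d]) (auto intro!: mx simp: d_def abs_less_iff)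
  show "dy = 0" by (rule DERIV_local_max[OF assms(5) d]) (auto intro!: mx simp: d_def abs_less_iff)
qed

subsection \<open>A priori bounds from the sign of the momentum\<close>

lemma slope_le:
  fixes v :: "real \<Rightarrow> real"
  assumes "\<And>x. (v has_real_derivative v' x) (at x)" "\<And>x. v' x \<le> c" "x \<le> y"
  shows "v y - v x \<le> c * (y - x)"
proof -
  have "v y - c * y \<le> v x - c * x"
  proof (rule DERIV_nonpos_imp_nonincreasing[OF assms(3)])
    fix z
    have "((\<lambda>x. v x - c * x) has_real_derivative (v' z - c)) (at z)"
      by (auto intro!: derivative_eq_intros assms(1))
    then show "\<exists>D. ((\<lambda>x. v x - c * x) has_real_derivative D) (at z) \<and> D \<le> 0"
      using assms(2)[of z] by auto
  qed
  then show ?thesis by (simp add: algebra_simps)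
qed

lemma deriv_le_slope:
  fixes v :: "real \<Rightarrow> real"
  assumes "(v has_real_derivative D) (at x)" "\<And>y. x \<le> y \<Longrightarrow> y \<le> x + 1 \<Longrightarrow> v y - v x \<le> c * (y - x)"
  shows "D \<le> c"
proof (rule ccontr)
  assume "\<not> D \<le> c"
  moreover have "((\<lambda>x. v x - c * x) has_real_derivative (D - c)) (at x)"
    by (auto intro!: derivative_eq_intros assms(1))
  ultimately obtain d where d: "d > 0" "\<And>h. 0 < h \<Longrightarrow> h < d \<Longrightarrow> v x - c * x < v (x + h) - c * (x + h)"
    using DERIV_pos_inc_right[of "\<lambda>x. v x - c * x" "D - c" x] by auto
  define h where "h = min (d / 2) 1"
  have h: "0 < h" "h < d" "h \<le> 1" using d(1) by (auto simp: h_def)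
  show False using d(2)[OF h(1,2)] assms(2)[of "x + h"] h by (simp add: algebra_simps)
qed

lemma zero_between:
  assumes u: "cper u" and d: "\<And>x. (u has_real_derivative v x) (at x)"
  obtains z where "x < z" "z < x + 1" "v z = 0"
proof -
  obtain z where "x < z" "z < x + 1" "u (x + 1) - u x = ((x + 1) - x) * v z"
    using MVT2[of x "x + 1" u v] d by auto
  then show ?thesis using that[of z] cperD(1)[OF u] by simp
qed

text \<open>The derivative \<open>v\<close> of a periodic function vanishes within distance 1 on
  either side of \<open>x\<close>; the one-sided slope bound towards these two zeros bounds
  \<open>v x\<close> from below and above.\<close>

lemma one_sided_slope_bound:
  assumes u: "cper u" and d: "\<And>x. (u has_real_derivative v x) (at x)" and c: "c \<ge> 0"
    and sl: "\<And>x y. x \<le> y \<Longrightarrow> y \<le> x + 1 \<Longrightarrow> v y - v x \<le> c * (y - x)"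
  shows "\<bar>v x\<bar> \<le> c"
proof -
  obtain z where z: "x < z" "z < x + 1" "v z = 0" using zero_between[OF u d, of x] by blast
  have "c * (z - x) \<le> c * 1" using z c by (intro mult_left_mono) auto
  then have 1: "- v x \<le> c" using sl[of x z] z by simp
  obtain y where y: "x - 1 < y" "y < (x - 1) + 1" "v y = 0" using zero_between[OF u d, of "x - 1"] by blast
  have "c * (x - y) \<le> c * 1" using y c by (intro mult_left_mono) auto
  then have "v x \<le> c" using sl[of y x] y by simp
  then show ?thesis using 1 by simp
qed

text \<open>Stated for arbitrary \<open>b\<close>, whether or not the series is differentiable,
  because \<open>doubling_maximum\<close> asks for periodicity at all times.\<close>

lemma deriv_syn_periodic: "deriv (syn b) (x + of_int n) = deriv (syn b) x"
proof -
  have "syn b (x + 1) = syn b x" for x by (simp add: syn_def cs_def ek_periodic)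
  then have "(\<lambda>x. syn b (x + 1)) = syn b" by blast
  moreover have "deriv (\<lambda>x. syn b (x + 1)) x = deriv (syn b) (x + 1)" for x
    by (simp add: deriv_def DERIV_shift)
  ultimately have 1: "deriv (syn b) (x + 1) = deriv (syn b) x" for x by metis
  have nat: "deriv (syn b) (x + real n) = deriv (syn b) x" for x and n :: nat
    by (induction n) (auto simp: add.assoc[symmetric] 1 add.commute[of 1])
  show ?thesis
  proof (cases "n \<ge> 0")
    case True then show ?thesis using nat[of x "nat n"] by simp
  next
    case False then show ?thesis using nat[of "x + of_int n" "nat (- n)"] by simp
  qed
qed

lemma sol_ux_doubled:
  assumes "sol s T R a" "R \<ge> 0" "s > 5/2"
  shows "continuous_on ({0..T} \<times> UNIV) (\<lambda>p. deriv (syn (a (fst p))) (snd (snd p)) - deriv (syn (a (fst p))) (fst (snd p)))"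
proof -
  define v where "v t = deriv (syn (a t))" for t
  have c: "continuous_on ({0..T} \<times> UNIV) (\<lambda>p. v (fst p) (snd p))"
    using sol_ux_continuous[OF assms] by (simp add: case_prod_beta' v_def)
  have "continuous_on ({0..T} \<times> UNIV) (\<lambda>p. v (fst (fst p, snd (snd p))) (snd (fst p, snd (snd p))))"
    by (rule continuous_on_compose2[OF c]) (auto intro!: continuous_intros)
  moreover have "continuous_on ({0..T} \<times> UNIV) (\<lambda>p. v (fst (fst p, fst (snd p))) (snd (fst p, fst (snd p))))"
    by (rule continuous_on_compose2[OF c]) (auto intro!: continuous_intros)
  ultimately show ?thesis unfolding v_def fst_conv snd_conv by (rule continuous_on_diff)
qed

text \<open>Propagation of \<open>A u \<ge> 0\<close>, i.e. of \<open>u\<^sub>x\<^sub>x \<le> \<mu>(u)\<close>, in the form of an Oleinik-type slope bound for \<open>u\<^sub>x\<close>: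
  this needs only \<open>u\<^sub>x \<in> C\<^sup>1\<close>, whereas the momentum \<open>A u\<close> itself need not be differentiable.\<close>

lemma upper_slope:
  assumes a: "sol s T R a" and R: "R \<ge> 0" and s: "s > 5/2"
    and m: "mu (syn (a 0)) = m" "m \<ge> 0" and init: "\<And>x. deriv (deriv (syn (a 0))) x \<le> m"
    and t: "t \<in> {0..T}" and xy: "x \<le> y" "y \<le> x + 1"
  shows "deriv (syn (a t)) y - deriv (syn (a t)) x \<le> m * (y - x)"
proof -
  define u where "u t = syn (a t)" for t
  define v where "v t = deriv (u t)" for t
  \<comment> \<open>The excess over the slope m: 0 on the diagonal and -m at y = x + 1, where the
    two slopes coincide.\<close>
  define w where "w t x y = v t y - v t x - m * (y - x)" for t x y
  define B where "B = zt (s - 1) * R"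
  have T0: "0 \<in> {0..T}" using t by auto
  have S: "cper (u t)" "hsb s R (fcoeff (u t))" if "t \<in> {0..T}" for t
    using sol_syn[OF a R s that] by (auto simp: u_def)
  note r = regularity[OF S R s, folded v_def]
  have vper: "v t (x + of_int n) = v t x" for t x n
    unfolding v_def u_def by (rule deriv_syn_periodic)
  have vc: "v t (x + 1) = v t x" for t x using vper[of t x 1] by simp
  have "w t x y \<le> 0"
  proof (rule doubling_maximum[where L = "m / 2 + B", OF _ _ _ _ _ _ t xy])
    show "continuous_on ({0..T} \<times> UNIV) (\<lambda>(t, x, y). w t x y)"
      unfolding w_def v_def u_def case_prod_beta'
      by (rule continuous_on_diff[OF sol_ux_doubled[OF a R s]]) (intro continuous_intros)
    show "w t (x + of_int n) (y + of_int n) = w t x y" for t x y n by (simp add: w_def vper)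
    show "w t x x \<le> 0" "w t x (x + 1) \<le> 0" for t x using m(2) by (simp_all add: w_def vc)
    show "w 0 x y \<le> 0" if "x \<le> y" "y \<le> x + 1" for x y
    proof -
      have "v 0 y - v 0 x \<le> m * (y - x)"
        by (rule slope_le[OF r(5)[OF T0 T0] _ that(1)]) (use init in \<open>simp add: v_def u_def\<close>)
      then show ?thesis by (simp add: w_def)
    qed
    fix t x y assume t: "t \<in> {0..T}" and xy: "x < y" "y < x + 1" and pos: "w t x y > 0"
      and mx: "\<And>x' y'. x' \<le> y' \<Longrightarrow> y' \<le> x' + 1 \<Longrightarrow> w t x' y' \<le> w t x y"
    define W where "W = w t x y"
    have mt: "mu (u t) = m" using sol_mu[OF a R s t] m(1) by (simp add: u_def)
    have dv: "(v t has_real_derivative deriv (v t) x) (at x)" for x by (rule r(5)[OF t t])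
    have wx: "((\<lambda>x. w t x y) has_real_derivative (- deriv (v t) x + m)) (at x)"
      unfolding w_def by (rule derivative_eq_intros dv refl | simp)+
    have wy: "((\<lambda>y. w t x y) has_real_derivative (deriv (v t) y - m)) (at y)"
      unfolding w_def by (rule derivative_eq_intros dv refl | simp)+
    \<comment> \<open>Both partial derivatives vanish at the interior maximum, so u_xx = m at both
      points and the transport terms become explicit.\<close>
    note im = interior_max_derivs[where W = "w t" and x = x and y = y, OF xy mx wx wy]
    have vx: "deriv (v t) x = m" "deriv (v t) y = m" using im by auto
    have vyW: "v t y = v t x + m * (y - x) + W" by (simp add: W_def w_def)
    have Wpos: "W > 0" using pos by (simp add: W_def)
    \<comment> \<open>Maximality against all pairs (x, z) with z up to y is integrated over z; this
      controls the increment of \<open>u\<close>, which the values at the two endpoints do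
      not.\<close>
    have du: "u t y - u t x \<le> v t x * (y - x) + m / 2 * (y - x)\<^sup>2 + W * (y - x)"
    proof -
      define h where "h z = u t z - v t x * (z - x) - m / 2 * (z - x)\<^sup>2 - W * (z - x)" for z
      have "h y \<le> h x"
      proof (rule DERIV_nonpos_imp_nonincreasing[where f = h])
        fix z assume z: "x \<le> z" "z \<le> y"
        have "(h has_real_derivative (v t z - v t x - m * (z - x) - W)) (at z)"
          unfolding h_def by (rule derivative_eq_intros r(1)[OF t t] refl | simp)+
        moreover have "v t z - v t x - m * (z - x) - W \<le> 0"
          using mx[of x z] z xy by (simp add: w_def W_def)
        ultimately show "\<exists>D. (h has_real_derivative D) (at z) \<and> D \<le> 0" by blast
      qed (use xy in simp)
      then show ?thesis by (simp add: h_def)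
    qed
    define D where "D = - (u t y * m + 1/2 * (v t y)\<^sup>2 - 2 * m * u t y + mu (flux (u t)))
       + (u t x * m + 1/2 * (v t x)\<^sup>2 - 2 * m * u t x + mu (flux (u t)))"
    have "((\<lambda>t. w t x y) has_real_derivative D) (at t within {0..T})"
    proof -
      have *: "((\<lambda>t. v t x) has_real_derivative
        - (u t x * deriv (v t) x + 1/2 * (v t x)\<^sup>2 - 2 * m * u t x + mu (flux (u t)))) (at t within {0..T})" for x
        using sol_ux_deriv[OF a R s t, of x] mt by (simp add: u_def v_def)
      show ?thesis unfolding w_def D_def
        by (rule DERIV_cong[OF DERIV_diff[OF DERIV_diff[OF *[of y] *[of x]] DERIV_const]]) (simp add: vx)
    qed
    moreover have "D \<le> (m / 2 + B) * W"
    proof -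
      \<comment> \<open>The constant \<open>mu (flux u)\<close> cancels between the two points, and
        the squares leave the mean slope \<open>A\<close>. The bracket \<open>Br\<close> is at most
        W (y - x) / 2 and \<open>A\<close> is at least -B, hence the rate m / 2 + B.\<close>
      define A where "A = (v t x + v t y) / 2"
      define Br where "Br = u t y - u t x - A * (y - x)"
      have "D = m * (u t y - u t x) - A * (v t y - v t x)"
        by (simp add: D_def A_def power2_eq_square field_simps)
      also have "\<dots> = m * Br - A * W" unfolding Br_def vyW by (simp add: algebra_simps)
      finally have D: "D = m * Br - A * W" .
      have "Br \<le> v t x * (y - x) + m / 2 * (y - x)\<^sup>2 + W * (y - x) - A * (y - x)" using du by (simp add: Br_def)
      also have "\<dots> = W / 2 * (y - x)" unfolding A_def vyW by (simp add: power2_eq_square field_simps)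
      also have "\<dots> \<le> W / 2 * 1" using Wpos xy by (intro mult_left_mono) auto
      finally have "m * Br \<le> m * (W / 2)" using m(2) by (intro mult_left_mono) auto
      moreover have "- A * W \<le> B * W"
      proof -
        have "\<bar>v t x\<bar> \<le> B" "\<bar>v t y\<bar> \<le> B" using sol_ux(2)[OF a R s t] by (simp_all add: B_def v_def u_def)
        moreover have "2 * A = v t x + v t y" by (simp add: A_def)
        ultimately have "- A \<le> B" by linarith
        then show ?thesis using Wpos by (intro mult_right_mono) auto
      qed
      ultimately show ?thesis unfolding D by (simp add: algebra_simps)
    qed
    ultimately show "\<exists>D. ((\<lambda>t. w t x y) has_real_derivative D) (at t within {0..T}) \<and> D \<le> (m / 2 + B) * w t x y"
      unfolding W_def by blast
  qed
  then show ?thesis by (simp add: w_def v_def u_def)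
qed

text \<open>The excess is now measured against a growing slope \<open>B t\<close>. At an interior
  maximum u_xx = -B at both points; with |u_x| <= m from \<open>upper_slope\<close>, the terms
  proportional to y - x have coefficient at most 2 m (B + m) - B', so \<open>B\<close> is chosen to
  solve B' = 2 m (B + m) with B 0 = b. The rate involves the mean but not the radius R.\<close>

lemma lower_slope:
  assumes a: "sol s T R a" and R: "R \<ge> 0" and s: "s > 5/2"
    and m: "mu (syn (a 0)) = m" "m \<ge> 0" and init: "\<And>x. deriv (deriv (syn (a 0))) x \<le> m"
    and low: "\<And>x. - b \<le> deriv (deriv (syn (a 0))) x" "b \<ge> 0"
    and t: "t \<in> {0..T}" and xy: "x \<le> y" "y \<le> x + 1"
  shows "- ((b + m) * exp (2 * m * t)) * (y - x) \<le> deriv (syn (a t)) y - deriv (syn (a t)) x"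
proof -
  define u where "u t = syn (a t)" for t
  define v where "v t = deriv (u t)" for t
  define B where "B t = (b + m) * exp (2 * m * t) - m" for t
  define w where "w t x y = - (v t y - v t x) - B t * (y - x)" for t x y
  have T0: "0 \<in> {0..T}" using t by auto
  have S: "cper (u t)" "hsb s R (fcoeff (u t))" if "t \<in> {0..T}" for t
    using sol_syn[OF a R s that] by (auto simp: u_def)
  note r = regularity[OF S R s, folded v_def]
  have vper: "v t (x + of_int n) = v t x" for t x n
    unfolding v_def u_def by (rule deriv_syn_periodic)
  have vc: "v t (x + 1) = v t x" for t x using vper[of t x 1] by simp
  have B0: "B t \<ge> 0" if "t \<in> {0..T}" for t
  proof -
    have "1 \<le> exp (2 * m * t)" using that m(2) by simp
    then have "(b + m) * 1 \<le> (b + m) * exp (2 * m * t)" using m(2) low(2) by (intro mult_left_mono) auto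
    then show ?thesis using low(2) by (simp add: B_def)
  qed
  have vm: "\<bar>v t x\<bar> \<le> m" if t: "t \<in> {0..T}" for t x
    by (rule one_sided_slope_bound[OF S(1)[OF t] r(1)[OF t t] m(2)])
       (use upper_slope[OF a R s m init t] in \<open>simp add: v_def u_def\<close>)
  have "w t x y \<le> 0"
  proof (rule doubling_maximum[where L = m, OF _ _ _ _ _ _ t xy])
    have "continuous_on ({0..T} \<times> UNIV) (\<lambda>p. - (v (fst p) (snd (snd p)) - v (fst p) (fst (snd p))) - B (fst p) * (snd (snd p) - fst (snd p)))"
      unfolding B_def v_def u_def
      by (rule continuous_on_diff[OF continuous_on_minus[OF sol_ux_doubled[OF a R s]]]) (intro continuous_intros)
    then show "continuous_on ({0..T} \<times> UNIV) (\<lambda>(t, x, y). w t x y)"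
      unfolding w_def case_prod_beta' .
    show "w t (x + of_int n) (y + of_int n) = w t x y" for t x y n by (simp add: w_def vper)
    show "w t x x \<le> 0" for t x by (simp add: w_def)
    show "w t x (x + 1) \<le> 0" if "t \<in> {0..T}" for t x using B0[OF that] by (simp add: w_def vc)
    show "w 0 x y \<le> 0" if "x \<le> y" "y \<le> x + 1" for x y
    proof -
      have "- v 0 y - - v 0 x \<le> b * (y - x)"
      proof (rule slope_le[OF _ _ that(1)])
        show "((\<lambda>x. - v 0 x) has_real_derivative - deriv (v 0) z) (at z)" for z by (intro DERIV_minus r(5)[OF T0 T0])
        show "- deriv (v 0) z \<le> b" for z using low(1)[of z] by (simp add: v_def u_def)
      qed
      then show ?thesis by (simp add: w_def B_def)
    qed
    fix t x y assume t: "t \<in> {0..T}" and xy: "x < y" "y < x + 1" and pos: "w t x y > 0"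
      and mx: "\<And>x' y'. x' \<le> y' \<Longrightarrow> y' \<le> x' + 1 \<Longrightarrow> w t x' y' \<le> w t x y"
    define W where "W = w t x y"
    have mt: "mu (u t) = m" using sol_mu[OF a R s t] m(1) by (simp add: u_def)
    have dv: "(v t has_real_derivative deriv (v t) x) (at x)" for x by (rule r(5)[OF t t])
    have wx: "((\<lambda>x. w t x y) has_real_derivative (deriv (v t) x + B t)) (at x)"
      unfolding w_def by (rule derivative_eq_intros dv refl | simp)+
    have wy: "((\<lambda>y. w t x y) has_real_derivative (- deriv (v t) y - B t)) (at y)"
      unfolding w_def by (rule derivative_eq_intros dv refl | simp)+
    note im = interior_max_derivs[where W = "w t" and x = x and y = y, OF xy mx wx wy]
    have vx: "deriv (v t) x = - B t" "deriv (v t) y = - B t" using im by auto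
    have vyW: "v t y = v t x - W - B t * (y - x)" by (simp add: W_def w_def)
    have Wpos: "W > 0" using pos by (simp add: W_def)
    have du: "u t x - u t y \<le> m * (y - x)"
    proof -
      have "- u t y - - u t x \<le> m * (y - x)"
      proof (rule slope_le)
        show "((\<lambda>x. - u t x) has_real_derivative - v t z) (at z)" for z by (intro DERIV_minus r(1)[OF t t])
        show "- v t z \<le> m" for z using vm[OF t, of z] by (simp add: abs_le_iff)
      qed (use xy in simp)
      then show ?thesis by simp
    qed
    define D where "D = (u t y * (- B t) + 1/2 * (v t y)\<^sup>2 - 2 * m * u t y + mu (flux (u t)))
       - (u t x * (- B t) + 1/2 * (v t x)\<^sup>2 - 2 * m * u t x + mu (flux (u t))) - (2 * m * (B t + m)) * (y - x)"
    have "((\<lambda>t. w t x y) has_real_derivative D) (at t within {0..T})"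
    proof -
      have *: "((\<lambda>t. v t x) has_real_derivative
        - (u t x * deriv (v t) x + 1/2 * (v t x)\<^sup>2 - 2 * m * u t x + mu (flux (u t)))) (at t within {0..T})" for x
        using sol_ux_deriv[OF a R s t, of x] mt by (simp add: u_def v_def)
      have b: "((\<lambda>t. B t * (y - x)) has_real_derivative (2 * m * (B t + m)) * (y - x)) (at t within {0..T})"
        unfolding B_def by (auto intro!: derivative_eq_intros)
      show ?thesis unfolding w_def D_def
        by (rule DERIV_cong[OF DERIV_diff[OF DERIV_minus[OF DERIV_diff[OF *[of y] *[of x]]] b]]) (simp add: vx)
    qed
    moreover have "D \<le> m * W"
    proof -
      define A where "A = (v t x + v t y) / 2"
      have "D = (B t + 2 * m) * (u t x - u t y) + A * (v t y - v t x) - (2 * m * (B t + m)) * (y - x)"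
        by (simp add: D_def A_def power2_eq_square field_simps)
      also have "\<dots> = (B t + 2 * m) * (u t x - u t y) - A * (W + B t * (y - x)) - (2 * m * (B t + m)) * (y - x)"
        unfolding vyW by (simp add: algebra_simps)
      finally have D: "D = (B t + 2 * m) * (u t x - u t y) - A * (W + B t * (y - x)) - (2 * m * (B t + m)) * (y - x)" .
      have "(B t + 2 * m) * (u t x - u t y) \<le> (B t + 2 * m) * (m * (y - x))"
        using du B0[OF t] m(2) by (intro mult_left_mono) auto
      moreover have "- A * (W + B t * (y - x)) \<le> m * (W + B t * (y - x))"
      proof -
        have "2 * A = v t x + v t y" by (simp add: A_def)
        then have "- A \<le> m" using vm[OF t, of x] vm[OF t, of y] by linarith
        then show ?thesis using Wpos B0[OF t] xy by (intro mult_right_mono) auto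
      qed
      ultimately show ?thesis unfolding D by (simp add: algebra_simps)
    qed
    ultimately show "\<exists>D. ((\<lambda>t. w t x y) has_real_derivative D) (at t within {0..T}) \<and> D \<le> m * w t x y"
      unfolding W_def by blast
  qed
  then have "- (v t y - v t x) \<le> B t * (y - x)" by (simp add: w_def)
  also have "\<dots> \<le> (b + m) * exp (2 * m * t) * (y - x)"
    using xy m(2) by (intro mult_right_mono) (auto simp: B_def)
  finally show ?thesis by (simp add: v_def u_def)
qed

text \<open>An H^2 bound turned by \<open>zt 1\<close> into an l^1 bound of first derivatives. The
  squared bracket is the sum of the upper and the lower bound of u_xx; the 4 comes from jb^2 <= 2 (2
  pi k)^2 for k nonzero, and \<open>m^2\<close> is mode 0. No Sobolev radius enters.\<close>

definition l1_apriori :: "real \<Rightarrow> real \<Rightarrow> real \<Rightarrow> real" where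
  "l1_apriori m b T = zt 1 * sqrt (4 * (m + (b + m) * exp (2 * m * T))\<^sup>2 + m\<^sup>2)"

text \<open>The time T' lets solutions on shorter intervals share one constant, which is fixed
  before the continuation starts.\<close>

lemma apriori_l1:
  assumes a: "sol s T R a" and R: "R \<ge> 0" and s: "s > 5/2"
    and m: "mu (syn (a 0)) = m" "m \<ge> 0" and init: "\<And>x. deriv (deriv (syn (a 0))) x \<le> m"
    and low: "\<And>x. - b \<le> deriv (deriv (syn (a 0))) x" "b \<ge> 0"
    and t: "t \<in> {0..T}" and T: "T \<le> T'" and F: "finite F"
  shows "(\<Sum>k\<in>F. jb k * cmod (a t k)) \<le> l1_apriori m b T'"
proof -
  define u where "u = syn (a t)"
  define H where "H = m + (b + m) * exp (2 * m * T')"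
  have S: "cper u" "fcoeff u = a t" "hsb s R (fcoeff u)" using sol_syn[OF a R s t] by (auto simp: u_def)
  note r = regularity[OF S(1,3) R s]
  have bm: "(b + m) * exp (2 * m * t) \<le> (b + m) * exp (2 * m * T')"
    using m(2) low(2) t T by (intro mult_left_mono) (auto intro!: mult_left_mono)
  have bm0: "(b + m) * exp (2 * m * t) \<ge> 0" using m(2) low(2) by simp
  have u2: "\<bar>deriv (deriv u) x\<bar> \<le> H" for x
  proof -
    have "deriv (deriv u) x \<le> m"
      by (rule deriv_le_slope[OF r(5)]) (use upper_slope[OF a R s m init t] in \<open>simp add: u_def\<close>)
    moreover have "- deriv (deriv u) x \<le> (b + m) * exp (2 * m * t)"
      by (rule deriv_le_slope[OF DERIV_minus[OF r(5)]])
         (use lower_slope[OF a R s m init low t] in \<open>force simp: u_def\<close>)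
    ultimately show ?thesis using bm bm0 m(2) by (auto simp: abs_le_iff H_def)
  qed
  have "(\<Sum>k\<in>F. (cmod (fcoeff (deriv (deriv u)) k))\<^sup>2) \<le> integral {0..1} (\<lambda>x. (deriv (deriv u) x)\<^sup>2)"
    by (rule bessel[OF r(6) F])
  also have "\<dots> \<le> integral {0..1} (\<lambda>x :: real. H\<^sup>2)"
  proof (rule integral_le)
    show "(deriv (deriv u) x)\<^sup>2 \<le> H\<^sup>2" for x
      using u2[of x] abs_le_square_iff[of "deriv (deriv u) x" H] by linarith
  qed (intro integrable_continuous_real continuous_intros cperD(2)[OF r(6)])+
  finally have bes: "(\<Sum>k\<in>F. (cmod (fcoeff (deriv (deriv u)) k))\<^sup>2) \<le> H\<^sup>2" by simp
  have "mu u = m" using sol_mu[OF a R s t] m(1) by (simp add: u_def)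
  then have a0: "cmod (a t 0) = m" using fcoeff_0[OF S(1)] S(2) m(2) by simp
  have tm: "(jb k powr 1 * (jb k * cmod (a t k)))\<^sup>2 \<le> 4 * (cmod (fcoeff (deriv (deriv u)) k))\<^sup>2 + (if k = 0 then m\<^sup>2 else 0)" for k
  proof (cases "k = 0")
    case True
    then show ?thesis using a0 by (simp add: jb_def)
  next
    case False
    have k1: "1 \<le> \<bar>real_of_int k\<bar>" using False by linarith
    have "1 * 1 \<le> (2 * pi) * \<bar>real_of_int k\<bar>" using k1 pi_gt3 by (intro mult_mono) auto
    then have "1 * 1 \<le> (2 * pi * \<bar>real_of_int k\<bar>) * (2 * pi * \<bar>real_of_int k\<bar>)" by (intro mult_mono) auto
    then have "1 \<le> (2 * pi * of_int k)\<^sup>2" by (simp add: power2_eq_square)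
    then have j: "(jb k)\<^sup>2 \<le> 2 * (2 * pi * of_int k)\<^sup>2" by (simp add: jb_sq)
    have "cmod (fcoeff (deriv (deriv u)) k) = (2 * pi * of_int k)\<^sup>2 * cmod (a t k)"
      unfolding r(7) S(2) norm_mult by (simp add: power2_eq_square)
    then have "jb k powr 1 * (jb k * cmod (a t k)) \<le> 2 * cmod (fcoeff (deriv (deriv u)) k)"
      using mult_right_mono[OF j, of "cmod (a t k)"] jb_nonneg[of k] by (simp add: power2_eq_square mult.assoc)
    then have "(jb k powr 1 * (jb k * cmod (a t k)))\<^sup>2 \<le> (2 * cmod (fcoeff (deriv (deriv u)) k))\<^sup>2"
      by (intro power_mono) (auto simp: jb_nonneg)
    then show ?thesis using False by (simp add: power_mult_distrib)
  qed
  have "(\<Sum>k\<in>F. jb k * cmod (a t k)) \<le> zt 1 * sqrt (\<Sum>k\<in>F. (jb k powr 1 * (jb k * cmod (a t k)))\<^sup>2)"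
    by (rule l1_bound[OF _ F]) (auto simp: jb_nonneg)
  also have "\<dots> \<le> zt 1 * sqrt (4 * H\<^sup>2 + m\<^sup>2)"
  proof (intro mult_left_mono real_sqrt_le_mono zt_nonneg)
    have "(\<Sum>k\<in>F. (jb k powr 1 * (jb k * cmod (a t k)))\<^sup>2)
      \<le> (\<Sum>k\<in>F. 4 * (cmod (fcoeff (deriv (deriv u)) k))\<^sup>2 + (if k = 0 then m\<^sup>2 else 0))" by (intro sum_mono tm)
    also have "\<dots> = 4 * (\<Sum>k\<in>F. (cmod (fcoeff (deriv (deriv u)) k))\<^sup>2) + (\<Sum>k\<in>F. if k = 0 then m\<^sup>2 else 0)"
      by (simp add: sum.distrib sum_distrib_left)
    also have "(\<Sum>k\<in>F. if k = 0 then m\<^sup>2 else 0) \<le> m\<^sup>2" using F by (simp add: sum.delta)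
    also have "4 * (\<Sum>k\<in>F. (cmod (fcoeff (deriv (deriv u)) k))\<^sup>2) \<le> 4 * H\<^sup>2" using bes by simp
    finally show "(\<Sum>k\<in>F. (jb k powr 1 * (jb k * cmod (a t k)))\<^sup>2) \<le> 4 * H\<^sup>2 + m\<^sup>2" by simp
  qed
  finally show ?thesis by (simp add: l1_apriori_def H_def)
qed

text \<open>K, and with it the radius R, is fixed for the whole interval before any solution is
  known. A step of length d starts in the ball of radius R and stays in the ball of radius 3 R; the
  a priori bound and \<open>tame\<close> put its endpoint back into the ball of radius R, so the
  steps never shrink.\<close>

lemma forward_existence:
  assumes s: "s > 5/2" and a0: "symm a0" "hsb s R0 a0" "R0 > 0"
    and m: "mu (syn a0) = m" "m \<ge> 0" and init: "\<And>x. deriv (deriv (syn a0)) x \<le> m" and T: "T \<ge> 0"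
  shows "\<exists>R a. R > 0 \<and> sol s T R a \<and> a 0 = a0"
proof -
  have as: "asum a0" using asum_0[OF a0(2)] a0(3) s by simp
  have c0: "cper (syn a0)" "hsb s R0 (fcoeff (syn a0))"
    using syn_cper[OF as] a0(2) fcoeff_syn[OF as a0(1)] by (auto simp: hsb_def)
  have R0: "R0 \<ge> 0" using a0(3) by simp
  have u2: "cper (deriv (deriv (syn a0)))" by (rule regularity(6)[OF c0 R0 s])
  have "bounded (deriv (deriv (syn a0)) ` {0..1})"
    by (intro compact_imp_bounded compact_continuous_image cperD(2)[OF u2]) auto
  then obtain b' where b': "\<forall>x\<in>{0..1}. \<bar>deriv (deriv (syn a0)) x\<bar> \<le> b'" unfolding bounded_iff by auto
  define b where "b = max 0 b'"
  have low: "- b \<le> deriv (deriv (syn a0)) x" for x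
  proof -
    have "frac x \<in> {0..1}" using frac_ge_0[of x] frac_lt_1[of x] by auto
    then have "\<bar>deriv (deriv (syn a0)) (frac x)\<bar> \<le> b'" using b' by blast
    moreover have "deriv (deriv (syn a0)) (frac x) = deriv (deriv (syn a0)) x"
      using cper_int[OF u2, of "frac x" "\<lfloor>x\<rfloor>"] by (simp add: frac_def)
    ultimately show ?thesis by (auto simp: b_def abs_le_iff)
  qed
  have b0: "b \<ge> 0" by (simp add: b_def)
  define K where "K = l1_apriori m b T"
  have K: "K \<ge> 0" unfolding K_def l1_apriori_def by (intro mult_nonneg_nonneg zt_nonneg real_sqrt_ge_zero) auto
  define R where "R = R0 * exp (en_const s * K * T)"
  have ec: "en_const s \<ge> 0" using en_const_pos[of s] s by simp
  have e1: "1 \<le> exp (en_const s * K * T)" using ec K T by simp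
  have R: "R > 0" "R0 \<le> R" using a0(3) e1 by (auto simp: R_def)
  have g: "gal_const s * R > 0" using gal_const_pos[of s] s R by simp
  \<comment> \<open>The lifespan that \<open>local_existence\<close> grants to data of radius
    R.\<close>
  define d where "d = 1 / (2 * (gal_const s * R))"
  have d: "d > 0" "gal_const s * R * d = 1/2" using g by (auto simp: d_def field_simps)
  have claim: "\<exists>a. sol s (min T (real n * d)) (3 * R) a \<and> a 0 = a0" for n
  proof (induction n)
    case 0
    have "hsb s (3 * R) a0" using hsb_mono[OF a0(2), of "3 * R"] a0(3) R by simp
    obtain a where "sol s 0 (3 * R) a" "a 0 = a0"
      using local_existence[OF s R(1) a0(1) hsb_mono[OF a0(2) R0 R(2)], of 0] by auto
    then show ?case using T by auto
  next
    case (Suc n)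
    then obtain a where a: "sol s (min T (real n * d)) (3 * R) a" "a 0 = a0" by blast
    define t where "t = min T (real n * d)"
    have t: "0 \<le> t" "t \<le> T" using T d by (auto simp: t_def)
    have tt: "t \<in> {0..t}" using t by simp
    have a': "sol s t (3 * R) a" using a by (simp add: t_def)
    have R3: "3 * R > 0" "3 * R \<ge> 0" using R by auto
    have "hsb s (R0 * exp (en_const s * K * t)) (a t)"
    proof (rule tame[OF s R3(1) a' _ _ K _ tt])
      show "(\<Sum>k\<in>F. jb k * cmod (a t' k)) \<le> K" if "t' \<in> {0..t}" "finite F" for t' F
        unfolding K_def
        by (rule apriori_l1[OF a' R3(2) s _ m(2) _ _ b0 that(1) t(2) that(2)]) (use a(2) m init low in auto)
    qed (use a0 a in auto)
    then have hT: "hsb s R (a t)"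
    proof (rule hsb_mono)
      have "exp (en_const s * K * t) \<le> exp (en_const s * K * T)" using ec K t by (auto intro!: mult_left_mono)
      then show "R0 * exp (en_const s * K * t) \<le> R" unfolding R_def using a0(3) by (intro mult_left_mono) auto
    qed (use a0 in auto)
    define t' where "t' = min T (real (Suc n) * d) - t"
    have t': "t' \<ge> 0" "t' \<le> d" "t + t' = min T (real (Suc n) * d)" using d by (auto simp: t'_def t_def algebra_simps min_def)
    have "gal_const s * R * t' \<le> gal_const s * R * d" using g t' by (intro mult_left_mono) auto
    then obtain c where c: "sol s t' (3 * R) c" "c 0 = a t"
      using local_existence[OF s R(1) solD(1)[OF a' tt] hT t'(1)] d(2) by auto
    have "sol s (t + t') (3 * R) (\<lambda>x. if x \<in> {0..t} then a x else c (x - t))"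
      by (rule sol_concat[OF a' c t(1) t'(1)])
    then show ?case unfolding t'(3) using a(2) t by (intro exI[of _ "\<lambda>x. if x \<in> {0..t} then a x else c (x - t)"]) auto
  qed
  obtain n where "T \<le> real n * d" using reals_Archimedean3[OF d(1)] less_imp_le by blast
  then show ?thesis using claim[of n] R by (intro exI[of _ "3 * R"]) (auto simp: min_absorb1)
qed

subsection \<open>Global solutions in Fourier space\<close>

text \<open>The radius may depend on the time interval, since the a priori bounds grow with
  time.\<close>

definition gsol :: "real \<Rightarrow> (real \<Rightarrow> int \<Rightarrow> complex) \<Rightarrow> bool" where
  "gsol s a \<longleftrightarrow> (\<forall>t. symm (a t)) \<and> (\<forall>T. \<exists>R\<ge>0. \<forall>t\<in>{-T..T}. hsb s R (a t)) \<and>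
     (\<forall>t k. ((\<lambda>t. a t k) has_vector_derivative qconv (a t) (a t) k) (at t))"

lemma sol_cong:
  assumes a: "sol s T R a" and ab: "\<And>t. t \<in> {0..T} \<Longrightarrow> b t = a t"
  shows "sol s T R b"
  unfolding sol_def
proof safe
  fix t k assume t: "t \<in> {0..T}"
  show "symm (b t)" "hsb s R (b t)" using solD(1,2)[OF a t] ab[OF t] by auto
  show "((\<lambda>t. b t k) has_vector_derivative qconv (b t) (b t) k) (at t within {0..T})"
    unfolding ab[OF t] by (rule has_vector_derivative_transform[OF t _ solD(3)[OF a t]]) (simp add: ab)
qed

lemma sol_mono: "sol s T R a \<Longrightarrow> R \<ge> 0 \<Longrightarrow> R \<le> R' \<Longrightarrow> sol s T R' a"
  unfolding sol_def using hsb_mono by blast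

lemma sol_restrict: "sol s T R a \<Longrightarrow> T' \<le> T \<Longrightarrow> sol s T' R a"
  using sol_shift[of s T R a 0 T'] by simp

lemma forward_half_line:
  assumes s: "s > 5/2" and A: "\<And>T. T \<ge> 0 \<Longrightarrow> \<exists>R a. R > 0 \<and> sol s T R a \<and> a 0 = a0"
  shows "\<exists>a. a 0 = a0 \<and> (\<forall>T\<ge>0. \<exists>R>0. sol s T R a)"
proof -
  obtain R A where RA: "\<And>T. T \<ge> 0 \<Longrightarrow> R T > 0 \<and> sol s T (R T) (A T) \<and> A T 0 = a0"
    using A by metis
  \<comment> \<open>Diagonal choice; uniqueness on [0,t] makes it agree with every
    \<open>A T\<close> for T >= t.\<close>
  define a where "a t = A t t" for t
  have eq: "a t = A T t" if "0 \<le> t" "t \<le> T" for t T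
  proof -
    define M where "M = max (R t) (R T)"
    have M: "R t \<le> M" "R T \<le> M" "M \<ge> 0" using RA[of t] that by (auto simp: M_def)
    have "sol s t M (A t)" "sol s t M (A T)" "A t 0 = A T 0"
      using RA[of t] RA[of T] that sol_mono[OF _ _ M(1)] sol_mono[OF sol_restrict[of s T _ "A T" t] _ M(2)] by auto
    then show ?thesis unfolding a_def
      by (rule sol_unique[where a = "A t" and b = "A T" and T = t, OF s M(3)]) (use that in auto)
  qed
  have "a 0 = a0" using RA[of 0] by (simp add: a_def)
  moreover have "\<exists>R>0. sol s T R a" if "T \<ge> 0" for T
    using RA[OF that] sol_cong[of s T "R T" "A T" a] eq by auto
  ultimately show ?thesis by blast
qed

section \<open>Symmetries and extension to negative times\<close>

lemma qconv_reflect: "qconv (\<lambda>k. b (- k)) (\<lambda>k. b (- k)) k = - qconv b b (- k)"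
proof -
  have "qconv (\<lambda>k. b (- k)) (\<lambda>k. b (- k)) k = infsum (\<lambda>j. - (- \<i> * gam (- k) j * (b j * b (- k - j)))) UNIV"
    unfolding qconv_def
  proof (rule infsum_reindex_bij_witness[of UNIV uminus uminus])
    fix j
    have "gam (- k) (- j) = - gam k j" by (rule gam_minus)
    then show "- (- \<i> * gam (- k) (- j) * (b (- j) * b (- k - - j))) = - \<i> * gam k j * (b (- j) * b (- (k - j)))"
      by simp
  qed auto
  then show ?thesis by (simp add: infsum_uminus qconv_def)
qed

lemma qconv_neg: "qconv (\<lambda>k. - b k) (\<lambda>k. - b k) k = qconv b b k"
  by (simp add: qconv_def)

lemma hsb_neg: "hsb s R (\<lambda>k. - b k) \<longleftrightarrow> hsb s R b"
  by (simp add: hsb_def)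

lemma hsb_reflect: "hsb s R (\<lambda>k. b (- k)) \<longleftrightarrow> hsb s R b"
proof -
  have *: "hsb s R (\<lambda>k. b (- k))" if "hsb s R b" for b :: "int \<Rightarrow> complex"
    unfolding hsb_def
  proof safe
    fix S :: "int set" assume S: "finite S"
    have "(\<Sum>k\<in>S. (jb k powr s * cmod (b (- k)))\<^sup>2) = (\<Sum>k\<in>uminus ` S. (jb k powr s * cmod (b k))\<^sup>2)"
      by (subst sum.reindex) auto
    then show "(\<Sum>k\<in>S. (jb k powr s * cmod (b (- k)))\<^sup>2) \<le> R\<^sup>2" using hsbD[OF that, of "uminus ` S"] S by simp
  qed
  show ?thesis using *[of b] *[of "\<lambda>k. b (- k)"] by auto
qed

lemma symm_reflect: "symm b \<Longrightarrow> symm (\<lambda>k. b (- k))"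
  by (simp add: symm_def)

lemma vderiv_reverse:
  fixes f :: "real \<Rightarrow> 'a::real_normed_vector"
  assumes "(f has_vector_derivative D) (at (- t) within uminus ` S)"
  shows "((\<lambda>t. f (- t)) has_vector_derivative - D) (at t within S)"
proof -
  have "((\<lambda>t. - t) has_vector_derivative (- 1)) (at t within S)"
    by (auto intro!: derivative_eq_intros simp flip: has_real_derivative_iff_has_vector_derivative)
  from vector_diff_chain_within[OF this, of f D] assms show ?thesis by (simp add: o_def)
qed

text \<open>\<open>g\<close> runs forward from the reflected data; reflecting it in space and time
  continues \<open>f\<close> to negative times. At 0 the one-sided derivatives agree, as both are
  given by the equation at the same value.\<close>

lemma gsol_glue:
  assumes f: "\<And>T. T \<ge> 0 \<Longrightarrow> \<exists>R>0. sol s T R f" and g: "\<And>T. T \<ge> 0 \<Longrightarrow> \<exists>R>0. sol s T R g"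
    and fg: "g 0 = (\<lambda>k. f 0 (- k))"
  shows "gsol s (\<lambda>t. if t \<in> {0..} then f t else (\<lambda>k. g (- t) (- k)))"
proof -
  define h where "h t = (\<lambda>k. g (- t) (- k))" for t
  define a where "a t = (if t \<in> {0..} then f t else h t)" for t
  have fg0: "f 0 = h 0" by (simp add: h_def fg)
  have sy: "symm (a t)" for t
  proof (cases "t \<ge> 0")
    case True
    then show ?thesis using f[of t] solD(1)[of s t _ f t] by (auto simp: a_def)
  next
    case False
    then show ?thesis using g[of "- t"] solD(1)[of s "- t" _ g "- t"] by (auto simp: a_def h_def intro: symm_reflect)
  qed
  have bd: "\<exists>R\<ge>0. \<forall>t\<in>{-T..T}. hsb s R (a t)" for T
  proof -
    obtain R1 where R1: "R1 > 0" "sol s \<bar>T\<bar> R1 f" using f[of "\<bar>T\<bar>"] by auto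
    obtain R2 where R2: "R2 > 0" "sol s \<bar>T\<bar> R2 g" using g[of "\<bar>T\<bar>"] by auto
    have "hsb s (max R1 R2) (a t)" if "t \<in> {-T..T}" for t
    proof (cases "t \<ge> 0")
      case True
      then have "hsb s R1 (f t)" using solD(2)[OF R1(2), of t] that by auto
      then show ?thesis using True R1 by (auto simp: a_def intro: hsb_mono)
    next
      case False
      then have "hsb s R2 (g (- t))" using solD(2)[OF R2(2), of "- t"] that by auto
      then have "hsb s R2 (h t)" by (simp add: h_def hsb_reflect)
      then show ?thesis using False R2 by (auto simp: a_def intro: hsb_mono)
    qed
    then show ?thesis using R1 by (intro exI[of _ "max R1 R2"]) auto
  qed
  have df: "((\<lambda>t. f t k) has_vector_derivative qconv (f t) (f t) k) (at t within {0..})" if "t \<in> {0..}" for t k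
  proof -
    have "0 \<le> t + 1" using that by simp
    then obtain R where "sol s (t + 1) R f" using f by blast
    then have "((\<lambda>t. f t k) has_vector_derivative qconv (f t) (f t) k) (at t within {0..t + 1})"
      using solD(3) that by auto
    moreover have "at t within {0..t + 1} = at t within {0..}"
      by (rule at_within_nhd[of _ "{..<t + 1}"]) auto
    ultimately show ?thesis by simp
  qed
  have dg: "((\<lambda>t. g t k) has_vector_derivative qconv (g t) (g t) k) (at t within {0..})" if "t \<in> {0..}" for t k
  proof -
    have "0 \<le> t + 1" using that by simp
    then obtain R where "sol s (t + 1) R g" using g by blast
    then have "((\<lambda>t. g t k) has_vector_derivative qconv (g t) (g t) k) (at t within {0..t + 1})"
      using solD(3) that by auto
    moreover have "at t within {0..t + 1} = at t within {0..}"
      by (rule at_within_nhd[of _ "{..<t + 1}"]) auto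
    ultimately show ?thesis by simp
  qed
  have dh: "((\<lambda>t. h t k) has_vector_derivative qconv (h t) (h t) k) (at t within {..0})" if "t \<in> {..0}" for t k
  proof -
    have im: "uminus ` {..0} = {0 :: real..}" by auto
    have "((\<lambda>t. g (- t) (- k)) has_vector_derivative - qconv (g (- t)) (g (- t)) (- k)) (at t within {..0})"
      by (rule vderiv_reverse) (use dg[of "- t" "- k"] that im in auto)
    then show ?thesis by (simp add: h_def qconv_reflect)
  qed
  have da: "((\<lambda>t. a t k) has_vector_derivative qconv (a t) (a t) k) (at t)" for t k
  proof -
    have cl: "closure {0 :: real..} \<inter> closure {..0} = {0}" by auto
    have "((\<lambda>t. if t \<in> {0..} then f t k else h t k) has_vector_derivative
       (if t \<in> {0..} then qconv (f t) (f t) k else qconv (h t) (h t) k)) (at t within UNIV)"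
    proof (rule has_vector_derivative_If_within_closures[where T = "{..0}"])
      show "t \<in> {0..} \<union> {..0}" "UNIV = {0 :: real..} \<union> {..0}" by auto
      have e: "{0 :: real..} \<union> {0} = {0..}" "{..0 :: real} \<union> {0} = {..0}" by auto
      show "((\<lambda>t. f t k) has_vector_derivative qconv (f t) (f t) k) (at t within {0..} \<union> (closure {0..} \<inter> closure {..0}))"
        if "t \<in> {0..} \<union> (closure {0..} \<inter> closure {..0})" using that df unfolding cl e by blast
      show "((\<lambda>t. h t k) has_vector_derivative qconv (h t) (h t) k) (at t within {..0} \<union> (closure {0..} \<inter> closure {..0}))"
        if "t \<in> {..0} \<union> (closure {0..} \<inter> closure {..0})" using that dh unfolding cl e by blast
      show "f t k = h t k" "qconv (f t) (f t) k = qconv (h t) (h t) k"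
        if "t \<in> closure {0..}" "t \<in> closure {..0}" using that fg0 by auto
    qed
    moreover have "(\<lambda>t. if t \<in> {0..} then f t k else h t k) = (\<lambda>t. a t k)" by (auto simp: a_def)
    moreover have "(if t \<in> {0..} then qconv (f t) (f t) k else qconv (h t) (h t) k) = qconv (a t) (a t) k"
      by (simp add: a_def)
    ultimately show ?thesis by simp
  qed
  have "gsol s a" unfolding gsol_def using sy bd da by blast
  then show ?thesis unfolding a_def h_def .
qed

lemma gsol_exists_pos:
  assumes s: "s > 5/2" and u: "in_Hs s u0" and m: "mu u0 \<ge> 0" and init: "\<And>x. deriv (deriv u0) x \<le> mu u0"
  shows "\<exists>a. gsol s a \<and> a 0 = fcoeff u0"
proof -
  define R0 where "R0 = Hs_norm s u0 + 1"
  note U = in_Hs_hsb[OF u]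
  have R0: "R0 > 0" "R0 \<ge> 0" "hsb s R0 (fcoeff u0)" using U hsb_mono[OF U(2,3), of R0] by (auto simp: R0_def)
  note r = regularity[OF U(1) R0(3,2) s]
  have su: "syn (fcoeff u0) = u0" using cper_eq_syn[OF U(1) r(8)] by simp
  \<comment> \<open>Reflection preserves the mean and carries the second derivative along without a
    change of sign, so the condition on the momentum passes to the data for negative times.\<close>
  define v0 where "v0 x = u0 (- x)" for x
  have v1: "(v0 has_real_derivative - deriv u0 (- x)) (at x)" for x
  proof -
    have "((\<lambda>x. u0 (- x)) has_real_derivative deriv u0 (- x) * (- 1)) (at x)"
      by (rule DERIV_chain2[OF r(1)]) (auto intro!: derivative_eq_intros)
    then show ?thesis by (simp add: v0_def[abs_def])
  qed
  have v2: "((\<lambda>x. - deriv u0 (- x)) has_real_derivative deriv (deriv u0) (- x)) (at x)" for x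
  proof -
    have "((\<lambda>x. deriv u0 (- x)) has_real_derivative deriv (deriv u0) (- x) * (- 1)) (at x)"
      by (rule DERIV_chain2[OF r(5)]) (auto intro!: derivative_eq_intros)
    from DERIV_minus[OF this] show ?thesis by simp
  qed
  have dv: "deriv v0 = (\<lambda>x. - deriv u0 (- x))" using v1 by (auto intro!: DERIV_imp_deriv)
  have ddv: "deriv (deriv v0) x = deriv (deriv u0) (- x)" for x unfolding dv by (rule DERIV_imp_deriv[OF v2])
  have vc: "cper v0"
  proof -
    have "u0 (- (x + 1)) = u0 (- x)" for x using cperD(1)[OF U(1), of "- x - 1"] by simp
    moreover have "continuous_on UNIV (\<lambda>x. u0 (- x))"
      by (rule continuous_on_compose2[OF cperD(2)[OF U(1), of UNIV]]) (auto intro!: continuous_intros)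
    ultimately show ?thesis by (simp add: cper_def periodic1_def v0_def[abs_def])
  qed
  define b0 where "b0 k = fcoeff u0 (- k)" for k
  have b0: "symm b0" "hsb s R0 b0" using symm_reflect[OF symm_fcoeff] R0(3) hsb_reflect[of s R0 "fcoeff u0"] by (auto simp: b0_def[abs_def])
  have as: "asum b0" using asum_0[OF b0(2) R0(2)] s by simp
  have sv: "syn b0 = v0"
  proof
    fix x
    have "((\<lambda>k. fcoeff u0 k * ek k (- x)) has_sum cs (fcoeff u0) (- x)) UNIV" by (rule cs_has_sum[OF r(8)])
    then have "((\<lambda>k. fcoeff u0 (- k) * ek (- k) (- x)) has_sum cs (fcoeff u0) (- x)) UNIV"
      using has_sum_reindex_bij_witness[of UNIV uminus uminus UNIV "\<lambda>k. fcoeff u0 k * ek k (- x)" "\<lambda>k. fcoeff u0 (- k) * ek (- k) (- x)"] by simp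
    then have "((\<lambda>k. b0 k * ek k x) has_sum cs (fcoeff u0) (- x)) UNIV" by (simp add: b0_def ek_def)
    then have "cs b0 x = cs (fcoeff u0) (- x)" using cs_has_sum[OF as] has_sum_unique by blast
    then have "syn b0 x = syn (fcoeff u0) (- x)" by (simp add: syn_def)
    then show "syn b0 x = v0 x" by (simp add: su v0_def)
  qed
  have mv: "mu v0 = mu u0"
  proof -
    have "complex_of_real (mu v0) = fcoeff (syn b0) 0" using fcoeff_0[OF vc] sv by simp
    also have "\<dots> = fcoeff u0 0" using fcoeff_syn[OF as b0(1)] by (simp add: b0_def)
    also have "\<dots> = of_real (mu u0)" by (rule fcoeff_0[OF U(1)])
    finally show ?thesis by simp
  qed
  have "\<exists>a. a 0 = fcoeff u0 \<and> (\<forall>T\<ge>0. \<exists>R>0. sol s T R a)"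
    by (rule forward_half_line[OF s], rule forward_existence[OF s symm_fcoeff R0(3,1) _ m]) (use init su in auto)
  then obtain f where f: "f 0 = fcoeff u0" "\<And>T. T \<ge> 0 \<Longrightarrow> \<exists>R>0. sol s T R f" by blast
  have "\<exists>a. a 0 = b0 \<and> (\<forall>T\<ge>0. \<exists>R>0. sol s T R a)"
    by (rule forward_half_line[OF s], rule forward_existence[OF s b0 R0(1) _ m]) (use init sv ddv mv in auto)
  then obtain g where g: "g 0 = b0" "\<And>T. T \<ge> 0 \<Longrightarrow> \<exists>R>0. sol s T R g" by blast
  have "gsol s (\<lambda>t. if t \<in> {0..} then f t else (\<lambda>k. g (- t) (- k)))"
    by (rule gsol_glue[OF f(2) g(2)]) (auto simp: f(1) g(1) b0_def[abs_def])
  moreover have "(if (0::real) \<in> {0..} then f 0 else (\<lambda>k. g (- 0) (- k))) = fcoeff u0" using f(1) by simp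
  ultimately show ?thesis by blast
qed

text \<open>The two sign changes cancel in the time derivative, and the nonlinearity is
  even.\<close>

lemma gsol_reverse:
  assumes a: "gsol s a"
  shows "gsol s (\<lambda>t k. - a (- t) k)"
  unfolding gsol_def
proof (intro conjI allI)
  show "symm (\<lambda>k. - a (- t) k)" for t using a by (simp add: gsol_def symm_def)
  show "\<exists>R\<ge>0. \<forall>t\<in>{-T..T}. hsb s R (\<lambda>k. - a (- t) k)" for T
  proof -
    obtain R where R: "R \<ge> 0" "\<forall>t\<in>{-T..T}. hsb s R (a t)" using a unfolding gsol_def by blast
    have "hsb s R (\<lambda>k. - a (- t) k)" if "t \<in> {-T..T}" for t
      using R(2) that by (auto simp: hsb_neg)
    then show ?thesis using R(1) by blast
  qed
  fix t k
  have "((\<lambda>t. a t k) has_vector_derivative qconv (a (- t)) (a (- t)) k) (at (- t) within uminus ` UNIV)"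
    using a by (auto simp: gsol_def intro: has_vector_derivative_at_within)
  from has_vector_derivative_minus[OF vderiv_reverse[OF this]]
  show "((\<lambda>t. - a (- t) k) has_vector_derivative qconv (\<lambda>k. - a (- t) k) (\<lambda>k. - a (- t) k) k) (at t)"
    by (simp add: qconv_neg)
qed

lemma gsol_shift_sol:
  assumes a: "gsol s a"
  shows "\<exists>R>0. sol s T R (\<lambda>t. a (t0 + t))"
proof -
  define M where "M = \<bar>t0\<bar> + \<bar>T\<bar>"
  obtain R where R: "R \<ge> 0" "\<forall>t\<in>{-M..M}. hsb s R (a t)" using a unfolding gsol_def by blast
  have "sol s T (R + 1) (\<lambda>t. a (t0 + t))"
    unfolding sol_def
  proof safe
    fix t k assume t: "t \<in> {0..T}"
    show "symm (a (t0 + t))" using a by (simp add: gsol_def)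
    have "t0 + t \<in> {-M..M}" using t by (auto simp: M_def)
    then show "hsb s (R + 1) (a (t0 + t))" using R hsb_mono[of s R "a (t0 + t)" "R + 1"] by auto
    have "((\<lambda>t. t0 + t) has_vector_derivative 1) (at t within {0..T})"
      by (auto intro!: derivative_eq_intros simp flip: has_real_derivative_iff_has_vector_derivative)
    moreover have "((\<lambda>t. a t k) has_vector_derivative qconv (a (t0 + t)) (a (t0 + t)) k) (at (t0 + t) within (\<lambda>t. t0 + t) ` {0..T})"
      using a by (auto simp: gsol_def intro: has_vector_derivative_at_within)
    ultimately have "((\<lambda>t. a t k) \<circ> (\<lambda>t. t0 + t) has_vector_derivative 1 *\<^sub>R qconv (a (t0 + t)) (a (t0 + t)) k) (at t within {0..T})"
      by (rule vector_diff_chain_within)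
    then show "((\<lambda>t. a (t0 + t) k) has_vector_derivative qconv (a (t0 + t)) (a (t0 + t)) k) (at t within {0..T})"
      by (simp add: o_def)
  qed
  then show ?thesis using R(1) by (intro exI[of _ "R + 1"]) auto
qed

lemma gsol_unique_forward:
  assumes s: "s > 5/2" and a: "gsol s a" and b: "gsol s b" and ab: "a 0 = b 0" and t: "t \<ge> 0"
  shows "a t = b t"
proof -
  obtain R1 where R1: "R1 > 0" "sol s t R1 a" using gsol_shift_sol[OF a, of t 0] by auto
  obtain R2 where R2: "R2 > 0" "sol s t R2 b" using gsol_shift_sol[OF b, of t 0] by auto
  have h1: "sol s t (max R1 R2) a" and h2: "sol s t (max R1 R2) b"
    using sol_mono[OF R1(2)] sol_mono[OF R2(2)] R1 R2 by auto
  show ?thesis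
    by (rule sol_unique[where a = a and b = b and T = t and R = "max R1 R2", OF s _ h1 h2 ab]) (use R1 t in auto)
qed

lemma gsol_unique:
  assumes s: "s > 5/2" and a: "gsol s a" and b: "gsol s b" and ab: "a 0 = b 0"
  shows "a t = b t"
proof (cases "t \<ge> 0")
  case True
  then show ?thesis using gsol_unique_forward[OF assms] by simp
next
  case False
  have "(\<lambda>k. - a (- (- t)) k) = (\<lambda>k. - b (- (- t)) k)"
    by (rule gsol_unique_forward[OF s gsol_reverse[OF a] gsol_reverse[OF b]]) (use ab False in auto)
  then show ?thesis by (auto simp: fun_eq_iff)
qed

subsection \<open>Strong continuity\<close>

text \<open>Any rate C will do; the point is that the bound starts exactly at r, so the norm cannot
  jump up at \<open>t0\<close>.\<close>

lemma gsol_norm_forward: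
  assumes s: "s > 5/2" and a: "gsol s a" and r: "r \<ge> 0" "hsb s r (a t0)"
  shows "\<exists>C\<ge>0. \<forall>h\<in>{0..1}. hsb s (r * exp (C * h)) (a (t0 + h))"
proof -
  obtain R where R: "R > 0" "sol s 1 R (\<lambda>t. a (t0 + t))" using gsol_shift_sol[OF a] by blast
  define K where "K = zt (s - 1) * R"
  have K: "K \<ge> 0" using R zt_nonneg by (simp add: K_def)
  have "hsb s (r * exp (en_const s * K * h)) (a (t0 + h))" if "h \<in> {0..1}" for h
    by (rule tame[OF s R(1) R(2) r(1) _ K _ that])
       (use r s R solD(2)[OF R(2)] hsb_jb_l1[where s = s and R = R] in \<open>auto simp: K_def\<close>)
  then show ?thesis using K en_const_pos[of s] s by (intro exI[of _ "en_const s * K"]) auto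
qed

lemma gsol_norm_near:
  assumes s: "s > 5/2" and a: "gsol s a" and r: "r \<ge> 0" "hsb s r (a t0)"
  shows "\<exists>C\<ge>0. \<forall>t. \<bar>t - t0\<bar> \<le> 1 \<longrightarrow> hsb s (r * exp (C * \<bar>t - t0\<bar>)) (a t)"
proof -
  obtain C1 where C1: "C1 \<ge> 0" "\<And>h. h \<in> {0..1} \<Longrightarrow> hsb s (r * exp (C1 * h)) (a (t0 + h))"
    using gsol_norm_forward[OF s a r] by blast
  obtain C2 where C2: "C2 \<ge> 0" "\<And>h. h \<in> {0..1} \<Longrightarrow> hsb s (r * exp (C2 * h)) (\<lambda>k. - a (- (- t0 + h)) k)"
    using gsol_norm_forward[OF s gsol_reverse[OF a] r(1), of "- t0"] r(2) by (auto simp: hsb_neg)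
  show ?thesis
  proof (intro exI[of _ "max C1 C2"] conjI allI impI)
    show "0 \<le> max C1 C2" using C1 by simp
    fix t assume t: "\<bar>t - t0\<bar> \<le> 1"
    have "\<exists>C\<in>{C1, C2}. hsb s (r * exp (C * \<bar>t - t0\<bar>)) (a t)"
    proof (cases "t \<ge> t0")
      case True
      then show ?thesis using C1(2)[of "t - t0"] t by auto
    next
      case False
      then show ?thesis using C2(2)[of "t0 - t"] t by (auto simp: hsb_neg)
    qed
    then obtain C where C: "C \<in> {C1, C2}" "hsb s (r * exp (C * \<bar>t - t0\<bar>)) (a t)" by blast
    show "hsb s (r * exp (max C1 C2 * \<bar>t - t0\<bar>)) (a t)"
      by (rule hsb_mono[OF C(2)]) (use C(1) r in \<open>auto intro!: mult_left_mono mult_right_mono\<close>)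
  qed
qed

lemma norm_diff_sq_le: "(cmod (x - y))\<^sup>2 \<le> 2 * (cmod x)\<^sup>2 + 2 * (cmod y)\<^sup>2"
proof -
  have "(cmod (x - y))\<^sup>2 \<le> (cmod x + cmod y)\<^sup>2" by (intro power_mono norm_triangle_ineq4) auto
  also have "\<dots> \<le> 2 * (cmod x)\<^sup>2 + 2 * (cmod y)\<^sup>2"
    using sum_squares_bound[of "cmod x" "cmod y"] by (simp add: power2_sum)
  finally show ?thesis .
qed

text \<open>Weak continuity together with convergence of the norms gives strong continuity.\<close>

lemma gsol_continuous:
  assumes s: "s > 5/2" and a: "gsol s a" and e: "e > 0"
  shows "eventually (\<lambda>t. hsb s e (\<lambda>k. a t k - a t0 k)) (at t0)"
proof -
  define x where "x t k = (jb k powr s * cmod (a t k))\<^sup>2" for t k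
  have x0: "x t k \<ge> 0" for t k by (simp add: x_def)
  obtain R where "R \<ge> 0" "\<forall>t\<in>{- \<bar>t0\<bar>..\<bar>t0\<bar>}. hsb s R (a t)" using a unfolding gsol_def by blast
  moreover have "t0 \<in> {- \<bar>t0\<bar>..\<bar>t0\<bar>}" by auto
  ultimately have R: "hsb s R (a t0)" by blast
  have sm: "x t0 summable_on UNIV"
    using hsbD[OF R] by (intro nonneg_bdd_above_summable_on bdd_aboveI[of _ "R\<^sup>2"]) (auto simp: x_def)
  define N where "N = infsum (x t0) UNIV"
  have N0: "N \<ge> 0" unfolding N_def by (intro infsum_nonneg x0)
  have N: "sum (x t0) F \<le> N" if "finite F" for F
    unfolding N_def by (rule finite_sum_le_infsum[OF sm that]) (auto simp: x0)
  have r: "hsb s (sqrt N) (a t0)" unfolding hsb_def using N N0 by (simp add: x_def)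
  obtain C where C: "C \<ge> 0" "\<And>t. \<bar>t - t0\<bar> \<le> 1 \<Longrightarrow> hsb s (sqrt N * exp (C * \<bar>t - t0\<bar>)) (a t)"
    using gsol_norm_near[OF s a _ r] N0 by auto
  \<comment> \<open>Seven portions of size d will arise: one from \<open>F\<close>, four from the
    tail at time t and two from the tail at \<open>t0\<close>.\<close>
  define d where "d = e\<^sup>2 / 16"
  have d: "d > 0" using e by (simp add: d_def)
  obtain F where F: "finite F" "dist (sum (x t0) F) N \<le> d"
    using infsum_finite_approximation[OF sm d] by (auto simp: N_def)
  have F2: "N \<le> sum (x t0) F + d" using F(2) by (simp add: dist_real_def)
  have ac: "((\<lambda>t. a t k) \<longlongrightarrow> a t0 k) (at t0)" for k
  proof -
    have "((\<lambda>t. a t k) has_vector_derivative qconv (a t0) (a t0) k) (at t0)" using a by (simp add: gsol_def)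
    then have "continuous (at t0) (\<lambda>t. a t k)" by (rule has_vector_derivative_continuous)
    then show ?thesis by (simp add: continuous_at)
  qed
  have "((\<lambda>t. \<Sum>k\<in>F. (jb k powr s * cmod (a t k - a t0 k))\<^sup>2) \<longlongrightarrow> (\<Sum>k\<in>F. (jb k powr s * cmod (a t0 k - a t0 k))\<^sup>2)) (at t0)"
    by (intro tendsto_intros ac)
  then have ev1: "eventually (\<lambda>t. (\<Sum>k\<in>F. (jb k powr s * cmod (a t k - a t0 k))\<^sup>2) < d) (at t0)"
    by (rule order_tendstoD) (use d in simp)
  have "((\<lambda>t. N * exp (2 * C * \<bar>t - t0\<bar>) - sum (x t) F) \<longlongrightarrow> N * exp (2 * C * \<bar>t0 - t0\<bar>) - sum (x t0) F) (at t0)"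
    unfolding x_def by (intro tendsto_intros ac)
  then have ev2: "eventually (\<lambda>t. N * exp (2 * C * \<bar>t - t0\<bar>) - sum (x t) F < 2 * d) (at t0)"
    by (rule order_tendstoD) (use d F2 in simp)
  have ev3: "eventually (\<lambda>t. \<bar>t - t0\<bar> \<le> 1) (at t0)"
    unfolding eventually_at by (intro exI[of _ 1]) (auto simp: dist_real_def)
  show ?thesis
    using ev1 ev2 ev3
  proof eventually_elim
    case (elim t)
    have Nt: "sum (x t) G \<le> N * exp (2 * C * \<bar>t - t0\<bar>)" if "finite G" for G
    proof -
      have "sum (x t) G \<le> (sqrt N * exp (C * \<bar>t - t0\<bar>))\<^sup>2"
        unfolding x_def by (rule hsbD[OF C(2)[OF elim(3)] that])
      also have "\<dots> = N * exp (2 * C * \<bar>t - t0\<bar>)"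
        using N0 exp_double[of "C * \<bar>t - t0\<bar>"] by (simp add: power_mult_distrib mult.assoc)
      finally show ?thesis .
    qed
    show ?case unfolding hsb_def
    proof safe
      fix G :: "int set" assume G: "finite G"
      define y where "y k = (jb k powr s * cmod (a t k - a t0 k))\<^sup>2" for k
      have y: "y k \<le> 2 * x t k + 2 * x t0 k" for k
        using mult_left_mono[OF norm_diff_sq_le[of "a t k" "a t0 k"], of "(jb k powr s)\<^sup>2"]
        by (simp add: y_def x_def power_mult_distrib algebra_simps)
      have "sum y G \<le> sum y (F \<union> G)" using F G by (intro sum_mono2) (auto simp: y_def)
      also have "\<dots> = sum y F + sum y (G - F)"
        using F G by (subst sum.union_disjoint[symmetric]) (auto intro!: sum.cong)
      also have "sum y (G - F) \<le> 2 * sum (x t) (G - F) + 2 * sum (x t0) (G - F)"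
        unfolding sum_distrib_left sum.distrib[symmetric] by (intro sum_mono y)
      \<comment> \<open>The tail at time t is at most what the bound of the total leaves after the
        modes in \<open>F\<close>, whose sum converges.\<close>
      also have "sum (x t) (G - F) \<le> 2 * d"
      proof -
        have "sum (x t) (G - F) + sum (x t) F = sum (x t) (G \<union> F)"
          using F G by (subst sum.union_disjoint[symmetric]) (auto intro!: sum.cong)
        also have "\<dots> \<le> N * exp (2 * C * \<bar>t - t0\<bar>)" using F G by (intro Nt) auto
        finally show ?thesis using elim(2) by linarith
      qed
      also have "sum (x t0) (G - F) \<le> d"
      proof -
        have "sum (x t0) (G - F) + sum (x t0) F = sum (x t0) (G \<union> F)"
          using F G by (subst sum.union_disjoint[symmetric]) (auto intro!: sum.cong)
        also have "\<dots> \<le> N" using F G by (intro N) auto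
        finally show ?thesis using F2 by linarith
      qed
      also have "sum y F \<le> d" using elim(1) by (simp add: y_def)
      finally have "sum y G \<le> 7 * d" by simp
      then show "(\<Sum>k\<in>G. (jb k powr s * cmod (a t k - a t0 k))\<^sup>2) \<le> e\<^sup>2"
        unfolding y_def d_def using zero_le_power2[of e] by linarith
    qed
  qed
qed

lemma hsb_add:
  assumes a: "hsb s R a" "R \<ge> 0" and b: "hsb s R' b" "R' \<ge> 0"
  shows "hsb s (R + R') (\<lambda>k. a k + b k)"
  unfolding hsb_def
proof safe
  fix S :: "int set" assume S: "finite S"
  define X where "X k = jb k powr s * cmod (a k)" for k
  define Y where "Y k = jb k powr s * cmod (b k)" for k
  have "L2_set X S \<le> R" "L2_set Y S \<le> R'"
    using hsbD[OF a(1) S] hsbD[OF b(1) S] a b by (auto simp: L2_set_def X_def Y_def real_le_lsqrt)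
  then have "L2_set (\<lambda>k. X k + Y k) S \<le> R + R'" using L2_set_triangle_ineq[of X Y S] by linarith
  then have "(L2_set (\<lambda>k. X k + Y k) S)\<^sup>2 \<le> (R + R')\<^sup>2" by (intro power_mono) auto
  then have "(\<Sum>k\<in>S. (X k + Y k)\<^sup>2) \<le> (R + R')\<^sup>2" by (simp add: L2_set_def sum_nonneg)
  moreover have "(\<Sum>k\<in>S. (jb k powr s * cmod (a k + b k))\<^sup>2) \<le> (\<Sum>k\<in>S. (X k + Y k)\<^sup>2)"
    unfolding X_def Y_def distrib_left[symmetric]
    by (intro sum_mono power_mono mult_left_mono norm_triangle_ineq) auto
  ultimately show "(\<Sum>k\<in>S. (jb k powr s * cmod (a k + b k))\<^sup>2) \<le> (R + R')\<^sup>2" by linarith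
qed

lemma qconv_diff:
  assumes s: "s > 3/2" and a: "hsb s R a" "R \<ge> 0" and b: "hsb s R' b" "R' \<ge> 0"
  shows "qconv a a k - qconv b b k = qconv (\<lambda>j. a j - b j) (\<lambda>j. a j + b j) k"
proof -
  define P where "P a b j = - \<i> * gam k j * (a j * b (k - j))" for a b :: "int \<Rightarrow> complex" and j
  have h: "(P a a has_sum qconv a a k) UNIV" "(P b b has_sum qconv b b k) UNIV"
    "(P a b has_sum qconv a b k) UNIV" "(P b a has_sum qconv b a k) UNIV"
    unfolding P_def qconv_def
    by (rule has_sum_infsum, rule qconv_summable(1)[OF a a s], rule has_sum_infsum, rule qconv_summable(1)[OF b b s],
        rule has_sum_infsum, rule qconv_summable(1)[OF a b s], rule has_sum_infsum, rule qconv_summable(1)[OF b a s])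
  have "(P b a has_sum qconv a b k) UNIV"
    using has_sum_reindex_bij_witness[of UNIV "\<lambda>j. k - j" "\<lambda>j. k - j" UNIV "P b a" "P a b" "qconv a b k" "qconv a b k"] h(3)
    by (simp add: P_def gam_flip mult_ac)
  then have e: "qconv a b k = qconv b a k" using h(4) has_sum_unique by blast
  have "((\<lambda>j. (P a a j + P a b j) + - (P b a j + P b b j)) has_sum ((qconv a a k + qconv a b k) + - (qconv b a k + qconv b b k))) UNIV"
  proof (rule has_sum_add[OF has_sum_add[OF h(1,3)]])
    show "((\<lambda>j. - (P b a j + P b b j)) has_sum - (qconv b a k + qconv b b k)) UNIV"
      unfolding has_sum_uminus minus_minus by (rule has_sum_add[OF h(4,2)])
  qed
  moreover have "(\<lambda>j. (P a a j + P a b j) + - (P b a j + P b b j)) = P (\<lambda>j. a j - b j) (\<lambda>j. a j + b j)"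
    by (simp add: P_def fun_eq_iff algebra_simps)
  ultimately have "infsum (P (\<lambda>j. a j - b j) (\<lambda>j. a j + b j)) UNIV = qconv a a k - qconv b b k"
    using e by (intro infsumI) simp
  moreover have "qconv (\<lambda>j. a j - b j) (\<lambda>j. a j + b j) k = infsum (P (\<lambda>j. a j - b j) (\<lambda>j. a j + b j)) UNIV"
    unfolding qconv_def by (rule infsum_cong) (simp add: P_def)
  ultimately show ?thesis by simp
qed

lemma gsol_rhs_continuous:
  assumes s: "s > 5/2" and a: "gsol s a" and e: "e > 0"
  shows "eventually (\<lambda>t. hsb (s - 1) e (\<lambda>k. qconv (a t) (a t) k - qconv (a t0) (a t0) k)) (at t0)"
proof -
  define M where "M = \<bar>t0\<bar> + 1"
  obtain R where R: "R \<ge> 0" "\<forall>t\<in>{-M..M}. hsb s R (a t)" using a unfolding gsol_def by blast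
  define d where "d = e / (cq s * (R + R) + 1)"
  have cR: "cq s * (R + R) \<ge> 0" using cq_nonneg R(1) by simp
  have d: "d > 0" unfolding d_def by (intro divide_pos_pos e) (use cR in linarith)
  have de: "cq s * d * (R + R) \<le> e"
  proof -
    have "X / (X + 1) * e \<le> 1 * e" if "X \<ge> 0" for X :: real
      using that e by (intro mult_right_mono) (auto simp: divide_le_eq_1)
    from this[OF cR] show ?thesis by (simp add: d_def mult_ac)
  qed
  have "eventually (\<lambda>t. \<bar>t - t0\<bar> \<le> 1) (at t0)"
    unfolding eventually_at by (intro exI[of _ 1]) (auto simp: dist_real_def)
  with gsol_continuous[OF s a d] show ?thesis
  proof eventually_elim
    case (elim t)
    have "t \<in> {-M..M}" "t0 \<in> {-M..M}" using elim(2) by (auto simp: M_def)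
    then have h: "hsb s R (a t)" "hsb s R (a t0)" using R(2) by auto
    have s': "s > 3/2" using s by simp
    have "hsb (s - 1) (cq s * d * (R + R)) (qconv (\<lambda>k. a t k - a t0 k) (\<lambda>k. a t k + a t0 k))"
      using d R by (intro qconv_hsb[OF s' elim(1)] hsb_add h) auto
    then have "hsb (s - 1) (cq s * d * (R + R)) (\<lambda>k. qconv (a t) (a t) k - qconv (a t0) (a t0) k)"
      using qconv_diff[OF s' h(1) R(1) h(2) R(1)] by presburger
    then show ?case by (rule hsb_mono) (use de cq_nonneg d R in auto)
  qed
qed

text \<open>The mean value theorem is scalar, so the error \<open>z\<close> of the quotient is
  paired with the trajectory on finitely many modes. The neighbourhood \<open>d\<close> is chosen
  from the continuity of the nonlinearity in H^(s-1), before \<open>F\<close>, which makes the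
  estimate uniform in \<open>F\<close>.\<close>

lemma gsol_quotient:
  assumes s: "s > 5/2" and a: "gsol s a" and e: "e > 0"
  shows "eventually (\<lambda>t. hsb (s - 1) e (\<lambda>k. (a t k - a t0 k) / of_real (t - t0) - qconv (a t0) (a t0) k)) (at t0)"
proof -
  define q where "q t = qconv (a t) (a t)" for t
  have da: "((\<lambda>t. a t k) has_vector_derivative q t k) (at t)" for t k using a by (simp add: gsol_def q_def)
  obtain d where d: "d > 0" "\<And>t. t \<noteq> t0 \<Longrightarrow> dist t t0 < d \<Longrightarrow> hsb (s - 1) e (\<lambda>k. q t k - q t0 k)"
    using gsol_rhs_continuous[OF s a e, of t0] unfolding eventually_at q_def by auto
  have "hsb (s - 1) e (\<lambda>k. (a t k - a t0 k) / of_real (t - t0) - q t0 k)" if t: "t \<noteq> t0" "dist t t0 < d" for t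
    unfolding hsb_def
  proof safe
    fix F :: "int set" assume F: "finite F"
    define w where "w k = (jb k powr (s - 1))\<^sup>2" for k
    define z where "z k = (a t k - a t0 k) / of_real (t - t0) - q t0 k" for k
    define Z where "Z = (\<Sum>k\<in>F. w k * (cmod (z k))\<^sup>2)"
    have Z0: "Z \<ge> 0" unfolding Z_def w_def by (intro sum_nonneg) auto
    define phi where "phi r = (\<Sum>k\<in>F. w k * Re (cnj (z k) * (a r k - of_real r * q t0 k)))" for r
    define phi' where "phi' r = (\<Sum>k\<in>F. w k * Re (cnj (z k) * (q r k - q t0 k)))" for r
    have dphi: "(phi has_real_derivative phi' r) (at r)" for r
    proof -
      have "((\<lambda>r. cnj (z k) * (a r k - of_real r * q t0 k)) has_vector_derivative cnj (z k) * (q r k - 1 * q t0 k)) (at r)" for k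
        by (intro has_vector_derivative_mult_right has_vector_derivative_diff da has_vector_derivative_mult_left)
           (auto intro!: derivative_eq_intros simp: has_vector_derivative_def scaleR_conv_of_real)
      from bounded_linear.has_vector_derivative[OF bounded_linear_Re this]
      have dk: "((\<lambda>r. Re (cnj (z k) * (a r k - of_real r * q t0 k))) has_real_derivative Re (cnj (z k) * (q r k - q t0 k))) (at r)" for k
        by (simp add: has_real_derivative_iff_has_vector_derivative)
      show ?thesis unfolding phi_def phi'_def by (intro DERIV_sum DERIV_cmult dk)
    qed
    have "phi t - phi t0 = (t - t0) * Z"
    proof -
      have "Re (cnj (z k) * (a t k - of_real t * q t0 k)) - Re (cnj (z k) * (a t0 k - of_real t0 * q t0 k)) = (t - t0) * (cmod (z k))\<^sup>2" for k
      proof -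
        have "a t k - a t0 k - of_real (t - t0) * q t0 k = of_real (t - t0) * z k"
        proof -
          have "A - c * q = c * (A / c - q)" if "c \<noteq> 0" for A c q :: complex
            using that by (simp add: right_diff_distrib)
          moreover have "(of_real (t - t0) :: complex) \<noteq> 0" using t by simp
          ultimately show ?thesis unfolding z_def by blast
        qed
        note zk = this
        have "cnj (z k) * (a t k - of_real t * q t0 k) - cnj (z k) * (a t0 k - of_real t0 * q t0 k)
          = cnj (z k) * (a t k - a t0 k - of_real (t - t0) * q t0 k)" by (simp add: algebra_simps)
        also have "\<dots> = of_real (t - t0) * (z k * cnj (z k))" unfolding zk by (simp only: mult_ac)
        also have "\<dots> = of_real ((t - t0) * (cmod (z k))\<^sup>2)" by (simp add: complex_norm_square[symmetric] del: of_real_power)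
        finally show ?thesis by (metis Re_complex_of_real minus_complex.simps(1))
      qed
      then show ?thesis
        unfolding phi_def Z_def sum_subtractf[symmetric] right_diff_distrib[symmetric] sum_distrib_left
        by (intro sum.cong refl) (simp add: mult_ac)
    qed
    moreover obtain r where r: "phi t - phi t0 = (t - t0) * phi' r" "dist r t0 < d" "r \<noteq> t0"
    proof (cases "t0 < t")
      case True
      obtain r where "t0 < r" "r < t" "phi t - phi t0 = (t - t0) * phi' r"
        using MVT2[OF True, of phi phi'] dphi by blast
      then show ?thesis using that[of r] t by (auto simp: dist_real_def)
    next
      case False
      then have "t < t0" using t by simp
      then obtain r where "t < r" "r < t0" "phi t0 - phi t = (t0 - t) * phi' r"
        using MVT2[of t t0 phi phi'] dphi by blast
      then show ?thesis using that[of r] t by (auto simp: dist_real_def algebra_simps)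
    qed
    ultimately have "Z = phi' r" using t by simp
    also have "\<dots> \<le> (\<Sum>k\<in>F. \<bar>jb k powr (s - 1) * cmod (z k)\<bar> * \<bar>jb k powr (s - 1) * cmod (q r k - q t0 k)\<bar>)"
      unfolding phi'_def
    proof (rule sum_mono)
      fix k
      have "Re (cnj (z k) * (q r k - q t0 k)) \<le> cmod (z k) * cmod (q r k - q t0 k)"
        by (rule order.trans[OF complex_Re_le_cmod]) (simp add: norm_mult)
      then have "w k * Re (cnj (z k) * (q r k - q t0 k)) \<le> w k * (cmod (z k) * cmod (q r k - q t0 k))"
        by (intro mult_left_mono) (auto simp: w_def)
      then show "w k * Re (cnj (z k) * (q r k - q t0 k)) \<le> \<bar>jb k powr (s - 1) * cmod (z k)\<bar> * \<bar>jb k powr (s - 1) * cmod (q r k - q t0 k)\<bar>"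
        by (simp add: w_def power2_eq_square abs_mult mult_ac)
    qed
    also have "\<dots> \<le> L2_set (\<lambda>k. jb k powr (s - 1) * cmod (z k)) F * L2_set (\<lambda>k. jb k powr (s - 1) * cmod (q r k - q t0 k)) F"
      by (rule L2_set_mult_ineq)
    also have "\<dots> \<le> sqrt Z * e"
    proof (intro mult_mono)
      show "L2_set (\<lambda>k. jb k powr (s - 1) * cmod (z k)) F \<le> sqrt Z"
        unfolding L2_set_def Z_def w_def by (simp add: power_mult_distrib)
      show "L2_set (\<lambda>k. jb k powr (s - 1) * cmod (q r k - q t0 k)) F \<le> e"
        unfolding L2_set_def using hsbD[OF d(2)[OF r(3,2)] F] e by (simp add: real_le_lsqrt)
    qed (use Z0 in auto)
    finally have "sqrt Z * sqrt Z \<le> sqrt Z * e" using Z0 by simp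
    then have "sqrt Z \<le> e" using Z0 e mult_le_cancel_left_pos[of "sqrt Z" "sqrt Z" e] by (cases "Z = 0") auto
    then have "(sqrt Z)\<^sup>2 \<le> e\<^sup>2" using Z0 by (intro power_mono) auto
    then have "Z \<le> e\<^sup>2" using Z0 by simp
    then show "(\<Sum>k\<in>F. (jb k powr (s - 1) * cmod ((a t k - a t0 k) / of_real (t - t0) - q t0 k))\<^sup>2) \<le> e\<^sup>2"
      by (simp add: Z_def w_def z_def power_mult_distrib)
  qed
  then show ?thesis unfolding eventually_at q_def using d(1) by blast
qed

subsection \<open>From Fourier coefficients back to functions\<close>

lemma gsol_hsb:
  assumes "gsol s a"
  obtains R where "R \<ge> 0" "hsb s R (a t)"
proof -
  obtain R where "R \<ge> 0" "\<forall>r\<in>{- \<bar>t\<bar>..\<bar>t\<bar>}. hsb s R (a r)" using assms unfolding gsol_def by blast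
  moreover have "t \<in> {- \<bar>t\<bar>..\<bar>t\<bar>}" by auto
  ultimately show ?thesis using that by blast
qed

lemma Hs_norm_tendsto_0:
  assumes c: "\<And>t. cper (F t)" and h: "\<And>e. e > 0 \<Longrightarrow> eventually (\<lambda>t. hsb s e (fcoeff (F t))) G"
  shows "((\<lambda>t. Hs_norm s (F t)) \<longlongrightarrow> 0) G"
proof (rule tendstoI)
  fix e :: real assume e: "e > 0"
  have "e / 2 > 0" using e by simp
  from h[OF this] show "eventually (\<lambda>t. dist (Hs_norm s (F t)) 0 < e) G"
  proof eventually_elim
    case (elim t)
    have "in_Hs s (F t)" "Hs_norm s (F t) \<le> e / 2" using hsb_in_Hs[OF c elim] e by auto
    then show ?case using in_Hs_hsb(3) e by fastforce
  qed
qed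

lemma cper_quotient: "cper u \<Longrightarrow> cper v \<Longrightarrow> cper w \<Longrightarrow> cper (\<lambda>x. (u x - v x) / c - w x)"
  using cper_diff[OF cper_mult[OF cper_const[of "1 / c"] cper_diff[of u v]], of w] by simp

lemma fcoeff_quotient:
  assumes "cper u" "cper v" "cper w"
  shows "fcoeff (\<lambda>x. (u x - v x) / c - w x) k = (fcoeff u k - fcoeff v k) / of_real c - fcoeff w k"
proof -
  have "fcoeff (\<lambda>x. (1 / c) * (u x - v x) - w x) k = fcoeff (\<lambda>x. (1 / c) * (u x - v x)) k - fcoeff w k"
    by (intro fcoeff_diff cper_mult cper_const cper_diff assms)
  also have "fcoeff (\<lambda>x. (1 / c) * (u x - v x)) k = of_real (1 / c) * (fcoeff u k - fcoeff v k)"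
    unfolding fcoeff_cmult by (simp add: fcoeff_diff assms)
  finally show ?thesis by simp
qed

lemma hsb_weaken:
  assumes "hsb s R a" "p \<le> s"
  shows "hsb p R a"
  unfolding hsb_def
proof safe
  fix S :: "int set" assume S: "finite S"
  have "(\<Sum>k\<in>S. (jb k powr p * cmod (a k))\<^sup>2) \<le> (\<Sum>k\<in>S. (jb k powr s * cmod (a k))\<^sup>2)"
    by (intro sum_mono power_mono mult_right_mono jb_powr_mono assms) auto
  also have "\<dots> \<le> R\<^sup>2" by (rule hsbD[OF assms(1) S])
  finally show "(\<Sum>k\<in>S. (jb k powr p * cmod (a k))\<^sup>2) \<le> R\<^sup>2" .
qed

lemma gsol_solution:
  assumes s: "s > 5/2" and a: "gsol s a"
  shows "is_global_solution s (syn (a 0)) (\<lambda>t. syn (a t))"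
proof -
  define U where "U t = syn (a t)" for t
  define V where "V t = (\<lambda>x. - rhs (U t) x)" for t
  have sy: "symm (a t)" for t using a by (simp add: gsol_def)
  have U: "cper (U t)" and fU: "fcoeff (U t) = a t" for t
  proof -
    obtain R where R: "R \<ge> 0" "hsb s R (a t)" using gsol_hsb[OF a, of t] by blast
    have as: "asum (a t)" using asum_0[OF R(2,1)] s by simp
    show "cper (U t)" unfolding U_def by (rule syn_cper[OF as])
    show "fcoeff (U t) = a t" unfolding U_def by (rule ext, rule fcoeff_syn[OF as sy])
  qed
  have inU: "in_Hs s (U t)" "in_Hs (s - 1) (U t)" for t
  proof -
    obtain R where R: "R \<ge> 0" "hsb s R (fcoeff (U t))" unfolding fU using gsol_hsb[OF a, of t] by blast
    show "in_Hs s (U t)" by (rule hsb_in_Hs(1)[OF U R(2,1)])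
    show "in_Hs (s - 1) (U t)" by (rule hsb_in_Hs(1)[OF U hsb_weaken[OF R(2)] R(1)]) simp
  qed
  have V: "cper (V t)" and fV: "fcoeff (V t) = qconv (a t) (a t)" and inV: "in_Hs (s - 1) (V t)" for t
  proof -
    obtain R where R: "R \<ge> 0" "hsb s R (a t)" using gsol_hsb[OF a, of t] by blast
    then have R': "hsb s R (fcoeff (U t))" by (simp add: fU)
    note p = rhs_props[OF U R' R(1) s]
    show V: "cper (V t)" unfolding V_def by (rule cper_minus[OF p(1)])
    show fV: "fcoeff (V t) = qconv (a t) (a t)"
    proof
      fix k
      show "fcoeff (V t) k = qconv (a t) (a t) k"
        using fcoeff_cmult[of "- 1" "rhs (U t)" k] p(2)[of k] by (simp add: V_def fU)
    qed
    have "hsb (s - 1) (cq s * R * R) (fcoeff (V t))" unfolding fV by (rule qconv_hsb) (use s R in auto)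
    then show "in_Hs (s - 1) (V t)" by (rule hsb_in_Hs(1)[OF V]) (use cq_nonneg R in simp)
  qed
  have cU: "((\<lambda>t. Hs_norm s (\<lambda>x. U t x - U t0 x)) \<longlongrightarrow> 0) (at t0)" for t0
  proof (rule Hs_norm_tendsto_0)
    fix e :: real assume e: "e > 0"
    have "fcoeff (\<lambda>x. U t x - U t0 x) = (\<lambda>k. a t k - a t0 k)" for t by (rule ext) (simp add: fcoeff_diff U fU)
    then show "eventually (\<lambda>t. hsb s e (fcoeff (\<lambda>x. U t x - U t0 x))) (at t0)"
      using gsol_continuous[OF s a e, of t0] by simp
  qed (intro cper_diff U)
  have cV: "((\<lambda>t. Hs_norm (s - 1) (\<lambda>x. V t x - V t0 x)) \<longlongrightarrow> 0) (at t0)" for t0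
  proof (rule Hs_norm_tendsto_0)
    fix e :: real assume e: "e > 0"
    have "fcoeff (\<lambda>x. V t x - V t0 x) = (\<lambda>k. qconv (a t) (a t) k - qconv (a t0) (a t0) k)" for t
      by (rule ext) (simp add: fcoeff_diff V fV)
    then show "eventually (\<lambda>t. hsb (s - 1) e (fcoeff (\<lambda>x. V t x - V t0 x))) (at t0)"
      using gsol_rhs_continuous[OF s a e, of t0] by simp
  qed (intro cper_diff V)
  have dU: "((\<lambda>t. Hs_norm (s - 1) (\<lambda>x. (U t x - U t0 x) / (t - t0) - V t0 x)) \<longlongrightarrow> 0) (at t0)" for t0
  proof (rule Hs_norm_tendsto_0)
    fix e :: real assume e: "e > 0"
    have "fcoeff (\<lambda>x. (U t x - U t0 x) / (t - t0) - V t0 x)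
        = (\<lambda>k. (a t k - a t0 k) / of_real (t - t0) - qconv (a t0) (a t0) k)" for t
      by (rule ext) (simp only: fcoeff_quotient[OF U U V] fU fV)
    then show "eventually (\<lambda>t. hsb (s - 1) e (fcoeff (\<lambda>x. (U t x - U t0 x) / (t - t0) - V t0 x))) (at t0)"
      using gsol_quotient[OF s a e, of t0] by simp
  qed (intro cper_quotient U V)
  have "C1_Hs_with (s - 1) U V" unfolding C1_Hs_with_def has_Hs_deriv_def cont_Hs_def using inU inV cV dU by blast
  moreover have "V t x + U t x * deriv (U t) x
      + opA_inv (deriv (\<lambda>y. 2 * mu (U t) * U t y + 1/2 * (deriv (U t) y)\<^sup>2)) x = 0" for t x
    by (simp add: V_def rhs_def flux_def)
  moreover have "cont_Hs s U" unfolding cont_Hs_def using inU cU by blast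
  ultimately have "is_global_solution s (U 0) U" unfolding is_global_solution_def by blast
  then show ?thesis unfolding U_def .
qed

section \<open>From a solution to its coefficients\<close>

lemma Hs_norm_continuous:
  assumes "cont_Hs s U"
  shows "continuous_on UNIV (\<lambda>t. Hs_norm s (U t))"
  unfolding continuous_on_def
proof
  fix t0
  define D where "D t = Hs_norm s (\<lambda>x. U t x - U t0 x)" for t
  have i: "in_Hs s (U t)" for t using assms by (simp add: cont_Hs_def)
  have D: "(D \<longlongrightarrow> 0) (at t0)" using assms by (simp add: cont_Hs_def D_def[abs_def])
  have "\<bar>Hs_norm s (U t) - Hs_norm s (U t0)\<bar> \<le> D t" for t
  proof -
    note u = in_Hs_hsb[OF i[of t]] and v = in_Hs_hsb[OF i[of t0]]
    define w where "w = (\<lambda>x. U t x - U t0 x)"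
    have fw: "fcoeff w = (\<lambda>k. fcoeff (U t) k - fcoeff (U t0) k)" unfolding w_def by (rule ext) (rule fcoeff_diff[OF u(1) v(1)])
    have cw: "cper w" unfolding w_def by (rule cper_diff[OF u(1) v(1)])
    \<comment> \<open>For a function whose weights are not summable \<open>Hs_norm\<close> is 0 by
      convention, so the difference must be known to lie in H^s before its norm says
      anything.\<close>
    have "hsb s (Hs_norm s (U t) + Hs_norm s (U t0)) (\<lambda>k. fcoeff (U t) k + - fcoeff (U t0) k)"
      by (intro hsb_add u v) (simp add: hsb_neg v)
    then have "in_Hs s w" using hsb_in_Hs(1)[OF cw] u(3) v(3) by (simp add: fw)
    note w = in_Hs_hsb[OF this]
    have "hsb s (Hs_norm s (U t0) + Hs_norm s w) (\<lambda>k. fcoeff (U t0) k + fcoeff w k)"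
      by (intro hsb_add w v)
    then have "Hs_norm s (U t) \<le> Hs_norm s (U t0) + Hs_norm s w"
      using w v by (intro hsb_in_Hs(2)[OF u(1)]) (auto simp: fw)
    moreover have "hsb s (Hs_norm s (U t) + Hs_norm s w) (\<lambda>k. fcoeff (U t) k + - fcoeff w k)"
      by (intro hsb_add w u) (simp add: hsb_neg w)
    then have "Hs_norm s (U t0) \<le> Hs_norm s (U t) + Hs_norm s w"
      using w u by (intro hsb_in_Hs(2)[OF v(1)]) (auto simp: fw)
    ultimately show ?thesis by (simp add: D_def w_def)
  qed
  then have "((\<lambda>t. Hs_norm s (U t) - Hs_norm s (U t0)) \<longlongrightarrow> 0) (at t0)"
    by (intro Lim_null_comparison[OF _ D]) auto
  then show "((\<lambda>t. Hs_norm s (U t)) \<longlongrightarrow> Hs_norm s (U t0)) (at t0 within UNIV)" by (rule LIM_zero_cancel)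
qed

text \<open>Since p >= 0, each coefficient of the error in the difference quotient is at most its
  H^p norm.\<close>

lemma fcoeff_has_vector_derivative:
  assumes d: "has_Hs_deriv p U V" and p: "p \<ge> 0"
  shows "((\<lambda>t. fcoeff (U t) k) has_vector_derivative fcoeff (V t0) k) (at t0)"
proof -
  have i: "cper (U t)" "cper (V t)" for t using d in_Hs_hsb(1) by (auto simp: has_Hs_deriv_def)
  have n: "((\<lambda>t. Hs_norm p (\<lambda>x. (U t x - U t0 x) / (t - t0) - V t0 x)) \<longlongrightarrow> 0) (at t0)"
    using d by (simp add: has_Hs_deriv_def)
  \<comment> \<open>The hypothesis speaks of a norm; only with membership in H^p does it bound
    coefficients.\<close>
  have iH: "in_Hs p (\<lambda>x. (U t x - U t0 x) / (t - t0) - V t0 x)" for t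
  proof -
    have I: "in_Hs p (U t)" "in_Hs p (U t0)" "in_Hs p (V t0)" using d by (auto simp: has_Hs_deriv_def)
    note u = in_Hs_hsb[OF I(1)] and v = in_Hs_hsb[OF I(2)] and w = in_Hs_hsb[OF I(3)]
    have cm: "hsb p (cmod c * R) (\<lambda>k. c * a k)" if "hsb p R a" for c R and a :: "int \<Rightarrow> complex"
      unfolding hsb_def
    proof safe
      fix S :: "int set" assume S: "finite S"
      have "(\<Sum>k\<in>S. (jb k powr p * cmod (c * a k))\<^sup>2) = (cmod c)\<^sup>2 * (\<Sum>k\<in>S. (jb k powr p * cmod (a k))\<^sup>2)"
        by (simp add: norm_mult power_mult_distrib sum_distrib_left mult_ac)
      also have "\<dots> \<le> (cmod c)\<^sup>2 * R\<^sup>2" by (intro mult_left_mono hsbD[OF that S]) auto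
      finally show "(\<Sum>k\<in>S. (jb k powr p * cmod (c * a k))\<^sup>2) \<le> (cmod c * R)\<^sup>2" by (simp add: power_mult_distrib)
    qed
    define c where "c = complex_of_real (1 / (t - t0))"
    define N where "N = cmod c * (Hs_norm p (U t) + Hs_norm p (U t0)) + Hs_norm p (V t0)"
    have "hsb p N (\<lambda>k. c * (fcoeff (U t) k + - fcoeff (U t0) k) + - fcoeff (V t0) k)"
      unfolding N_def by (intro hsb_add cm) (auto simp: hsb_neg u v w)
    moreover have "(\<lambda>k. c * (fcoeff (U t) k + - fcoeff (U t0) k) + - fcoeff (V t0) k)
      = fcoeff (\<lambda>x. (U t x - U t0 x) / (t - t0) - V t0 x)"
      by (rule ext) (simp add: fcoeff_quotient i c_def)
    ultimately have "hsb p N (fcoeff (\<lambda>x. (U t x - U t0 x) / (t - t0) - V t0 x))" by simp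
    then show ?thesis by (rule hsb_in_Hs(1)[OF cper_quotient[OF i(1) i(1) i(2)]]) (use u v w in \<open>simp add: N_def\<close>)
  qed
  have le: "norm (fcoeff (U t) k - fcoeff (U t0) k - (t - t0) *\<^sub>R fcoeff (V t0) k) / norm (t - t0)
      \<le> Hs_norm p (\<lambda>x. (U t x - U t0 x) / (t - t0) - V t0 x)" if t: "t \<noteq> t0" for t
  proof -
    define z where "z = fcoeff (\<lambda>x. (U t x - U t0 x) / (t - t0) - V t0 x) k"
    have "A - c * q = c * (A / c - q)" if "c \<noteq> 0" for A c q :: complex
      using that by (simp add: right_diff_distrib)
    moreover have "(of_real (t - t0) :: complex) \<noteq> 0" using t by simp
    ultimately have e: "fcoeff (U t) k - fcoeff (U t0) k - (t - t0) *\<^sub>R fcoeff (V t0) k = of_real (t - t0) * z"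
      unfolding z_def fcoeff_quotient[OF i(1) i(1) i(2)] scaleR_conv_of_real by blast
    have "norm (of_real (t - t0) * z) / norm (t - t0) = 1 * cmod z"
      using t by (simp add: norm_mult del: of_real_diff)
    also have "\<dots> \<le> jb k powr p * cmod z" by (intro mult_right_mono jb_powr_ge1 p) auto
    also have "\<dots> \<le> Hs_norm p (\<lambda>x. (U t x - U t0 x) / (t - t0) - V t0 x)"
      unfolding z_def by (rule hsb_single[OF in_Hs_hsb(2,3)[OF iH]])
    finally show ?thesis unfolding e .
  qed
  show ?thesis
    unfolding has_vector_derivative_def has_derivative_iff_norm
  proof
    show "bounded_linear (\<lambda>x. x *\<^sub>R fcoeff (V t0) k)" by (rule bounded_linear_scaleR_left)
    show "((\<lambda>y. norm (fcoeff (U y) k - fcoeff (U t0) k - (y - t0) *\<^sub>R fcoeff (V t0) k) / norm (y - t0)) \<longlongrightarrow> 0) (at t0)"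
    proof (rule Lim_null_comparison[OF _ n])
      show "\<forall>\<^sub>F t in at t0. norm (norm (fcoeff (U t) k - fcoeff (U t0) k - (t - t0) *\<^sub>R fcoeff (V t0) k) / norm (t - t0))
         \<le> Hs_norm p (\<lambda>x. (U t x - U t0 x) / (t - t0) - V t0 x)"
        unfolding eventually_at_filter using le by (intro always_eventually) auto
    qed
  qed
qed

lemma solution_gsol:
  assumes s: "s > 5/2" and U: "is_global_solution s u0 U"
  shows "gsol s (\<lambda>t. fcoeff (U t))" "U t = syn (fcoeff (U t))"
proof -
  obtain V where c: "cont_Hs s U" and V: "C1_Hs_with (s - 1) U V"
    and pde: "\<And>t x. V t x + U t x * deriv (U t) x + opA_inv (deriv (\<lambda>y. 2 * mu (U t) * U t y + 1/2 * (deriv (U t) y)\<^sup>2)) x = 0"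
    using U unfolding is_global_solution_def by blast
  have i: "in_Hs s (U t)" for t using c by (simp add: cont_Hs_def)
  note h = in_Hs_hsb[OF i]
  have "asum (fcoeff (U t))" using asum_0[OF h(2,3)] s by simp
  then show "U t = syn (fcoeff (U t))" by (rule cper_eq_syn[OF h(1)])
  show "gsol s (\<lambda>t. fcoeff (U t))"
    unfolding gsol_def
  proof (intro conjI allI)
    show "symm (fcoeff (U t))" for t by (rule symm_fcoeff)
    show "\<exists>R\<ge>0. \<forall>t\<in>{-T..T}. hsb s R (fcoeff (U t))" for T
    proof -
      \<comment> \<open>Continuity of the norm supplies the radius on compact time intervals that
        \<open>gsol\<close> asks for.\<close>
      have "compact ((\<lambda>t. Hs_norm s (U t)) ` {-T..T})"
        by (intro compact_continuous_image continuous_on_subset[OF Hs_norm_continuous[OF c]]) auto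
      then obtain R where R: "\<forall>t\<in>{-T..T}. \<bar>Hs_norm s (U t)\<bar> \<le> R"
        by (auto simp: bounded_iff dest!: compact_imp_bounded)
      have "hsb s (max R 0) (fcoeff (U t))" if "t \<in> {-T..T}" for t
        by (rule hsb_mono[OF h(2,3)]) (use R that in force)
      then show ?thesis by (intro exI[of _ "max R 0"]) auto
    qed
    fix t k
    have "V t = (\<lambda>x. (- 1) * rhs (U t) x)" using pde[of t] by (auto simp: rhs_def flux_def fun_eq_iff add_eq_0_iff algebra_simps)
    then have "fcoeff (V t) k = qconv (fcoeff (U t)) (fcoeff (U t)) k"
      using rhs_props(2)[OF h s, of t k] by (simp only: fcoeff_cmult) simp
    moreover have "((\<lambda>t. fcoeff (U t) k) has_vector_derivative fcoeff (V t) k) (at t)"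
      by (rule fcoeff_has_vector_derivative[of "s - 1"]) (use V s in \<open>auto simp: C1_Hs_with_def\<close>)
    ultimately show "((\<lambda>t. fcoeff (U t) k) has_vector_derivative qconv (fcoeff (U t)) (fcoeff (U t)) k) (at t)"
      by simp
  qed
qed

lemma gsol_exists:
  assumes s: "s > 5/2" and u: "in_Hs s u0" and A: "(\<forall>x. opA u0 x \<ge> 0) \<or> (\<forall>x. opA u0 x \<le> 0)"
  shows "\<exists>a. gsol s a \<and> a 0 = fcoeff u0"
proof -
  note U = in_Hs_hsb[OF u]
  note r = regularity[OF U s]
  \<comment> \<open>At a zero of u_xx, which periodicity provides, A u equals the mean; the sign of
    A u is thus inherited by the mean.\<close>
  obtain z where z: "deriv (deriv u0) z = 0" using zero_between[OF r(2) r(5)] by blast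
  from A show ?thesis
  proof
    assume A: "\<forall>x. opA u0 x \<ge> 0"
    show ?thesis by (rule gsol_exists_pos[OF s u]) (use A[rule_format, of z] z A in \<open>auto simp: opA_def\<close>)
  next
    assume A: "\<forall>x. opA u0 x \<le> 0"
    define v where "v x = - u0 x" for x
    have fv: "fcoeff v k = - fcoeff u0 k" for k using fcoeff_cmult[of "- 1" u0 k] by (simp add: v_def[abs_def])
    have v: "in_Hs s v"
    proof (rule hsb_in_Hs(1)[OF _ _ U(3)])
      show "cper v" unfolding v_def[abs_def] by (rule cper_minus[OF U(1)])
      show "hsb s (Hs_norm s u0) (fcoeff v)" unfolding fv[abs_def] hsb_neg by (rule U(2))
    qed
    have "deriv v = (\<lambda>x. - deriv u0 x)"
      unfolding v_def[abs_def] by (intro ext DERIV_imp_deriv DERIV_minus r(1))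
    then have dv: "deriv (deriv v) x = - deriv (deriv u0) x" for x
      by (simp add: DERIV_imp_deriv[OF DERIV_minus[OF r(5)]])
    have mv: "mu v = - mu u0" by (simp add: mu_def v_def[abs_def])
    have "\<exists>a. gsol s a \<and> a 0 = fcoeff v"
      by (rule gsol_exists_pos[OF s v]) (use A[rule_format, of z] z A in \<open>auto simp: opA_def dv mv\<close>)
    then obtain a where "gsol s a" "a 0 = fcoeff v" by blast
    then show ?thesis using gsol_reverse[of s a] by (intro exI[of _ "\<lambda>t k. - a (- t) k"]) (auto simp: fv)
  qed
qed

theorem theorem5p4:
  fixes s :: real and u0 :: "real \<Rightarrow> real"
  assumes "s > 5/2"
    and "in_Hs s u0"
    and "mu u0 \<noteq> 0"
    and "(\<forall>x. opA u0 x \<ge> 0) \<or> (\<forall>x. opA u0 x \<le> 0)"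
  shows "\<exists>!U. is_global_solution s u0 U"
proof -
  note U = in_Hs_hsb[OF assms(2)]
  obtain a where a: "gsol s a" "a 0 = fcoeff u0" using gsol_exists[OF assms(1,2,4)] by blast
  have "asum (fcoeff u0)" using asum_0[OF U(2,3)] assms(1) by simp
  then have "syn (a 0) = u0" using cper_eq_syn[OF U(1)] a(2) by simp
  then have "is_global_solution s u0 (\<lambda>t. syn (a t))" using gsol_solution[OF assms(1) a(1)] by simp
  moreover have "U = (\<lambda>t. syn (a t))" if "is_global_solution s u0 U" for U
  proof
    fix t
    have "U 0 = u0" using that by (simp add: is_global_solution_def)
    then have "fcoeff (U 0) = a 0" by (simp add: a(2))
    from gsol_unique[OF assms(1) solution_gsol(1)[OF assms(1) that] a(1) this] have "fcoeff (U t) = a t" .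
    then show "U t = syn (a t)" using solution_gsol(2)[OF assms(1) that, of t] by simp
  qed
  ultimately show ?thesis by blast
qed

end
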